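(* Let $r=8$. There exists $\delta>0$ such that for every $\Omega\in\mathcal S^r_\delta$ the operator $\mathcal T_\Omega:C^r_{\mathrm{sym}}\to\ell^\infty$, $\mathcal T_\Omega\nu=(\ell_{\Omega,0}(\nu),\ell_{\Omega,1}(\nu),\dots,\ell_{\Omega,q}(\nu),\dots)$, is injective (for any choice of the marked symmetric maximal periodic orbits defining $\ell_{\Omega,q}$, $q\ge2$).
   Context: $\mathcal D^r$: strictly convex bounded open planar domains with $C^{r+1}$ boundary oriented counterclockwise; $\mathcal S^r$: those invariant under a reflection. A perimeter-$1$ domain with arc-length parameterization $\gamma$ is $\delta$-close to a circle if $\|\gamma-\gamma_{\mathbb D}\|_{C^{r+1}}\le\delta$ with $\gamma_{\mathbb D}$ the arc-length parameterization of a perimeter-$1$ disk tangent at $s=0$; a domain is $\delta$-close to a circle if its rescaling to perimeter $1$ is; $\mathcal S^r_\delta$ is the set of such domains in $\mathcal S^r$. For $\Omega\in\mathcal S^r$ (scaled to perimeter $1$) let $\gamma:\mathbb T^1\to\partial\Omega$ be the counterclockwise arc-length parameterization with $\gamma(0)$ the marked point (one of the two intersections of a fixed symmetry axis with $\partial\Omega$), so $\gamma(1/2)$ is the other (auxiliary) point and $\gamma(-s)$ is the reflection of $\gamma(s)$. $C^r_{\mathrm{sym}}=\{\nu\in C^r(\mathbb T^1):\nu(s)=\nu(-s)\}$. With $\rho_\Omega$ the radius of curvature: $\ell_{\Omega,0}(\nu)=\int_0^1\nu(s)/\rho_\Omega(s)\,ds$; $\ell_{\Omega,1}(\nu)=\nu(0)$;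 for $q\ge2$, $\ell_{\Omega,q}(\nu)=\sum_{k=0}^{q-1}\nu(s_q^k)\sin\varphi_q^k$ where $\gamma(s_q^k)$ are the collision points of a marked symmetric maximal periodic orbit of rotation number $1/q$ and $\varphi_q^k$ the angles between outgoing chords and the positive tangent. Such an orbit is obtained from a maximizer $\bar{\mathbf s}$ of $L_q$ (with $L(s,s')=\|\gamma(s)-\gamma(s')\|$, $L_q(\mathbf s)=2\sum_{i=0}^{k-1}L(s_i,s_{i+1})$ on $\{0=s_0\le\dots\le s_k=1/2\}$ if $q=2k$, and $L_q(\mathbf s)=\sum_{i=0}^{k-1}2L(s_i,s_{i+1})+L(s_k,-s_k)$ on $\{0=s_0\le\dots\le s_k\le1/2\}$ if $q=2k+1$) by taking the points $\bar s_i$ together with their reflections $-\bar s_i$. *)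

theory Defs
  imports "HOL-Analysis.Analysis"
begin

text \<open>The plane is modelled as the complex numbers. Curves are maps real => complex;
functions on the circle T^1 = R/Z are 1-periodic maps on the reals.\<close>

fun vd :: "nat \<Rightarrow> (real \<Rightarrow> 'a::real_normed_vector) \<Rightarrow> real \<Rightarrow> 'a" where
  "vd 0 f = f"
| "vd (Suc k) f = (\<lambda>t. vector_derivative (vd k f) (at t))"

definition Ck :: "nat \<Rightarrow> (real \<Rightarrow> 'a::real_normed_vector) \<Rightarrow> bool" where
  "Ck m f \<longleftrightarrow>
     (\<forall>k<m. \<forall>t. (vd k f has_vector_derivative vd (Suc k) f t) (at t))
     \<and> continuous_on UNIV (vd m f)"

definition Cnorm :: "nat \<Rightarrow> (real \<Rightarrow> 'a::real_normed_vector) \<Rightarrow> real" where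
  "Cnorm m f = (\<Sum>k\<le>m. (SUP s\<in>{0..1}. norm (vd k f s)))"

definition strictly_convex_domain :: "complex set \<Rightarrow> bool" where
  "strictly_convex_domain \<Omega> \<longleftrightarrow> open \<Omega> \<and> bounded \<Omega> \<and> \<Omega> \<noteq> {} \<and> convex \<Omega> \<and>
     (\<forall>x\<in>closure \<Omega>. \<forall>y\<in>closure \<Omega>. x \<noteq> y \<longrightarrow> open_segment x y \<subseteq> \<Omega>)"

text \<open>gamma is a counterclockwise arc-length parameterization of class C^m of the boundary
  of the domain, which has perimeter 1 (unit speed, 1-periodic, injective on [0,1)).
  Counterclockwise: the left normal i*gamma' points into the domain.\<close>
definition perim1_arclen :: "nat \<Rightarrow> complex set \<Rightarrow> (real \<Rightarrow> complex) \<Rightarrow> bool" where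
  "perim1_arclen m \<Omega> \<gamma> \<longleftrightarrow> Ck m \<gamma> \<and> (\<forall>s. \<gamma> (s + 1) = \<gamma> s) \<and>
     (\<forall>s. norm (vd 1 \<gamma> s) = 1) \<and> inj_on \<gamma> {0..<1} \<and> \<gamma> ` {0..1} = frontier \<Omega> \<and>
     (\<forall>s. \<exists>e>0. \<forall>t. 0 < t \<and> t < e \<longrightarrow> \<gamma> s + complex_of_real t * \<i> * vd 1 \<gamma> s \<in> \<Omega>)"

text \<open>Arc-length parameterization of the perimeter-1 disk tangent to gamma at s = 0
  (same point and same unit tangent at s = 0, counterclockwise).\<close>
definition tangent_disk :: "(real \<Rightarrow> complex) \<Rightarrow> real \<Rightarrow> complex" where
  "tangent_disk \<gamma> s = \<gamma> 0 + vd 1 \<gamma> 0 * (exp (2 * pi * \<i> * s) - 1) / (2 * pi * \<i>)"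

text \<open>Reflection of the plane across the line through p with unit direction u.\<close>
definition reflection :: "complex \<Rightarrow> complex \<Rightarrow> complex \<Rightarrow> complex" where
  "reflection p u z = p + u\<^sup>2 * cnj (z - p)"

text \<open>Omega in S^r_delta, with c > 0 the rescaling factor to perimeter 1 and gamma the
  counterclockwise arc-length parameterization of the rescaled domain c*Omega whose
  origin gamma(0) is the marked point on a fixed symmetry axis, i.e. gamma(-s) is the
  reflection of gamma(s).\<close>
definition marked_sym_domain :: "nat \<Rightarrow> real \<Rightarrow> complex set \<Rightarrow> real \<Rightarrow> (real \<Rightarrow> complex) \<Rightarrow> bool" where
  "marked_sym_domain r \<delta> \<Omega> c \<gamma> \<longleftrightarrow>
     strictly_convex_domain \<Omega> \<and> 0 < c \<and>
     perim1_arclen (r + 1) ((\<lambda>z. c *\<^sub>R z) ` \<Omega>) \<gamma> \<and>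
     (\<exists>\<eta>. perim1_arclen (r + 1) ((\<lambda>z. c *\<^sub>R z) ` \<Omega>) \<eta> \<and>
          Cnorm (r + 1) (\<lambda>s. \<eta> s - tangent_disk \<eta> s) \<le> \<delta>) \<and>
     (\<exists>p u. norm u = 1 \<and> reflection p u ` \<Omega> = \<Omega> \<and>
          (\<forall>s. \<gamma> (- s) = reflection (c *\<^sub>R p) u (\<gamma> s)))"

definition Csym :: "nat \<Rightarrow> (real \<Rightarrow> real) \<Rightarrow> bool" where
  "Csym r \<nu> \<longleftrightarrow> Ck r \<nu> \<and> (\<forall>s. \<nu> (s + 1) = \<nu> s) \<and> (\<forall>s. \<nu> (- s) = \<nu> s)"

definition curvature :: "(real \<Rightarrow> complex) \<Rightarrow> real \<Rightarrow> real" where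
  "curvature \<gamma> s = Im (cnj (vd 1 \<gamma> s) * vd 2 \<gamma> s)"

definition radius_curv :: "(real \<Rightarrow> complex) \<Rightarrow> real \<Rightarrow> real" where
  "radius_curv \<gamma> s = 1 / curvature \<gamma> s"

definition chordL :: "(real \<Rightarrow> complex) \<Rightarrow> real \<Rightarrow> real \<Rightarrow> real" where
  "chordL \<gamma> s s' = norm (\<gamma> s - \<gamma> s')"

definition adm :: "nat \<Rightarrow> (nat \<Rightarrow> real) \<Rightarrow> bool" where
  "adm q s \<longleftrightarrow> s 0 = 0 \<and> (\<forall>i < q div 2. s i \<le> s (Suc i)) \<and>
     (if even q then s (q div 2) = 1/2 else s (q div 2) \<le> 1/2)"

definition Lq :: "(real \<Rightarrow> complex) \<Rightarrow> nat \<Rightarrow> (nat \<Rightarrow> real) \<Rightarrow> real" where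
  "Lq \<gamma> q s = (if even q then 2 * (\<Sum>i < q div 2. chordL \<gamma> (s i) (s (Suc i)))
     else (\<Sum>i < q div 2. 2 * chordL \<gamma> (s i) (s (Suc i))) + chordL \<gamma> (s (q div 2)) (- s (q div 2)))"

definition is_Lq_max :: "(real \<Rightarrow> complex) \<Rightarrow> nat \<Rightarrow> (nat \<Rightarrow> real) \<Rightarrow> bool" where
  "is_Lq_max \<gamma> q s \<longleftrightarrow> adm q s \<and> (\<forall>t. adm q t \<longrightarrow> Lq \<gamma> q t \<le> Lq \<gamma> q s)"

text \<open>Collision parameters s_q^j, j = 0..q-1, in counterclockwise order:
  s_0, ..., s_k followed by the reflections -s_{q-j}.\<close>
definition orbit_pt :: "nat \<Rightarrow> (nat \<Rightarrow> real) \<Rightarrow> nat \<Rightarrow> real" where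
  "orbit_pt q s j = (if j \<le> q div 2 then s j else - s (q - j))"

definition sin_angle :: "(real \<Rightarrow> complex) \<Rightarrow> real \<Rightarrow> real \<Rightarrow> real" where
  "sin_angle \<gamma> s s' = sin (Arg ((\<gamma> s' - \<gamma> s) / vd 1 \<gamma> s))"

definition ell0 :: "(real \<Rightarrow> complex) \<Rightarrow> (real \<Rightarrow> real) \<Rightarrow> real" where
  "ell0 \<gamma> \<nu> = integral {0..1} (\<lambda>s. \<nu> s / radius_curv \<gamma> s)"

definition ellq :: "(real \<Rightarrow> complex) \<Rightarrow> nat \<Rightarrow> (nat \<Rightarrow> real) \<Rightarrow> (real \<Rightarrow> real) \<Rightarrow> real" where
  "ellq \<gamma> q s \<nu> = (\<Sum>j<q. \<nu> (orbit_pt q s j) *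
       sin_angle \<gamma> (orbit_pt q s j) (orbit_pt q s (Suc j mod q)))"

text \<open>The operator T_Omega; sigma q is the chosen maximizer defining the q-th orbit.\<close>
definition T_op :: "(real \<Rightarrow> complex) \<Rightarrow> (nat \<Rightarrow> nat \<Rightarrow> real) \<Rightarrow> (real \<Rightarrow> real) \<Rightarrow> nat \<Rightarrow> real" where
  "T_op \<gamma> \<sigma> \<nu> q = (if q = 0 then ell0 \<gamma> \<nu> else if q = 1 then \<nu> 0 else ellq \<gamma> q (\<sigma> q) \<nu>)"

end

theory Submission
  imports Defs
begin

text \<open>
  Write the boundary in terms of its tangent angle, with radius of curvature \<open>f\<^sup>3\<close>, and let \<open>x\<close> be the Lazutkin
  coordinate \<open>dx = f d\<theta>\<close>, normalised to have period \<open>1\<close>. The reflection law and a Taylor expansion of the angles of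
  a chord show that the Lazutkin lengths of consecutive chords of a \<open>q\<close>-gon orbit differ by \<open>O(\<epsilon> / q\<^sup>4)\<close>, where
  \<open>\<epsilon>\<close> measures the distance from a circle. Hence the collision points are \<open>x\<^sub>j = j / q + d\<^sub>j\<close>, where \<open>d\<close> has total
  variation \<open>O(\<epsilon> / q\<^sup>2)\<close>, and \<open>f sin \<phi>\<^sub>j\<close> is independent of \<open>j\<close> up to a relative error \<open>O(\<epsilon> / q\<^sup>2)\<close>.

  So for \<open>u = \<nu> / f\<close> the functionals say that the mean of \<open>u\<close>, the value \<open>u 0\<close> and almost uniform averages of \<open>u\<close>
  over \<open>q\<close> points vanish. Let \<open>a\<^sub>n\<close> be the cosine coefficients of \<open>u\<close>, with \<open>|a\<^sub>n| \<le> M / n\<^sup>2\<close>. The average over exactly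
  equidistant points is \<open>a\<^sub>q + a\<^sub>2\<^sub>q + a\<^sub>3\<^sub>q + \<dots>\<close>, and since \<open>1/4 + 1/9 + \<dots> \<le> 3/4\<close> its vanishing improves the bound
  on \<open>|a\<^sub>q|\<close> to \<open>3/4 M / q\<^sup>2\<close>. By Abel summation, which is where the bound on the total variation enters,
  the perturbation adds at most \<open>1/8 M / q\<^sup>2\<close>. Iterating, all \<open>a\<^sub>n\<close> vanish.
\<close>

section \<open>Elementary estimates\<close>

text \<open>One \<open>\<epsilon>\<close> has to serve every \<open>q \<ge> 2\<close>, so nothing
  may be asymptotic in \<open>q\<close>: the chord estimates hold up to half-angle
  \<open>17/10\<close>, beyond the \<open>pi / 2\<close> of a \<open>2\<close>-gon, and all
  constants are explicit. A bound on the single displacements \<open>d\<close> would not do. To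
  first order they change the \<open>n\<close>-th cosine average by a multiple of
  \<open>n * \<epsilon> / q\<^sup>2\<close>; weighted with \<open>M / n\<^sup>2\<close> and summed
  over frequencies up to order \<open>q\<^sup>2\<close>, this costs a factor \<open>log q\<close>.
  The bound on the total variation inserts a weight that is large only for \<open>n\<close> close to
  a multiple of \<open>q\<close>, and then the sum is bounded uniformly in \<open>q\<close>. The
  mean of \<open>u\<close> removes the coefficient of order \<open>0\<close>, and
  \<open>u 0 = 0\<close> takes the place of \<open>q = 1\<close>. Two things have to be earned
  before angles can be expanded. Closeness to a circle is given for some arc-length parametrisation,
  not for the one starting at the marked point. And a maximizer is taken over a closed set of
  ordered points, so coinciding points must be excluded before the reflection law is
  available.\<close>

lemma periodic_add_int:
  fixes f :: "real \<Rightarrow> 'a"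
  assumes per: "\<And>x. f (x + 1) = f x"
  shows "f (x + real_of_int n) = f x"
proof -
  have per': "f (x + real n) = f x" for x and n :: nat
  proof (induction n)
    case (Suc n) then show ?case using per[of "x + real n"] by (simp add: algebra_simps)
  qed simp
  show ?thesis
  proof (cases "n \<ge> 0")
    case True then show ?thesis using per'[of x "nat n"] by simp
  next
    case False then show ?thesis using per'[of "x + real_of_int n" "nat (- n)"] by simp
  qed
qed

lemma periodic_frac:
  fixes f :: "real \<Rightarrow> 'a"
  assumes per: "\<And>x. f (x + 1) = f x"
  shows "f x = f (frac x)"
  using periodic_add_int[of f "frac x" "\<lfloor>x\<rfloor>"] per by (simp add: frac_def)


lemma norm_cis_minus_one: "norm (cis t - 1) = 2 * \<bar>sin (t / 2)\<bar>"
proof -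
  have "(norm (cis t - 1))\<^sup>2 = 2 - 2 * cos t"
    unfolding cmod_power2 using sin_cos_squared_add[of t] by (simp add: power2_eq_square algebra_simps)
  also have "\<dots> = (2 * \<bar>sin (t / 2)\<bar>)\<^sup>2"
    using cos_double_sin[of "t/2"] by (simp add: power_mult_distrib)
  finally show ?thesis by (subst (asm) power2_eq_iff_nonneg) auto
qed

lemma cos_minus_one_le: "\<bar>cos t - 1\<bar> \<le> t\<^sup>2 / 2" for t :: real
proof -
  have "\<bar>sin (t/2)\<bar> \<le> \<bar>t/2\<bar>" by (rule abs_sin_x_le_abs_x)
  then have "(sin (t/2))\<^sup>2 \<le> (t/2)\<^sup>2" by (rule abs_le_square_iff[THEN iffD1])
  then show ?thesis using cos_double_sin[of "t/2"] by (simp add: power_divide)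
qed

text \<open>Follows from \<open>sin x \<ge> x - x ^ 3 / 6\<close> and
  \<open>x\<^sup>2 \<le> 3\<close>. The range passes \<open>pi / 2\<close> because the half-angles
  of chords are only known to be at most \<open>17/10\<close>.\<close>

lemma sin_ge_half:
  fixes x :: real
  assumes "0 \<le> x" "x \<le> 17/10"
  shows "sin x \<ge> x / 2"
proof -
  have "\<bar>sin x - (\<Sum>m<3. sin_coeff m * x ^ m)\<bar> \<le> inverse (fact 3) * \<bar>x\<bar> ^ 3"
    by (rule Maclaurin_sin_bound)
  then have "\<bar>sin x - x\<bar> \<le> x ^ 3 / 6"
    using assms by (simp add: numeral_3_eq_3 sin_coeff_def power3_eq_cube)
  moreover have "x ^ 3 \<le> 3 * x"
  proof -
    have "x * x \<le> (17/10) * (17/10)" using assms by (intro mult_mono) auto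
    then have "x * (x * x) \<le> x * 3" using assms by (intro mult_left_mono) auto
    then show ?thesis by (simp add: power3_eq_cube mult_ac)
  qed
  ultimately show ?thesis by linarith
qed

lemma abs_mult_le: "\<bar>x\<bar> \<le> X \<Longrightarrow> \<bar>y\<bar> \<le> Y \<Longrightarrow> \<bar>x * y\<bar> \<le> X * (Y::real)"
  unfolding abs_mult by (intro mult_mono) auto

lemma taylor2_bound:
  fixes g g1 g2 :: "real \<Rightarrow> real"
  assumes d: "\<And>t. (g has_real_derivative g1 t) (at t)" "\<And>t. (g1 has_real_derivative g2 t) (at t)"
    and B: "\<And>t. \<bar>g2 t\<bar> \<le> B"
  shows "\<bar>g (a + t) - (g a + g1 a * t)\<bar> \<le> B * t\<^sup>2 / 2"
proof -
  \<comment> \<open>The list indexes the named derivatives by their order, as the Maclaurin theorem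
    requires.\<close>
  let ?diff = "\<lambda>m x. ([g, g1, g2] ! m) (a + x)"
  have sh: "((\<lambda>x. h (a + x)) has_real_derivative h' (a + x)) (at x)"
    if "\<And>t. (h has_real_derivative h' t) (at t)" for h h' :: "real \<Rightarrow> real" and x
    using DERIV_shift[of h "h' (a + x)" x a] that by (simp add: add.commute)
  have "\<exists>s. \<bar>s\<bar> \<le> \<bar>t\<bar> \<and> ?diff 0 t = (\<Sum>m<2. ?diff m 0 / fact m * t ^ m) + ?diff 2 s / fact 2 * t ^ 2"
    by (rule Maclaurin_bi_le[of ?diff "?diff 0"])
       (use sh[OF d(1)] sh[OF d(2)] in \<open>auto simp: less_Suc_eq numeral_2_eq_2\<close>)
  then obtain s where "g (a + t) = g a + g1 a * t + g2 (a + s) / 2 * t\<^sup>2"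
    by (auto simp: numeral_2_eq_2)
  then have "\<bar>g (a + t) - (g a + g1 a * t)\<bar> = \<bar>g2 (a + s)\<bar> * (t\<^sup>2 / 2)" by (simp add: abs_mult)
  also have "\<dots> \<le> B * (t\<^sup>2 / 2)" by (intro mult_right_mono B) auto
  finally show ?thesis by simp
qed

lemma taylor3_bound:
  fixes g g1 g2 g3 :: "real \<Rightarrow> real"
  assumes d: "\<And>t. (g has_real_derivative g1 t) (at t)" "\<And>t. (g1 has_real_derivative g2 t) (at t)"
      "\<And>t. (g2 has_real_derivative g3 t) (at t)"
    and B: "\<And>t. \<bar>g3 t\<bar> \<le> B"
  shows "\<bar>g (a + t) - (g a + g1 a * t + g2 a * t\<^sup>2 / 2)\<bar> \<le> B * \<bar>t\<bar> ^ 3 / 6"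
proof -
  let ?diff = "\<lambda>m x. ([g, g1, g2, g3] ! m) (a + x)"
  have sh: "((\<lambda>x. h (a + x)) has_real_derivative h' (a + x)) (at x)"
    if "\<And>t. (h has_real_derivative h' t) (at t)" for h h' :: "real \<Rightarrow> real" and x
    using DERIV_shift[of h "h' (a + x)" x a] that by (simp add: add.commute)
  have "\<exists>s. \<bar>s\<bar> \<le> \<bar>t\<bar> \<and> ?diff 0 t = (\<Sum>m<3. ?diff m 0 / fact m * t ^ m) + ?diff 3 s / fact 3 * t ^ 3"
    by (rule Maclaurin_bi_le[of ?diff "?diff 0"])
       (use sh[OF d(1)] sh[OF d(2)] sh[OF d(3)] in \<open>auto simp: less_Suc_eq numeral_3_eq_3\<close>)
  then obtain s where "g (a + t) = g a + g1 a * t + g2 a / 2 * t\<^sup>2 + g3 (a + s) / 6 * t ^ 3"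
    by (auto simp: numeral_3_eq_3 numeral_2_eq_2)
  then have "\<bar>g (a + t) - (g a + g1 a * t + g2 a * t\<^sup>2 / 2)\<bar> = \<bar>g3 (a + s)\<bar> * (\<bar>t\<bar> ^ 3 / 6)"
    by (simp add: abs_mult power_abs)
  also have "\<dots> \<le> B * (\<bar>t\<bar> ^ 3 / 6)" by (intro mult_right_mono B) auto
  finally show ?thesis by simp
qed

lemma taylor4_bound:
  fixes g g1 g2 g3 g4 :: "real \<Rightarrow> real"
  assumes d: "\<And>t. (g has_real_derivative g1 t) (at t)" "\<And>t. (g1 has_real_derivative g2 t) (at t)"
      "\<And>t. (g2 has_real_derivative g3 t) (at t)" "\<And>t. (g3 has_real_derivative g4 t) (at t)"
    and B: "\<And>t. \<bar>g4 t\<bar> \<le> B"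
  shows "\<bar>g (a + t) - (g a + g1 a * t + g2 a * t\<^sup>2 / 2 + g3 a * t ^ 3 / 6)\<bar> \<le> B * t ^ 4 / 24"
proof -
  let ?diff = "\<lambda>m x. ([g, g1, g2, g3, g4] ! m) (a + x)"
  have sh: "((\<lambda>x. h (a + x)) has_real_derivative h' (a + x)) (at x)"
    if "\<And>t. (h has_real_derivative h' t) (at t)" for h h' :: "real \<Rightarrow> real" and x
    using DERIV_shift[of h "h' (a + x)" x a] that by (simp add: add.commute)
  have "\<exists>s. \<bar>s\<bar> \<le> \<bar>t\<bar> \<and> ?diff 0 t = (\<Sum>m<4. ?diff m 0 / fact m * t ^ m) + ?diff 4 s / fact 4 * t ^ 4"
    by (rule Maclaurin_bi_le[of ?diff "?diff 0"])
       (use sh[OF d(1)] sh[OF d(2)] sh[OF d(3)] sh[OF d(4)] in \<open>auto simp: less_Suc_eq eval_nat_numeral\<close>)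
  then obtain s where "g (a + t) = g a + g1 a * t + g2 a / 2 * t\<^sup>2 + g3 a / 6 * t ^ 3 + g4 (a + s) / 24 * t ^ 4"
    by (auto simp: eval_nat_numeral)
  then have "\<bar>g (a + t) - (g a + g1 a * t + g2 a * t\<^sup>2 / 2 + g3 a * t ^ 3 / 6)\<bar> = \<bar>g4 (a + s)\<bar> * (t ^ 4 / 24)"
    by (simp add: abs_mult)
  also have "\<dots> \<le> B * (t ^ 4 / 24)" by (intro mult_right_mono B) auto
  finally show ?thesis by simp
qed

text \<open>In the slope of a chord, \<open>sin w - w * cos w\<close> appears in the numerator and
  \<open>sin w\<close> in the denominator. Replacing the former by
  \<open>w\<^sup>2 / 3 * sin w\<close> makes the sines cancel and leaves a rational expression in
  \<open>w\<close>.\<close>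

lemma sin_minus_cos_expansion:
  fixes w :: real
  assumes "0 \<le> w"
  shows "\<bar>sin w - w * cos w - w\<^sup>2 / 3 * sin w\<bar> \<le> w ^ 5"
proof -
  have s5: "\<bar>sin w - (w - w ^ 3 / 6)\<bar> \<le> w ^ 5 / 120"
  proof -
    have "sin_coeff 3 = - 1 / 6" "sin_coeff 4 = 0" "sin_coeff 2 = 0" "sin_coeff 1 = 1"
      by (simp_all add: sin_coeff_def fact_numeral)
    moreover have "{..<5} = {0,1,2,3,4::nat}" by auto
    ultimately have "(\<Sum>m<5. sin_coeff m * w ^ m) = w - w ^ 3 / 6" by simp
    then show ?thesis using Maclaurin_sin_bound[of w 5] assms by (simp add: fact_numeral)
  qed
  have s3: "\<bar>sin w - w\<bar> \<le> w ^ 3 / 6"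
    using Maclaurin_sin_bound[of w 3] assms by (simp add: eval_nat_numeral sin_coeff_def)
  obtain t where "cos w = (\<Sum>m<4. cos_coeff m * w ^ m) + (cos (t + 1/2 * real 4 * pi) / fact 4) * w ^ 4"
    using Maclaurin_cos_expansion[of w 4] by blast
  then have "cos w - (1 - w\<^sup>2 / 2) = cos (t + 1/2 * real 4 * pi) * (w ^ 4 / 24)"
  proof -
    assume *: "cos w = (\<Sum>m<4. cos_coeff m * w ^ m) + (cos (t + 1/2 * real 4 * pi) / fact 4) * w ^ 4"
    have "cos_coeff 3 = 0" "cos_coeff 2 = - 1 / 2" "cos_coeff 1 = 0"
      by (simp_all add: cos_coeff_def fact_numeral)
    moreover have "{..<4} = {0,1,2,3::nat}" by auto
    ultimately have "(\<Sum>m<4. cos_coeff m * w ^ m) = 1 - w\<^sup>2 / 2" by simp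
    then show ?thesis using * by (simp add: fact_numeral)
  qed
  then have c4: "\<bar>cos w - (1 - w\<^sup>2 / 2)\<bar> \<le> 1 * (w ^ 4 / 24)"
    by (simp only: abs_mult_le abs_cos_le_one) (rule abs_mult_le, auto)
  have "sin w - w * cos w - w\<^sup>2 / 3 * sin w
     = (sin w - (w - w ^ 3 / 6)) - w * (cos w - (1 - w\<^sup>2 / 2)) - w\<^sup>2 / 3 * (sin w - w)"
    by (simp add: algebra_simps power2_eq_square power3_eq_cube diff_divide_distrib)
  moreover have "\<bar>w * (cos w - (1 - w\<^sup>2 / 2))\<bar> \<le> w * (1 * (w ^ 4 / 24))"
    using assms c4 by (intro abs_mult_le) auto
  moreover have "\<bar>w\<^sup>2 / 3 * (sin w - w)\<bar> \<le> w\<^sup>2 / 3 * (w ^ 3 / 6)"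
    using assms s3 by (intro abs_mult_le) auto
  moreover have "w * (1 * (w ^ 4 / 24)) = w ^ 5 / 24" "w\<^sup>2 / 3 * (w ^ 3 / 6) = w ^ 5 / 18"
    by (simp_all add: eval_nat_numeral)
  moreover have "w ^ 5 \<ge> 0" using assms by simp
  ultimately show ?thesis using s5 by linarith
qed

lemma arctan_minus_self_le:
  fixes y :: real
  assumes "\<bar>y\<bar> \<le> 1"
  shows "\<bar>arctan y - y\<bar> \<le> y\<^sup>2"
proof -
  have "norm ((arctan y - y) - (arctan 0 - 0)) \<le> y\<^sup>2 * norm (y - 0)"
  proof (rule field_differentiable_bound[of "{-\<bar>y\<bar>..\<bar>y\<bar>}" _ "\<lambda>z. 1 / (1 + z\<^sup>2) - 1"])
    fix z assume z: "z \<in> {-\<bar>y\<bar>..\<bar>y\<bar>}"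
    have p: "1 + z\<^sup>2 > 0" by (rule add_pos_nonneg) auto
    show "((\<lambda>z. arctan z - z) has_real_derivative 1 / (1 + z\<^sup>2) - 1) (at z within {- \<bar>y\<bar>..\<bar>y\<bar>})"
      using p by (auto intro!: derivative_eq_intros simp: inverse_eq_divide)
    have "1 / (1 + z\<^sup>2) - 1 = - (z\<^sup>2 / (1 + z\<^sup>2))" using p by (simp add: field_simps)
    then have "norm (1 / (1 + z\<^sup>2) - 1) = z\<^sup>2 / (1 + z\<^sup>2)" using p by simp
    also have "\<dots> \<le> z\<^sup>2 / 1" using p by (intro divide_left_mono) auto
    also have "\<dots> \<le> y\<^sup>2" using z abs_le_square_iff[of z y] by auto
    finally show "norm (1 / (1 + z\<^sup>2) - 1) \<le> y\<^sup>2" .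
  qed auto
  then have "\<bar>arctan y - y\<bar> \<le> y\<^sup>2 * \<bar>y\<bar>" by simp
  also have "\<dots> \<le> y\<^sup>2 * 1" using assms by (intro mult_left_mono) auto
  finally show ?thesis by simp
qed

section \<open>Cosine series\<close>

text \<open>Multiplication by \<open>cos (2 * pi * x)\<close> turns a cosine moment into the mean of
  its two neighbours, so vanishing passes on to every power of the cosine.\<close>

lemma cos_moments_zero:
  fixes v :: "real \<Rightarrow> real"
  assumes cv: "continuous_on {0..1} v"
    and z: "\<And>n::nat. integral {0..1} (\<lambda>x. v x * cos (2 * pi * n * x)) = 0"
  shows "integral {0..1} (\<lambda>x. v x * cos (2 * pi * x) ^ k * cos (2 * pi * real m * x)) = 0"
proof (induction k arbitrary: m)
  case 0
  then show ?case using z[of m] by simp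
next
  case (Suc k)
  have int: "(\<lambda>x. v x * cos (2 * pi * x) ^ k * cos (2 * pi * real m * x)) integrable_on {0..1}" for m
    by (intro integrable_continuous_interval continuous_intros cv)
  show ?case
  proof (cases m)
    case 0
    then show ?thesis using Suc.IH[of 1] by (simp add: algebra_simps)
  next
    case (Suc l)
    have e: "v x * cos (2 * pi * x) ^ Suc k * cos (2 * pi * real m * x) =
       (1/2) * (v x * cos (2 * pi * x) ^ k * cos (2 * pi * real (m+1) * x)
              + v x * cos (2 * pi * x) ^ k * cos (2 * pi * real l * x))" for x
    proof -
      have "cos (2 * pi * real (m+1) * x) + cos (2 * pi * real l * x)
          = 2 * cos (2 * pi * x) * cos (2 * pi * real m * x)"
        using cos_times_cos[of "2 * pi * real m * x" "2 * pi * x"] Suc by (simp add: algebra_simps)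
      then show ?thesis by (simp add: distrib_left[symmetric] mult_ac)
    qed
    show ?thesis unfolding e
      using Suc.IH[of "m+1"] Suc.IH[of l] int[of "m+1"] int[of l]
      by (simp add: integral_add)
  qed
qed

text \<open>By symmetry \<open>v\<close> is a continuous function of
  \<open>cos (2 * pi * x)\<close>. A polynomial in the cosine approximates it uniformly, and
  \<open>v\<close> is orthogonal to that polynomial, so the integral of \<open>v\<^sup>2\<close> is
  arbitrarily small.\<close>

lemma even_periodic_eq_cos_moments_zero:
  fixes v :: "real \<Rightarrow> real"
  assumes cv: "continuous_on UNIV v"
    and per: "\<And>x. v (x + 1) = v x" and ev: "\<And>x. v (- x) = v x"
    and z: "\<And>n::nat. integral {0..1} (\<lambda>x. v x * cos (2 * pi * n * x)) = 0"
  shows "v x = 0"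
proof -
  have cv01: "continuous_on {0..1} v" using cv continuous_on_subset by blast
  define B where "B = integral {0..1} (\<lambda>x. \<bar>v x\<bar>)"
  have B0: "0 \<le> B" unfolding B_def by (intro integral_nonneg integrable_continuous_interval continuous_intros cv01) auto
  have le: "integral {0..1} (\<lambda>x. v x * v x) \<le> e * B" if "e > 0" for e
  proof -
    have c1: "continuous_on {-1..1} (\<lambda>y. v (arccos y / (2 * pi)))"
      by (rule continuous_on_compose2[OF cv]) (auto intro!: continuous_intros)
    obtain p where p: "real_polynomial_function p"
      "\<And>y. y \<in> {-1..1} \<Longrightarrow> \<bar>v (arccos y / (2 * pi)) - p y\<bar> < e"
      using Stone_Weierstrass_real_polynomial_function[OF compact_Icc c1 \<open>e > 0\<close>] by metis
    obtain a n where an: "p = (\<lambda>y. \<Sum>i\<le>n. a i * y ^ i)"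
      using p(1) unfolding real_polynomial_function_iff_sum by auto
    have cl1: "\<bar>v x - p (cos (2 * pi * x))\<bar> < e" if "0 \<le> x" "x \<le> 1/2" for x
    proof -
      have "arccos (cos (2 * pi * x)) = 2 * pi * x" using that by (intro arccos_cos) auto
      then show ?thesis using p(2)[of "cos (2 * pi * x)"] by simp
    qed
    have cl: "\<bar>v x - p (cos (2 * pi * x))\<bar> \<le> e" if "x \<in> {0..1}" for x
    proof (cases "x \<le> 1/2")
      case True then show ?thesis using cl1[of x] that by auto
    next
      case False
      have "v (1 - x) = v x" using per[of "- x"] ev[of x] by (simp add: algebra_simps)
      moreover have "cos (2 * pi * (1 - x)) = cos (2 * pi * x)"
        using cos_diff[of "2*pi" "2*pi*x"] by (simp add: algebra_simps)
      ultimately show ?thesis using cl1[of "1 - x"] that False by auto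
    qed
    have cp: "continuous_on {0..1} (\<lambda>x. p (cos (2 * pi * x)))" unfolding an by (intro continuous_intros)
    have "integral {0..1} (\<lambda>x. v x * p (cos (2 * pi * x)))
        = integral {0..1} (\<lambda>x. \<Sum>i\<le>n. a i * (v x * cos (2 * pi * x) ^ i * cos (2 * pi * real 0 * x)))"
      unfolding an by (simp add: sum_distrib_left mult_ac)
    also have "\<dots> = (\<Sum>i\<le>n. a i * integral {0..1} (\<lambda>x. v x * cos (2 * pi * x) ^ i * cos (2 * pi * real 0 * x)))"
      by (subst integral_sum) (auto intro!: integrable_continuous_interval continuous_intros cv01)
    also have "\<dots> = 0" by (simp only: cos_moments_zero[OF cv01 z]) simp
    finally have vp: "integral {0..1} (\<lambda>x. v x * p (cos (2 * pi * x))) = 0" .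
    have "integral {0..1} (\<lambda>x. v x * v x) = integral {0..1} (\<lambda>x. v x * v x - v x * p (cos (2 * pi * x)))"
      by (subst integral_diff) (auto intro!: integrable_continuous_interval continuous_intros cv01 cp simp: vp)
    also have "\<dots> \<le> integral {0..1} (\<lambda>x. e * \<bar>v x\<bar>)"
    proof (intro integral_le integrable_continuous_interval continuous_intros cv01 cp)
      fix x :: real assume x: "x \<in> {0..1}"
      have "v x * v x - v x * p (cos (2 * pi * x)) \<le> \<bar>v x * (v x - p (cos (2 * pi * x)))\<bar>"
        by (simp add: algebra_simps)
      also have "\<dots> \<le> e * \<bar>v x\<bar>" using mult_right_mono[OF cl[OF x], of "\<bar>v x\<bar>"] by (simp add: abs_mult mult.commute)
      finally show "v x * v x - v x * p (cos (2 * pi * x)) \<le> e * \<bar>v x\<bar>" .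
    qed
    also have "\<dots> = e * B" unfolding B_def by simp
    finally show ?thesis .
  qed
  have "integral {0..1} (\<lambda>x. v x * v x) \<le> 0"
  proof (rule field_le_epsilon)
    fix e :: real assume "e > 0"
    have "integral {0..1} (\<lambda>x. v x * v x) \<le> e / (B + 1) * B" using le[of "e/(B+1)"] B0 \<open>e > 0\<close> by auto
    also have "\<dots> \<le> e" using B0 \<open>e > 0\<close> by (simp add: field_simps)
    finally show "integral {0..1} (\<lambda>x. v x * v x) \<le> 0 + e" by simp
  qed
  moreover have "integral {0..1} (\<lambda>x. v x * v x) \<ge> 0"
    by (rule integral_nonneg[OF integrable_continuous_interval[OF continuous_on_mult[OF cv01 cv01]]]) simp
  ultimately have "integral {0..1} (\<lambda>x. v x * v x) = 0" by simp
  then have v0: "v x = 0" if "x \<in> {0..1}" for x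
    using integral_eq_0_iff[of 0 1 "\<lambda>x. v x * v x"] that continuous_on_mult[OF cv01 cv01] by simp
  have "v x = v (frac x)" by (rule periodic_frac[where f = v, OF per])
  also have "\<dots> = 0" using frac_ge_0[of x] frac_lt_1[of x] by (intro v0) auto
  finally show ?thesis .
qed

lemma integral_cos_2pi:
  fixes n :: int
  assumes "n \<noteq> 0"
  shows "((\<lambda>x. cos (2 * pi * real_of_int n * x)) has_integral 0) {0..1}"
proof -
  have "((\<lambda>x. cos (2 * pi * real_of_int n * x)) has_integral
        (sin (2 * pi * real_of_int n * 1) / (2 * pi * real_of_int n) - sin (2 * pi * real_of_int n * 0) / (2 * pi * real_of_int n))) {0..1}"
    using assms by (intro fundamental_theorem_of_calculus)
      (auto intro!: derivative_eq_intros simp: has_real_derivative_iff_has_vector_derivative[symmetric])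
  moreover have "sin (2 * pi * real_of_int n) = 0"
    using sin_zero_iff_int2 by (metis mult.assoc mult.commute of_int_mult of_int_numeral)
  ultimately show ?thesis by simp
qed

lemma integral_cos_cos:
  fixes m n :: nat
  shows "((\<lambda>x. cos (2 * pi * m * x) * cos (2 * pi * n * x)) has_integral
     (if m = n then if n = 0 then 1 else 1/2 else 0)) {0..1}"
proof -
  have c: "((\<lambda>x. cos (2 * pi * real_of_int k * x)) has_integral (if k = 0 then 1 else 0)) {0..1}" for k
    using integral_cos_2pi[of k] has_integral_const_real[of "1::real" 0 1] by auto
  have "((\<lambda>x. (1/2) * (cos (2 * pi * real_of_int (int m - int n) * x) + cos (2 * pi * real_of_int (int m + int n) * x)))
     has_integral (1/2) * ((if int m - int n = 0 then 1 else 0) + (if int m + int n = 0 then 1 else 0))) {0..1}"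
    by (intro has_integral_mult_right has_integral_add c)
  moreover have "(1/2) * (cos (2 * pi * real_of_int (int m - int n) * x) + cos (2 * pi * real_of_int (int m + int n) * x))
     = cos (2 * pi * m * x) * cos (2 * pi * n * x)" for x
    using cos_times_cos[of "2 * pi * m * x" "2 * pi * n * x"] by (simp add: algebra_simps)
  ultimately have "((\<lambda>x. cos (2 * pi * m * x) * cos (2 * pi * n * x)) has_integral
    (1/2) * ((if int m - int n = 0 then 1 else 0) + (if int m + int n = 0 then 1 else 0))) {0..1}" by simp
  moreover have "(1/2) * ((if int m - int n = 0 then 1 else 0) + (if int m + int n = 0 then 1 else 0)) =
     (if m = n then if n = 0 then 1 else 1/2 else (0::real))" by auto
  ultimately show ?thesis by simp
qed

text \<open>Two integrations by parts give the quadratic decay, hence uniform convergence. The sum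
  of the series has the same cosine moments as \<open>u\<close> and therefore equals it.\<close>

lemma cosine_series:
  fixes u u1 u2 :: "real \<Rightarrow> real"
  assumes per: "\<And>x. u (x + 1) = u x" and ev: "\<And>x. u (- x) = u x"
    and d1: "\<And>x. (u has_real_derivative u1 x) (at x)"
    and d2: "\<And>x. (u1 has_real_derivative u2 x) (at x)"
    and c2: "continuous_on UNIV u2"
  obtains a M where "a 0 = integral {0..1} u" "\<And>n::nat. n \<ge> 1 \<Longrightarrow> \<bar>a n\<bar> \<le> M / (real n)\<^sup>2"
    "\<And>x. (\<lambda>n. a n * cos (2 * pi * real n * x)) sums u x"
proof -
  define a where "a n = (if n = 0 then 1 else 2) * integral {0..1} (\<lambda>x. u x * cos (2 * pi * real n * x))" for n
  have cu: "continuous_on A u" for A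
    using DERIV_continuous_on[of A u u1] d1 has_field_derivative_at_within by blast
  have cu2: "continuous_on A u2" for A using c2 continuous_on_subset by blast
  have "bounded (u2 ` {0..1})" using compact_imp_bounded[OF compact_continuous_image[OF cu2 compact_Icc]] .
  then obtain B where B: "\<And>x. x \<in> {0..1} \<Longrightarrow> \<bar>u2 x\<bar> \<le> B" unfolding bounded_iff by fastforce
  have B0: "0 \<le> B" using B[of 0] by auto
  have per1: "u1 (x + 1) = u1 x" for x
  proof -
    have "((\<lambda>x. u (x + 1)) has_real_derivative u1 (x + 1)) (at x)"
      by (rule DERIV_chain2[where g = "\<lambda>x. x + 1" and Db = 1, simplified]) (auto intro!: d1 derivative_eq_intros)
    then show ?thesis using d1[of x] DERIV_unique by (simp add: per)
  qed
  have dec: "\<bar>a n\<bar> \<le> B / (real n)\<^sup>2" if n: "n \<ge> 1" for n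
  proof -
    define w where "w = 2 * pi * real n"
    have w: "w > 0" using n by (simp add: w_def)
    have s0: "sin w = 0" "cos w = 1" using sin_npi[of "2*n"] cos_npi[of "2 * n"] by (simp_all add: mult_ac w_def)
    \<comment> \<open>This antiderivative combines both integrations by parts. Its boundary values
      agree because the sine vanishes at both ends and \<open>u1\<close> is periodic.\<close>
    let ?H = "\<lambda>x. u x * sin (w * x) / w + u1 x * cos (w * x) / w\<^sup>2"
    have "((\<lambda>x. u x * cos (w * x) + u2 x * cos (w * x) / w\<^sup>2) has_integral (?H 1 - ?H 0)) {0..1}"
    proof (rule fundamental_theorem_of_calculus)
      fix x :: real
      have "(?H has_real_derivative (u x * cos (w * x) + u2 x * cos (w * x) / w\<^sup>2)) (at x)"
        using w by (auto intro!: derivative_eq_intros d1 d2 simp: field_simps power2_eq_square)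
      then show "(?H has_vector_derivative (u x * cos (w * x) + u2 x * cos (w * x) / w\<^sup>2)) (at x within {0..1})"
        using has_real_derivative_iff_has_vector_derivative has_vector_derivative_at_within by blast
    qed simp
    moreover have "?H 1 - ?H 0 = 0" using s0 per1[of 0] by simp
    ultimately have h0: "integral {0..1} (\<lambda>x. u x * cos (w * x) + u2 x * cos (w * x) / w\<^sup>2) = 0"
      by (simp add: integral_unique)
    have "integral {0..1} (\<lambda>x. u x * cos (w * x) + u2 x * cos (w * x) / w\<^sup>2)
      = integral {0..1} (\<lambda>x. u x * cos (w * x)) + integral {0..1} (\<lambda>x. u2 x * cos (w * x) / w\<^sup>2)"
      using w by (intro integral_add integrable_continuous_interval continuous_intros cu cu2) auto
    with h0 have e: "integral {0..1} (\<lambda>x. u x * cos (w * x)) = - integral {0..1} (\<lambda>x. u2 x * cos (w * x) / w\<^sup>2)" by simp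
    have "norm (integral {0..1} (\<lambda>x. u2 x * cos (w * x) / w\<^sup>2)) \<le> (B / w\<^sup>2) * (1 - 0)"
    proof (rule integral_bound)
      show "continuous_on {0..1} (\<lambda>x. u2 x * cos (w * x) / w\<^sup>2)" using w by (intro continuous_intros cu2) auto
      fix t :: real assume "t \<in> {0..1}"
      then have "\<bar>u2 t * cos (w * t)\<bar> \<le> B * 1" unfolding abs_mult by (intro mult_mono B B0) auto
      then show "norm (u2 t * cos (w * t) / w\<^sup>2) \<le> B / w\<^sup>2" using w by (simp add: divide_right_mono)
    qed simp
    then have "\<bar>a n\<bar> \<le> 2 * (B / w\<^sup>2)" using n e by (simp add: a_def w_def)
    also have "\<dots> = (2 / (2 * pi)\<^sup>2) * (B / (real n)\<^sup>2)" by (simp add: power_mult_distrib w_def)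
    also have "\<dots> \<le> 1 * (B / (real n)\<^sup>2)"
    proof (rule mult_right_mono)
      have "(2::real)\<^sup>2 \<le> (2 * pi)\<^sup>2" using pi_gt3 by (intro power_mono) auto
      then show "2 / (2 * pi)\<^sup>2 \<le> 1" using pi_gt_zero by (simp add: divide_le_eq)
    qed (use B0 in auto)
    finally show ?thesis by simp
  qed
  \<comment> \<open>At \<open>n = 0\<close> the quotient \<open>B / (real n)\<^sup>2\<close> has the
    default value \<open>0\<close>, so the constant term needs its own majorant.\<close>
  define A where "A n = (if n = 0 then \<bar>a 0\<bar> else B / (real n)\<^sup>2)" for n
  have sumA: "summable A"
  proof -
    have "summable (\<lambda>n. B * (1 / real n ^ 2))" using inverse_power_summable[of 2, where 'a=real]
      by (intro summable_mult) (simp add: inverse_eq_divide)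
    then have "summable (\<lambda>n. B * (1 / real (Suc n) ^ 2))" by (subst summable_Suc_iff)
    then have "summable (\<lambda>n. A (Suc n))" by (simp add: A_def)
    then show ?thesis by (subst (asm) summable_Suc_iff)
  qed
  define S where "S x = (\<Sum>n. a n * cos (2 * pi * real n * x))" for x
  have tb: "norm (a n * cos (2 * pi * real n * x)) \<le> A n" for n x
  proof -
    have "\<bar>a n\<bar> \<le> A n" using dec[of n] by (auto simp: A_def)
    moreover have "\<bar>a n * cos (2 * pi * real n * x)\<bar> \<le> \<bar>a n\<bar> * 1" unfolding abs_mult by (intro mult_left_mono) auto
    ultimately show ?thesis by simp
  qed
  have sm: "(\<lambda>n. a n * cos (2 * pi * real n * x)) sums S x" for x
    unfolding S_def by (rule summable_sums[OF summable_comparison_test'[OF sumA, of 0]]) (use tb in auto)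
  have ul: "uniform_limit UNIV (\<lambda>n x. \<Sum>i<n. a i * cos (2 * pi * real i * x)) S sequentially"
    unfolding S_def by (rule Weierstrass_m_test[OF _ sumA]) (use tb in auto)
  have cS: "continuous_on UNIV S"
    by (rule uniform_limit_theorem[OF _ ul]) (auto intro!: always_eventually continuous_intros)
  have cS': "continuous_on A S" for A using cS continuous_on_subset by blast
  \<comment> \<open>Uniform convergence permits integrating the partial sums; by orthogonality their
    \<open>m\<close>-th moment is constant as soon as \<open>n > m\<close>.\<close>
  have mom: "integral {0..1} (\<lambda>x. (u x - S x) * cos (2 * pi * real m * x)) = 0" for m
  proof -
    have "uniform_limit {0..1} (\<lambda>n x. (\<Sum>i<n. a i * cos (2 * pi * real i * x)) * cos (2 * pi * real m * x))
       (\<lambda>x. S x * cos (2 * pi * real m * x)) sequentially"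
    proof (rule uniform_lim_mult)
      show "uniform_limit {0..1} (\<lambda>n x. (\<Sum>i<n. a i * cos (2 * pi * real i * x))) S sequentially"
        using ul uniform_limit_on_subset by blast
      show "uniform_limit {0..1} (\<lambda>n x. cos (2 * pi * real m * x)) (\<lambda>x. cos (2 * pi * real m * x)) sequentially"
        by (intro uniform_limit_const)
      show "bounded (S ` {0..1})"
        by (rule compact_imp_bounded[OF compact_continuous_image[OF cS' compact_Icc]])
      show "bounded ((\<lambda>x. cos (2 * pi * real m * x)) ` {0..1})"
        unfolding bounded_iff by (intro exI[of _ 1]) auto
    qed
    then obtain I J where IJ: "\<And>n. ((\<lambda>x. (\<Sum>i<n. a i * cos (2 * pi * real i * x)) * cos (2 * pi * real m * x)) has_integral I n) {0..1}"
      "((\<lambda>x. S x * cos (2 * pi * real m * x)) has_integral J) {0..1}" "I \<longlonglongrightarrow> J"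
      by (rule uniform_limit_integral) (auto intro!: continuous_intros)
    let ?c = "if m = 0 then 1 else 1/2 :: real"
    have "I n = a m * ?c" if "n > m" for n
    proof -
      have "((\<lambda>x. \<Sum>i<n. a i * (cos (2 * pi * real i * x) * cos (2 * pi * real m * x))) has_integral
          (\<Sum>i<n. a i * (if i = m then if m = 0 then 1 else 1/2 else 0))) {0..1}"
        by (intro has_integral_sum has_integral_mult_right integral_cos_cos) auto
      then have "I n = (\<Sum>i<n. a i * (if i = m then if m = 0 then 1 else 1/2 else 0))"
        by (intro has_integral_unique[OF IJ(1)[of n]]) (simp only: sum_distrib_right mult.assoc)
      also have "\<dots> = (\<Sum>i<n. if i = m then a m * ?c else 0)" by (intro sum.cong) auto
      also have "\<dots> = a m * ?c" using that by (simp add: sum.delta')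
      finally show ?thesis .
    qed
    then have "I \<longlonglongrightarrow> a m * ?c"
      by (intro tendsto_eventually) (auto simp: eventually_sequentially intro!: exI[of _ "Suc m"])
    then have J: "J = a m * ?c" using IJ(3) LIMSEQ_unique by blast
    have "integral {0..1} (\<lambda>x. (u x - S x) * cos (2 * pi * real m * x))
       = integral {0..1} (\<lambda>x. u x * cos (2 * pi * real m * x)) - integral {0..1} (\<lambda>x. S x * cos (2 * pi * real m * x))"
      unfolding left_diff_distrib by (intro integral_diff integrable_continuous_interval continuous_intros cu cS')
    also have "\<dots> = 0" using IJ(2) J by (auto simp: a_def integral_unique)
    finally show ?thesis .
  qed
  have "u x - S x = 0" for x
  proof (rule even_periodic_eq_cos_moments_zero[where v = "\<lambda>x. u x - S x"])
    show "continuous_on UNIV (\<lambda>x. u x - S x)" by (intro continuous_intros cu cS)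
    have "cos (2 * pi * real n * (x + 1)) = cos (2 * pi * real n * x)" for n :: nat and x :: real
    proof -
      have "sin (2 * pi * real n) = 0" "cos (2 * pi * real n) = 1" using sin_npi[of "2*n"] cos_npi[of "2 * n"] by (simp_all add: mult_ac)
      then show ?thesis by (simp add: distrib_left cos_add)
    qed
    then show "u (x + 1) - S (x + 1) = u x - S x" for x by (simp add: S_def per)
    show "u (- x) - S (- x) = u x - S x" for x by (simp add: S_def ev)
  qed (rule mom)
  then have "u = S" by auto
  show thesis
  proof (rule that)
    show "a 0 = integral {0..1} u" by (simp add: a_def)
  qed (use dec sm \<open>u = S\<close> in auto)
qed

section \<open>Almost uniform sampling\<close>

text \<open>The inequality \<open>sin (pi * y) \<ge> y\<close> on \<open>[0, 1/2]\<close> and its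
  mirror image bound the distance from \<open>1\<close> below by twice the distance of
  \<open>r / q\<close> from \<open>0\<close> or from \<open>1\<close>. Adding both reciprocals
  avoids having to know which one is smaller.\<close>

lemma norm_root_minus_one_ge:
  fixes r q :: nat
  assumes r: "0 < r" "r < q"
  shows "0 < norm (cis (2 * pi * (real r / real q)) - 1)"
    and "1 / norm (cis (2 * pi * (real r / real q)) - 1) \<le> (real q / 2) * (1 / real r + 1 / (real q - real r))"
proof -
  have half: "sin (pi * y) \<ge> y" if "0 \<le> y" "y \<le> 1/2" for y :: real
  proof -
    have "pi * y \<le> 17/10" using mult_mono[of pi "34/10" y "1/2"] pi_less_4 that pi_approx by auto
    then have "sin (pi * y) \<ge> pi * y / 2" using that by (intro sin_ge_half) auto
    moreover have "pi * y \<ge> 2 * y" using that pi_ge_two by (intro mult_right_mono) auto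
    ultimately show ?thesis by linarith
  qed
  let ?y = "real r / real q"
  let ?n = "norm (cis (2 * pi * (real r / real q)) - 1)"
  have y: "0 < ?y" "?y < 1" using r by auto
  have n: "?n = 2 * \<bar>sin (pi * ?y)\<bar>" unfolding norm_cis_minus_one by (simp add: mult.assoc)
  have s: "?y \<le> 1/2 \<Longrightarrow> sin (pi * ?y) \<ge> ?y" using half[of ?y] y by auto
  have "sin (pi * (1 - ?y)) = sin (pi * ?y)" using sin_pi_minus[of "pi * ?y"] by (simp add: right_diff_distrib)
  then have s': "?y > 1/2 \<Longrightarrow> sin (pi * ?y) \<ge> 1 - ?y" using half[of "1 - ?y"] y by auto
  have key: "2 * ?y \<le> ?n \<or> 2 * (1 - ?y) \<le> ?n" using s s' n by force
  have y2: "0 < 2 * ?y" "0 < 2 * (1 - ?y)" using y by auto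
  show n0: "0 < ?n" using key y2 less_le_trans by blast
  have a: "1 / (2 * ?y) = (real q / 2) * (1 / real r)" using r by simp
  have b: "1 / (2 * (1 - ?y)) = (real q / 2) * (1 / (real q - real r))"
    using r by (simp add: field_simps)
  have "1 / ?n \<le> (real q / 2) * (1 / real r) \<or> 1 / ?n \<le> (real q / 2) * (1 / (real q - real r))"
    using key unfolding a[symmetric] b[symmetric] using divide_left_mono[of _ ?n 1] y2 n0 by (meson mult_pos_pos zero_le_one)
  moreover have "(real q / 2) * (1 / real r) \<ge> 0" "(real q / 2) * (1 / (real q - real r)) \<ge> 0" using r by auto
  ultimately show "1 / ?n \<le> (real q / 2) * (1 / real r + 1 / (real q - real r))"
    unfolding distrib_left by linarith
qed

lemma cis_period_mod:
  fixes n q :: nat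
  assumes "0 < q"
  shows "cis (2 * pi * (real n / real q)) = cis (2 * pi * (real (n mod q) / real q))"
proof -
  have "real n / real q = real (n div q) + real (n mod q) / real q"
    using assms by (simp add: field_simps flip: of_nat_mult of_nat_add)
  then have "cis (2 * pi * (real n / real q)) = cis (2 * pi * real (n div q)) * cis (2 * pi * (real (n mod q) / real q))"
    by (simp only: distrib_left cis_mult)
  also have "cis (2 * pi * real (n div q)) = 1" by (rule cis_multiple_2pi) auto
  finally show ?thesis by simp
qed

text \<open>The aliasing identity, as the real part of a geometric sum: equidistant sampling sees
  exactly the multiples of \<open>q\<close>.\<close>

lemma sum_cos_roots:
  fixes n q :: nat
  assumes q: "0 < q"
  shows "(\<Sum>j<q. cos (2 * pi * real n * (real j / real q))) = (if q dvd n then real q else 0)"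
proof -
  let ?z = "cis (2 * pi * (real n / real q))"
  have zj: "?z ^ j = cis (2 * pi * real n * (real j / real q))" for j
    unfolding Complex.DeMoivre by (rule arg_cong[of _ _ cis]) simp
  have "(\<Sum>j<q. cos (2 * pi * real n * (real j / real q))) = Re (\<Sum>j<q. ?z ^ j)"
    unfolding zj by simp
  also have "\<dots> = (if q dvd n then real q else 0)"
  proof (cases "q dvd n")
    case True
    then have "?z = 1" using cis_period_mod[OF q, of n] by (simp add: mod_eq_0_iff_dvd)
    then show ?thesis using True by simp
  next
    case False
    then have r: "0 < n mod q" "n mod q < q" using q by (auto simp: mod_greater_zero_iff_not_dvd)
    have z1: "?z \<noteq> 1" using norm_root_minus_one_ge(1)[OF r] cis_period_mod[OF q, of n] by auto
    have "?z ^ q = cis (2 * pi * real n)" using zj[of q] q by simp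
    also have "\<dots> = 1" by (rule cis_multiple_2pi) auto
    finally show ?thesis using z1 False by (simp add: geometric_sum)
  qed
  finally show ?thesis .
qed

lemma abel_sum_bound:
  fixes d :: "nat \<Rightarrow> real" and z :: complex
  assumes d: "d 0 = 0" "d q = 0" and z: "norm z = 1"
  shows "norm ((\<Sum>j<q. of_real (d j) * z ^ j) * (z - 1)) \<le> (\<Sum>j<q. \<bar>d (Suc j) - d j\<bar>)"
proof -
  have "(\<Sum>j<q. of_real (d j) * z ^ j) * (z - 1)
     = (\<Sum>j<q. (of_real (d (Suc j)) * z ^ Suc j - of_real (d j) * z ^ j) - of_real (d (Suc j) - d j) * z ^ Suc j)"
    unfolding sum_distrib_right by (intro sum.cong) (auto simp: algebra_simps)
  also have "\<dots> = - (\<Sum>j<q. of_real (d (Suc j) - d j) * z ^ Suc j)"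
    unfolding sum_subtractf using sum_lessThan_telescope[of "\<lambda>j. of_real (d j) * z ^ j" q] d by (simp add: sum_subtractf)
  also have "norm \<dots> \<le> (\<Sum>j<q. \<bar>d (Suc j) - d j\<bar>)"
    unfolding norm_minus_cancel
    by (rule order_trans[OF norm_sum]) (auto simp: norm_mult norm_power z simp flip: of_real_diff intro!: sum_mono)
  finally show ?thesis .
qed

lemma cos_add_expansion: "\<bar>cos (a + b) - cos a + b * sin a\<bar> \<le> b\<^sup>2" for a b :: real
proof -
  have s: "\<bar>sin b - b\<bar> \<le> b\<^sup>2 / 2"
    using Maclaurin_sin_bound[of b 2] by (simp add: numeral_2_eq_2 sin_coeff_def)
  have c: "\<bar>cos b - 1\<bar> \<le> b\<^sup>2 / 2" by (rule cos_minus_one_le)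
  have "cos (a + b) - cos a + b * sin a = cos a * (cos b - 1) - sin a * (sin b - b)"
    by (simp add: cos_add algebra_simps)
  also have "\<bar>\<dots>\<bar> \<le> \<bar>cos a\<bar> * \<bar>cos b - 1\<bar> + \<bar>sin a\<bar> * \<bar>sin b - b\<bar>"
    unfolding abs_mult[symmetric] by (rule abs_triangle_ineq4)
  also have "\<dots> \<le> 1 * (b\<^sup>2 / 2) + 1 * (b\<^sup>2 / 2)" by (intro add_mono mult_mono s c) auto
  finally show ?thesis by simp
qed

text \<open>Up to the factor \<open>q / 2\<close>, an upper bound for \<open>1 / norm (z - 1)\<close> with \<open>z\<close> the \<open>n\<close>-th power of a primitive
  \<open>q\<close>-th root of unity. If \<open>q\<close> divides \<open>n\<close>, the sine sum which it controls vanishes.\<close>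
definition near_root_weight :: "nat \<Rightarrow> nat \<Rightarrow> real" where
  "near_root_weight q n = (if q dvd n then 0 else 1 / real (n mod q) + 1 / (real q - real (n mod q)))"

lemma near_root_weight_nonneg: "0 < q \<Longrightarrow> 0 \<le> near_root_weight q n"
  using mod_less_divisor[of q n] by (auto simp: near_root_weight_def simp del: mod_less_divisor)

text \<open>The three error terms stem from the weights \<open>e\<close>, from the second-order
  remainder of the displaced cosine, and from its first-order part. Only the last grows linearly in
  \<open>\<epsilon> * n\<close>, and there Abel summation supplies
  \<open>near_root_weight\<close>.\<close>

lemma perturbed_cos_sum:
  fixes x e :: "nat \<Rightarrow> real" and q n :: nat
  assumes q: "q \<ge> 1" and eps: "0 \<le> \<epsilon>" "\<epsilon> \<le> 1"
    and x0: "x 0 = 0" and xq: "x q = 1"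
    and dx: "\<And>j. j < q \<Longrightarrow> \<bar>x (Suc j) - x j - 1 / real q\<bar> \<le> \<epsilon> / real q ^ 3"
    and e: "\<And>j. j < q \<Longrightarrow> \<bar>e j\<bar> \<le> \<epsilon> / (real q)\<^sup>2"
  shows "\<bar>(\<Sum>j<q. cos (2 * pi * real n * x j) * (1 + e j)) / real q - (if q dvd n then 1 else 0)\<bar>
     \<le> \<epsilon> / (real q)\<^sup>2 + 40 * \<epsilon>\<^sup>2 * (real n)\<^sup>2 / real q ^ 4 + 4 * \<epsilon> * real n * near_root_weight q n / (real q)\<^sup>2"
proof -
  have q0: "real q > 0" using q by simp
  define d where "d j = x j - real j / real q" for j
  define b where "b j = 2 * pi * real n * d j" for j
  define t where "t j = 2 * pi * real n * (real j / real q)" for j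
  have dd: "\<bar>d (Suc j) - d j\<bar> \<le> \<epsilon> / real q ^ 3" if "j < q" for j
  proof -
    have "d (Suc j) - d j = x (Suc j) - x j - 1 / real q" by (simp add: d_def add_divide_distrib)
    then show ?thesis using dx[OF that] by simp
  qed
  have d0: "d 0 = 0" "d q = 0" using q x0 xq by (auto simp: d_def)
  \<comment> \<open>The total variation. Since \<open>d 0 = 0\<close>, it also bounds every single
    displacement.\<close>
  have V: "(\<Sum>j<q. \<bar>d (Suc j) - d j\<bar>) \<le> \<epsilon> / (real q)\<^sup>2"
  proof -
    have "(\<Sum>j<q. \<bar>d (Suc j) - d j\<bar>) \<le> (\<Sum>j<q. \<epsilon> / real q ^ 3)" by (intro sum_mono dd) auto
    also have "\<dots> = \<epsilon> / (real q)\<^sup>2" using q0 by (simp add: power2_eq_square power3_eq_cube)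
    finally show ?thesis .
  qed
  have dj: "\<bar>d j\<bar> \<le> \<epsilon> / (real q)\<^sup>2" if "j < q" for j
  proof -
    have "d j = (\<Sum>i<j. d (Suc i) - d i)" using d0 by (simp add: sum_lessThan_telescope)
    then have "\<bar>d j\<bar> \<le> (\<Sum>i<j. \<bar>d (Suc i) - d i\<bar>)" by (metis sum_abs)
    also have "\<dots> \<le> (\<Sum>i<q. \<bar>d (Suc i) - d i\<bar>)" using that by (intro sum_mono2) auto
    finally show ?thesis using V by linarith
  qed
  have bj: "(b j)\<^sup>2 \<le> 40 * \<epsilon>\<^sup>2 * (real n)\<^sup>2 / real q ^ 4" if "j < q" for j
  proof -
    have "(b j)\<^sup>2 = (2 * pi)\<^sup>2 * (real n)\<^sup>2 * \<bar>d j\<bar>\<^sup>2" by (simp add: b_def power_mult_distrib)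
    also have "\<dots> \<le> 40 * (real n)\<^sup>2 * (\<epsilon> / (real q)\<^sup>2)\<^sup>2"
    proof (intro mult_mono power_mono dj that)
      have "pi \<le> 3.15" using pi_approx by simp
      then have "(2 * pi)\<^sup>2 \<le> (2 * 3.15)\<^sup>2" by (intro power_mono) auto
      then show "(2 * pi)\<^sup>2 \<le> 40" by (simp add: power2_eq_square)
    qed auto
    also have "\<dots> = 40 * \<epsilon>\<^sup>2 * (real n)\<^sup>2 / real q ^ 4" by (simp add: power_divide)
    finally show ?thesis .
  qed
  have T1: "\<bar>\<Sum>j<q. cos (2 * pi * real n * x j) * e j\<bar> \<le> real q * (\<epsilon> / (real q)\<^sup>2)"
  proof -
    have "\<bar>\<Sum>j<q. cos (2 * pi * real n * x j) * e j\<bar> \<le> (\<Sum>j<q. \<bar>cos (2 * pi * real n * x j) * e j\<bar>)" by (rule sum_abs)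
    also have "\<dots> \<le> (\<Sum>j<q. 1 * (\<epsilon> / (real q)\<^sup>2))" unfolding abs_mult by (intro sum_mono mult_mono e) auto
    finally show ?thesis by simp
  qed
  have T2: "\<bar>\<Sum>j<q. cos (t j + b j) - cos (t j) + b j * sin (t j)\<bar> \<le> real q * (40 * \<epsilon>\<^sup>2 * (real n)\<^sup>2 / real q ^ 4)"
  proof -
    have "\<bar>\<Sum>j<q. cos (t j + b j) - cos (t j) + b j * sin (t j)\<bar> \<le> (\<Sum>j<q. \<bar>cos (t j + b j) - cos (t j) + b j * sin (t j)\<bar>)" by (rule sum_abs)
    also have "\<dots> \<le> (\<Sum>j<q. 40 * \<epsilon>\<^sup>2 * (real n)\<^sup>2 / real q ^ 4)"
      by (intro sum_mono order_trans[OF cos_add_expansion bj]) auto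
    finally show ?thesis by simp
  qed
  have T3: "\<bar>\<Sum>j<q. b j * sin (t j)\<bar> \<le> real q * (4 * \<epsilon> * real n * near_root_weight q n / (real q)\<^sup>2)"
  proof -
    let ?z = "cis (2 * pi * (real n / real q))"
    have zj: "?z ^ j = cis (t j)" for j unfolding t_def Complex.DeMoivre by (rule arg_cong[of _ _ cis]) simp
    have im: "(\<Sum>j<q. d j * sin (t j)) = Im (\<Sum>j<q. of_real (d j) * ?z ^ j)"
      unfolding zj by simp
    have bd: "(\<Sum>j<q. b j * sin (t j)) = (2 * pi * real n) * (\<Sum>j<q. d j * sin (t j))"
      by (simp add: b_def sum_distrib_left mult_ac)
    show ?thesis
    proof (cases "q dvd n")
      case True
      then have "?z = 1" using cis_period_mod[of q n] q by (simp add: mod_eq_0_iff_dvd)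
      then have "sin (t j) = 0" for j using zj[of j] by (metis power_one cis.sel(2) one_complex.sel(2))
      then show ?thesis using True by (simp add: near_root_weight_def)
    next
      case False
      then have r: "0 < n mod q" "n mod q < q" using q by (auto simp: mod_greater_zero_iff_not_dvd)
      have z: "?z = cis (2 * pi * (real (n mod q) / real q))" using cis_period_mod[of q n] q by simp
      note ge = norm_root_minus_one_ge[OF r, folded z]
      let ?R = "near_root_weight q n"
      have R: "?R = 1 / real (n mod q) + 1 / (real q - real (n mod q))" using False by (simp add: near_root_weight_def)
      have R0: "?R \<ge> 0" using q by (simp add: near_root_weight_nonneg)
      have "norm (\<Sum>j<q. of_real (d j) * ?z ^ j) * norm (?z - 1) \<le> \<epsilon> / (real q)\<^sup>2"
        using abel_sum_bound[of d q ?z, OF d0] V by (simp add: norm_mult)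
      then have "norm (\<Sum>j<q. of_real (d j) * ?z ^ j) \<le> (\<epsilon> / (real q)\<^sup>2) * (1 / norm (?z - 1))"
        using ge(1) by (simp only: pos_le_divide_eq times_divide_eq_right mult_1_right)
      also have "\<dots> \<le> (\<epsilon> / (real q)\<^sup>2) * ((real q / 2) * ?R)"
        unfolding R using eps by (intro mult_left_mono ge(2)) auto
      finally have s: "\<bar>\<Sum>j<q. d j * sin (t j)\<bar> \<le> (\<epsilon> / (real q)\<^sup>2) * ((real q / 2) * ?R)"
        unfolding im using abs_Im_le_cmod order_trans by blast
      have "\<bar>\<Sum>j<q. b j * sin (t j)\<bar> = (2 * pi * real n) * \<bar>\<Sum>j<q. d j * sin (t j)\<bar>"
        unfolding bd by (simp add: abs_mult)
      \<comment> \<open>The \<open>8\<close> majorises \<open>2 * pi\<close>; together with the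
        \<open>2\<close> in \<open>real q / 2\<close> it produces the \<open>4\<close> of the
        claim.\<close>
      also have "\<dots> \<le> (8 * real n) * ((\<epsilon> / (real q)\<^sup>2) * ((real q / 2) * ?R))"
        using pi_less_4 by (intro mult_mono s) auto
      also have "\<dots> = real q * (4 * \<epsilon> * real n * ?R / (real q)\<^sup>2)" by simp
      finally show ?thesis .
    qed
  qed
  have tb: "2 * pi * real n * x j = t j + b j" for j by (simp add: t_def b_def d_def algebra_simps)
  have T0: "(\<Sum>j<q. cos (t j)) = (if q dvd n then real q else 0)"
    unfolding t_def using sum_cos_roots[of q n] q by simp
  have "(\<Sum>j<q. cos (2 * pi * real n * x j) * (1 + e j)) - (if q dvd n then real q else 0)
    = (\<Sum>j<q. cos (2 * pi * real n * x j) * e j) + (\<Sum>j<q. cos (t j + b j) - cos (t j) + b j * sin (t j))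
       - (\<Sum>j<q. b j * sin (t j))"
    unfolding T0[symmetric] sum.distrib[symmetric] sum_subtractf[symmetric] tb
    by (intro sum.cong) (auto simp: algebra_simps)
  then have "\<bar>(\<Sum>j<q. cos (2 * pi * real n * x j) * (1 + e j)) - (if q dvd n then real q else 0)\<bar>
    \<le> real q * (\<epsilon> / (real q)\<^sup>2 + 40 * \<epsilon>\<^sup>2 * (real n)\<^sup>2 / real q ^ 4 + 4 * \<epsilon> * real n * near_root_weight q n / (real q)\<^sup>2)"
    using T1 T2 T3 unfolding distrib_left by linarith
  moreover have "(\<Sum>j<q. cos (2 * pi * real n * x j) * (1 + e j)) / real q - (if q dvd n then 1 else 0)
    = ((\<Sum>j<q. cos (2 * pi * real n * x j) * (1 + e j)) - (if q dvd n then real q else 0)) / real q"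
    using q0 by (simp add: diff_divide_distrib)
  ultimately show ?thesis using q0 by (simp add: pos_divide_le_eq mult.commute)
qed

section \<open>Sums over the frequencies, uniform in \<open>q\<close>\<close>

lemma sum_inverse_squares_le:
  fixes N L :: nat
  assumes "N \<ge> 1"
  shows "(\<Sum>n\<in>{N..<L}. 1 / (real n)\<^sup>2) \<le> 2 / real N"
proof (cases "N \<le> L")
  case True
  have "(\<Sum>n\<in>{N..<L}. 1 / (real n)\<^sup>2) \<le> (\<Sum>n\<in>{N..<L}. (- 2 / real (Suc n)) - (- 2 / real n))"
  proof (rule sum_mono)
    fix n assume "n \<in> {N..<L}"
    then have n: "real n \<ge> 1" using assms by auto
    have "1 / (real n)\<^sup>2 = (1 + real n) / ((real n)\<^sup>2 * (1 + real n))" using n by simp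
    also have "\<dots> \<le> (2 * real n) / ((real n)\<^sup>2 * (1 + real n))" using n by (intro divide_right_mono) auto
    also have "\<dots> = (- 2 / real (Suc n)) - (- 2 / real n)"
    proof -
      have "real n \<noteq> 0" "1 + real n \<noteq> 0" using n by auto
      then show ?thesis by (simp add: divide_simps power2_eq_square)
    qed
    finally show "1 / (real n)\<^sup>2 \<le> (- 2 / real (Suc n)) - (- 2 / real n)" .
  qed
  also have "\<dots> = (- 2 / real L) - (- 2 / real N)" using True by (rule sum_Suc_diff')
  also have "\<dots> \<le> 2 / real N" by simp
  finally show ?thesis .
qed (use assms in simp)

text \<open>A bound strictly below \<open>1\<close> is what makes the later iteration contract. The
  term \<open>1/4\<close> is kept, and the rest telescopes to at most \<open>1/2\<close> through
  \<open>1 / m\<^sup>2 \<le> 1 / (m - 1) - 1 / m\<close>.\<close>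

lemma sum_inverse_squares_from_2_le:
  "(\<Sum>m\<in>{2..<L}. 1 / (real m)\<^sup>2) \<le> 3 / 4"
proof (cases "L \<le> 3")
  case True
  then have "{2..<L} \<subseteq> {2}" by auto
  then have "(\<Sum>m\<in>{2..<L}. 1 / (real m)\<^sup>2) \<le> (\<Sum>m\<in>{2}. 1 / (real m)\<^sup>2)" by (intro sum_mono2) auto
  then show ?thesis by (simp add: power2_eq_square)
next
  case False
  have "(\<Sum>m\<in>{3..<L}. 1 / (real m)\<^sup>2) \<le> (\<Sum>m\<in>{3..<L}. (- 1 / (real (Suc m) - 1)) - (- 1 / (real m - 1)))"
  proof (rule sum_mono)
    fix m assume "m \<in> {3..<L}"
    then have m: "real m \<ge> 3" by auto
    have "1 / (real m)\<^sup>2 \<le> 1 / (real m * (real m - 1))"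
      using m by (intro divide_left_mono) (auto simp: power2_eq_square)
    also have "\<dots> = (- 1 / (real (Suc m) - 1)) - (- 1 / (real m - 1))" using m by (simp add: field_simps)
    finally show "1 / (real m)\<^sup>2 \<le> (- 1 / (real (Suc m) - 1)) - (- 1 / (real m - 1))" .
  qed
  also have "\<dots> = (- 1 / (real L - 1)) - (- 1 / (real 3 - 1))"
    using False by (intro sum_Suc_diff'[of 3 L "\<lambda>m. - 1 / (real m - 1)"]) auto
  also have "\<dots> \<le> 1/2" using False by simp
  finally have a: "(\<Sum>m\<in>{3..<L}. 1 / (real m)\<^sup>2) \<le> 1/2" .
  have "{2..<L} = insert 2 {3..<L}" using False by auto
  then have "(\<Sum>m\<in>{2..<L}. 1 / (real m)\<^sup>2) = 1/4 + (\<Sum>m\<in>{3..<L}. 1 / (real m)\<^sup>2)"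
    by (simp add: power2_eq_square)
  then show ?thesis using a by simp
qed

lemma sum_proper_multiples_le:
  fixes q L :: nat
  assumes q: "q \<ge> 1"
  shows "(\<Sum>n\<in>{1..<L}. if q dvd n \<and> n \<noteq> q then 1 / (real n)\<^sup>2 else 0) \<le> (3/4) / (real q)\<^sup>2"
proof -
  have "(\<Sum>n\<in>{1..<L}. if q dvd n \<and> n \<noteq> q then 1 / (real n)\<^sup>2 else 0)
     = (\<Sum>n\<in>{n\<in>{1..<L}. q dvd n \<and> n \<noteq> q}. 1 / (real n)\<^sup>2)" by (rule sum.inter_filter[symmetric]) simp
  also have "\<dots> \<le> (\<Sum>n\<in>(\<lambda>m. q * m) ` {2..<L+2}. 1 / (real n)\<^sup>2)"
  proof (rule sum_mono2)
    show "{n \<in> {1..<L}. q dvd n \<and> n \<noteq> q} \<subseteq> (\<lambda>m. q * m) ` {2..<L + 2}"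
    proof
      fix n assume "n \<in> {n \<in> {1..<L}. q dvd n \<and> n \<noteq> q}"
      then obtain m where m: "n = q * m" "n \<ge> 1" "n < L" "n \<noteq> q" by (auto elim: dvdE)
      then have "m \<noteq> 0" "m \<noteq> 1" by auto
      moreover have "m \<le> q * m" using q by simp
      then have "m < L" using m(1,3) by linarith
      ultimately show "n \<in> (\<lambda>m. q * m) ` {2..<L + 2}" using m by auto
    qed
  qed auto
  also have "\<dots> = (\<Sum>m\<in>{2..<L+2}. 1 / (real (q * m))\<^sup>2)"
    using q by (subst sum.reindex) (auto simp: inj_on_def)
  also have "\<dots> = (\<Sum>m\<in>{2..<L+2}. 1 / (real m)\<^sup>2) / (real q)\<^sup>2"
    unfolding sum_divide_distrib by (intro sum.cong) (auto simp: power_mult_distrib field_simps)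
  also have "\<dots> \<le> (3/4) / (real q)\<^sup>2"
    by (intro divide_right_mono sum_inverse_squares_from_2_le) auto
  finally show ?thesis .
qed

text \<open>Squaring makes the two peaks of the weight, at \<open>0\<close> and at \<open>q\<close>,
  summable independently of \<open>q\<close>:
  \<open>(a + b)\<^sup>2 \<le> 2 * a\<^sup>2 + 2 * b\<^sup>2\<close> separates them, and each
  contributes at most \<open>4\<close>.\<close>

lemma sum_near_root_weight_sq_period:
  assumes q: "q \<ge> 1"
  shows "(\<Sum>n<q. (near_root_weight q n)\<^sup>2) \<le> 8"
proof -
  have "(\<Sum>n<q. (near_root_weight q n)\<^sup>2) = (\<Sum>n\<in>{1..<q}. (near_root_weight q n)\<^sup>2)"
  proof (rule sum.mono_neutral_right)
    show "\<forall>i\<in>{..<q} - {1..<q}. (near_root_weight q i)\<^sup>2 = 0"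
      by (metis DiffE One_nat_def Suc_leI atLeastLessThan_iff dvd_0_right lessThan_iff near_root_weight_def not_gr_zero zero_power2)
  qed auto
  also have "\<dots> \<le> (\<Sum>n\<in>{1..<q}. 2 * (1 / (real n)\<^sup>2) + 2 * (1 / (real (q - n))\<^sup>2))"
  proof (rule sum_mono)
    fix n assume n: "n \<in> {1..<q}"
    then have "near_root_weight q n \<le> 1 / real n + 1 / real (q - n)"
      by (auto simp: near_root_weight_def)
    then have "(near_root_weight q n)\<^sup>2 \<le> (1 / real n + 1 / real (q - n))\<^sup>2"
      using q near_root_weight_nonneg[of q n] by (intro power_mono) auto
    also have "\<dots> \<le> 2 * (1 / real n)\<^sup>2 + 2 * (1 / real (q - n))\<^sup>2"
      using sum_squares_ge_zero[of "1 / real n - 1 / real (q - n)" 0] by (simp add: power2_eq_square algebra_simps)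
    finally show "(near_root_weight q n)\<^sup>2 \<le> 2 * (1 / (real n)\<^sup>2) + 2 * (1 / (real (q - n))\<^sup>2)"
      by (simp add: power_divide)
  qed
  also have "\<dots> = 2 * (\<Sum>n\<in>{1..<q}. 1 / (real n)\<^sup>2) + 2 * (\<Sum>n\<in>{1..<q}. 1 / (real (q - n))\<^sup>2)"
    by (simp add: sum.distrib sum_distrib_left)
  also have "(\<Sum>n\<in>{1..<q}. 1 / (real (q - n))\<^sup>2) = (\<Sum>n\<in>{1..<q}. 1 / (real n)\<^sup>2)"
    by (rule sum.reindex_bij_witness[of _ "\<lambda>n. q - n" "\<lambda>n. q - n"]) auto
  also have "2 * (\<Sum>n\<in>{1..<q}. 1 / (real n)\<^sup>2) + 2 * (\<Sum>n\<in>{1..<q}. 1 / (real n)\<^sup>2) \<le> 8"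
    using sum_inverse_squares_le[of 1 q] by simp
  finally show ?thesis .
qed

lemma sum_near_root_weight_sq:
  assumes q: "q \<ge> 1"
  shows "(\<Sum>n<m * q. (near_root_weight q n)\<^sup>2) \<le> 8 * real m"
proof -
  have "(\<Sum>n<m * q. (near_root_weight q n)\<^sup>2) = (\<Sum>i<m. \<Sum>n\<in>{i*q..<i*q+q}. (near_root_weight q n)\<^sup>2)"
    by (simp add: sum.nat_group)
  also have "\<dots> = (\<Sum>i<m. \<Sum>n<q. (near_root_weight q n)\<^sup>2)"
  proof (rule sum.cong)
    fix i
    have "(\<Sum>n\<in>{i*q..<i*q+q}. (near_root_weight q n)\<^sup>2) = (\<Sum>n\<in>{0..<q}. (near_root_weight q (n + i*q))\<^sup>2)"
      using sum.shift_bounds_nat_ivl[of "\<lambda>n. (near_root_weight q n)\<^sup>2" 0 "i*q" q] by (simp add: add.commute)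
    also have "\<dots> = (\<Sum>n<q. (near_root_weight q n)\<^sup>2)"
      by (rule sum.cong) (auto simp: near_root_weight_def dvd_add_left_iff)
    finally show "(\<Sum>n\<in>{i*q..<i*q+q}. (near_root_weight q n)\<^sup>2) = (\<Sum>n<q. (near_root_weight q n)\<^sup>2)" .
  qed simp
  also have "\<dots> \<le> (\<Sum>i<m. 8)" using sum_near_root_weight_sq_period[OF q] by (intro sum_mono) auto
  finally show ?thesis by simp
qed

text \<open>This is where the logarithm disappears. The product of the weight with
  \<open>1 / n\<close> is split by \<open>a * b \<le> a\<^sup>2 + b\<^sup>2\<close>, unscaled below
  \<open>q\<close>. Above \<open>q\<close> the split is balanced with \<open>q\<close>: the squared
  weights over \<open>P * q\<close> periods cost \<open>8 * P * q / q\<close>, the tail of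
  \<open>1 / n\<^sup>2\<close> costs \<open>q * (2 / q)\<close>.\<close>

lemma sum_near_root_weight_div:
  assumes q: "q \<ge> 1"
  shows "(\<Sum>n\<in>{1..<P * q\<^sup>2}. near_root_weight q n / real n) \<le> 12 + 8 * real P"
proof -
  let ?R = "near_root_weight q" and ?N = "P * q\<^sup>2"
  have am: "a * b \<le> a\<^sup>2 + b\<^sup>2" for a b :: real
  proof -
    have "0 \<le> (a - b)\<^sup>2" "0 \<le> a\<^sup>2" "0 \<le> b\<^sup>2" by auto
    then show ?thesis unfolding power2_diff by linarith
  qed
  have small: "?R n / real n \<le> (?R n)\<^sup>2 + 1 / (real n)\<^sup>2" for n
    using am[of "?R n" "1 / real n"] by (simp add: power_divide)
  have large: "?R n / real n \<le> (?R n)\<^sup>2 / real q + real q * (1 / (real n)\<^sup>2)" for n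
  proof -
    have q0: "real q > 0" using q by simp
    have "?R n * (real q / real n) / real q \<le> ((?R n)\<^sup>2 + (real q / real n)\<^sup>2) / real q"
      by (intro divide_right_mono am) auto
    then show ?thesis using q0 by (simp add: power_divide add_divide_distrib power2_eq_square)
  qed
  have nn: "?R n / real n \<ge> 0" for n using near_root_weight_nonneg[of q n] q by simp
  have "(\<Sum>n\<in>{1..<?N}. ?R n / real n) \<le> (\<Sum>n\<in>{1..<q} \<union> {q..<?N}. ?R n / real n)"
    by (intro sum_mono2 nn) auto
  also have "\<dots> = (\<Sum>n\<in>{1..<q}. ?R n / real n) + (\<Sum>n\<in>{q..<?N}. ?R n / real n)"
    by (intro sum.union_disjoint) auto
  also have "(\<Sum>n\<in>{1..<q}. ?R n / real n) \<le> (\<Sum>n\<in>{1..<q}. (?R n)\<^sup>2 + 1 / (real n)\<^sup>2)"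
    by (intro sum_mono small)
  also have "\<dots> = (\<Sum>n\<in>{1..<q}. (?R n)\<^sup>2) + (\<Sum>n\<in>{1..<q}. 1 / (real n)\<^sup>2)" by (rule sum.distrib)
  also have "(\<Sum>n\<in>{1..<q}. (?R n)\<^sup>2) \<le> (\<Sum>n<q. (?R n)\<^sup>2)" by (intro sum_mono2) auto
  also have "\<dots> \<le> 8" by (rule sum_near_root_weight_sq_period[OF q])
  also have "(\<Sum>n\<in>{1..<q}. 1 / (real n)\<^sup>2) \<le> 2" using sum_inverse_squares_le[of 1 q] by simp
  also have "(\<Sum>n\<in>{q..<?N}. ?R n / real n) \<le> (\<Sum>n\<in>{q..<?N}. (?R n)\<^sup>2 / real q + real q * (1 / (real n)\<^sup>2))"
    by (intro sum_mono large)
  also have "\<dots> = (\<Sum>n\<in>{q..<?N}. (?R n)\<^sup>2) / real q + real q * (\<Sum>n\<in>{q..<?N}. 1 / (real n)\<^sup>2)"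
    by (simp add: sum.distrib sum_distrib_left sum_divide_distrib)
  also have "\<dots> \<le> (8 * real (P * q)) / real q + real q * (2 / real q)"
  proof (intro add_mono divide_right_mono mult_left_mono sum_inverse_squares_le q)
    have "(\<Sum>n\<in>{q..<?N}. (?R n)\<^sup>2) \<le> (\<Sum>n<(P * q) * q. (?R n)\<^sup>2)"
      by (intro sum_mono2) (auto simp: power2_eq_square mult_ac)
    also have "\<dots> \<le> 8 * real (P * q)" by (rule sum_near_root_weight_sq[OF q])
    finally show "(\<Sum>n\<in>{q..<?N}. (?R n)\<^sup>2) \<le> 8 * real (P * q)" .
  qed auto
  also have "\<dots> = 8 * real P + 2" using q by simp
  finally show ?thesis by simp
qed

text \<open>Exact sampling would give \<open>(\<Sum>m. a (q * m)) = 0\<close>, and the terms with \<open>m \<ge> 2\<close> contribute at most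
  \<open>3 / 4 * M / q\<^sup>2\<close>. The perturbation costs a further eighth: frequencies beyond \<open>96 * q\<^sup>2\<close> are estimated
  trivially, the others by \<open>perturbed_cos_sum\<close>.\<close>
lemma perturbed_sampling_improves:
  fixes a :: "nat \<Rightarrow> real" and u :: "real \<Rightarrow> real" and x e :: "nat \<Rightarrow> real" and q :: nat
  assumes q: "q \<ge> 1" and M: "0 \<le> M" and eps: "0 \<le> \<epsilon>" "\<epsilon> \<le> 1 / 100000"
    and a0: "a 0 = 0" and aM: "\<And>n. n \<ge> 1 \<Longrightarrow> \<bar>a n\<bar> \<le> M / (real n)\<^sup>2"
    and sums: "\<And>y. (\<lambda>n. a n * cos (2 * pi * real n * y)) sums u y"
    and x0: "x 0 = 0" and xq: "x q = 1"
    and dx: "\<And>j. j < q \<Longrightarrow> \<bar>x (Suc j) - x j - 1 / real q\<bar> \<le> \<epsilon> / real q ^ 3"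
    and e: "\<And>j. j < q \<Longrightarrow> \<bar>e j\<bar> \<le> \<epsilon> / (real q)\<^sup>2"
    and zero: "(\<Sum>j<q. u (x j) * (1 + e j)) = 0"
  shows "\<bar>a q\<bar> \<le> (7/8) * M / (real q)\<^sup>2"
proof -
  have q0: "real q \<ge> 1" using q by simp
  define c where "c n = (\<Sum>j<q. cos (2 * pi * real n * x j) * (1 + e j)) / real q" for n
  define I where "I n = (if q dvd n then 1 else 0 :: real)" for n
  \<comment> \<open>Beyond \<open>N\<close> the trivial bound \<open>3 = 2 + 1\<close> is used, and
    \<open>96\<close> makes the tail \<open>3 * (2 / N)\<close> equal to
    \<open>(1/16) / (real q)\<^sup>2\<close>, half of the permitted eighth.\<close>
  define N where "N = 96 * q\<^sup>2"
  define K where "K n = (if n < N then \<epsilon> / (real q)\<^sup>2 + 40 * \<epsilon>\<^sup>2 * (real n)\<^sup>2 / real q ^ 4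
       + 4 * \<epsilon> * real n * near_root_weight q n / (real q)\<^sup>2 else 3)" for n
  have e1: "\<bar>e j\<bar> \<le> 1" if "j < q" for j
  proof -
    have "\<epsilon> / (real q)\<^sup>2 \<le> \<epsilon> / 1" using eps q0 by (intro divide_left_mono) auto
    then show ?thesis using e[OF that] eps by linarith
  qed
  have c2: "\<bar>c n\<bar> \<le> 2" for n
  proof -
    have "\<bar>\<Sum>j<q. cos (2 * pi * real n * x j) * (1 + e j)\<bar> \<le> (\<Sum>j<q. \<bar>cos (2 * pi * real n * x j) * (1 + e j)\<bar>)" by (rule sum_abs)
    also have "\<dots> \<le> (\<Sum>j<q. 1 * 2)" unfolding abs_mult
    proof (intro sum_mono mult_mono)
      fix j assume "j \<in> {..<q}"
      then have "\<bar>e j\<bar> \<le> 1" using e1 by simp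
      then show "\<bar>1 + e j\<bar> \<le> 2" by linarith
    qed auto
    finally show ?thesis using q0 unfolding c_def by (simp add: divide_le_eq)
  qed
  have cK: "\<bar>c n - I n\<bar> \<le> K n" for n
  proof (cases "n < N")
    case True
    then show ?thesis using perturbed_cos_sum[OF q eps(1) _ x0 xq dx e, where n = n] eps
      unfolding c_def I_def K_def by simp
  next
    case False
    then show ?thesis using c2[of n] unfolding K_def I_def by auto
  qed
  have csum: "(\<lambda>n. a n * c n) sums 0"
  proof -
    have "(\<lambda>n. \<Sum>j<q. a n * cos (2 * pi * real n * x j) * (1 + e j)) sums (\<Sum>j<q. u (x j) * (1 + e j))"
      by (intro sums_sum sums_mult2 sums)
    then have "(\<lambda>n. (\<Sum>j<q. a n * cos (2 * pi * real n * x j) * (1 + e j)) / real q) sums ((\<Sum>j<q. u (x j) * (1 + e j)) / real q)"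
      by (rule sums_divide)
    moreover have "(\<lambda>n. (\<Sum>j<q. a n * cos (2 * pi * real n * x j) * (1 + e j)) / real q) = (\<lambda>n. a n * c n)"
      by (auto simp: c_def sum_distrib_left mult.assoc)
    ultimately show ?thesis using zero by simp
  qed
  \<comment> \<open>Removing \<open>a q\<close> at \<open>n = q\<close> isolates the coefficient in
    question: the series of \<open>g\<close> sums to \<open>- a q\<close>, and all its terms are
    either proper multiples of \<open>q\<close> or errors.\<close>
  define g where "g n = a n * c n - (if n = q then a q else 0)" for n
  have gs: "g sums (0 - a q)"
    unfolding g_def by (intro sums_diff csum) (rule sums_single)
  have gb: "\<bar>g n\<bar> \<le> M * (if q dvd n \<and> n \<noteq> q then 1 / (real n)\<^sup>2 else 0) + M * (K n / (real n)\<^sup>2)" if n: "n \<ge> 1" for n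
  proof -
    define J where "J = (if q dvd n \<and> n \<noteq> q then 1 else 0 :: real)"
    have "g n = a n * (J + (c n - I n))" by (auto simp: g_def J_def I_def algebra_simps)
    then have "\<bar>g n\<bar> \<le> \<bar>a n\<bar> * (J + K n)"
      unfolding abs_mult using cK[of n] by (simp add: abs_mult J_def mult_left_mono)
    also have "\<dots> \<le> (M / (real n)\<^sup>2) * (J + K n)"
      using cK[of n] by (intro mult_right_mono aM n) (auto simp: J_def)
    finally show ?thesis by (auto simp: J_def algebra_simps add_divide_distrib)
  qed
  have Ksum: "(\<Sum>n\<in>{1..<L}. K n / (real n)\<^sup>2) \<le> (1/8) / (real q)\<^sup>2" for L
  proof -
    have K0: "K n / (real n)\<^sup>2 \<ge> 0" for n using cK[of n] by (simp add: order_trans[OF abs_ge_zero])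
    have N1: "N \<ge> 1" "real N = 96 * (real q)\<^sup>2" using q by (auto simp: N_def)
    have t1: "(\<Sum>n\<in>{N..<L}. K n / (real n)\<^sup>2) \<le> (1/16) / (real q)\<^sup>2"
    proof -
      have "(\<Sum>n\<in>{N..<L}. K n / (real n)\<^sup>2) = 3 * (\<Sum>n\<in>{N..<L}. 1 / (real n)\<^sup>2)"
        unfolding sum_distrib_left by (intro sum.cong) (auto simp: K_def)
      also have "\<dots> \<le> 3 * (2 / real N)" by (intro mult_left_mono sum_inverse_squares_le N1) auto
      also have "\<dots> = (1/16) / (real q)\<^sup>2" using N1 by simp
      finally show ?thesis .
    qed
    have "(\<Sum>n\<in>{1..<N}. K n / (real n)\<^sup>2) = (\<Sum>n\<in>{1..<N}. (\<epsilon> / (real q)\<^sup>2) * (1 / (real n)\<^sup>2)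
        + 40 * \<epsilon>\<^sup>2 / real q ^ 4 + (4 * \<epsilon> / (real q)\<^sup>2) * (near_root_weight q n / real n))"
    proof (rule sum.cong)
      fix n assume "n \<in> {1..<N}"
      then show "K n / (real n)\<^sup>2 = (\<epsilon> / (real q)\<^sup>2) * (1 / (real n)\<^sup>2) + 40 * \<epsilon>\<^sup>2 / real q ^ 4
         + (4 * \<epsilon> / (real q)\<^sup>2) * (near_root_weight q n / real n)"
        by (simp add: K_def add_divide_distrib power2_eq_square)
    qed simp
    also have "\<dots> = (\<epsilon> / (real q)\<^sup>2) * (\<Sum>n\<in>{1..<N}. 1 / (real n)\<^sup>2) + real (card {1..<N}) * (40 * \<epsilon>\<^sup>2 / real q ^ 4)
       + (4 * \<epsilon> / (real q)\<^sup>2) * (\<Sum>n\<in>{1..<N}. near_root_weight q n / real n)"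
      by (simp only: sum.distrib sum_distrib_left sum_constant)
    also have "\<dots> \<le> (\<epsilon> / (real q)\<^sup>2) * 2 + real N * (40 * \<epsilon>\<^sup>2 / real q ^ 4) + (4 * \<epsilon> / (real q)\<^sup>2) * (12 + 8 * real 96)"
      using sum_inverse_squares_le[of 1 N] sum_near_root_weight_div[OF q, of 96] eps
      by (intro add_mono mult_left_mono mult_right_mono) (auto simp: N_def simp del: of_nat_mult)
    \<comment> \<open>Here \<open>3840 = 96 * 40\<close> and
      \<open>3120 = 4 * (12 + 8 * 96)\<close>. The linear terms govern how large
      \<open>\<epsilon>\<close> may be.\<close>
    also have "\<dots> = (\<epsilon> * 2 + 3840 * \<epsilon>\<^sup>2 + 3120 * \<epsilon>) / (real q)\<^sup>2"
      unfolding N1 using q0 by (simp add: field_simps power2_eq_square power4_eq_xxxx)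
    also have "\<dots> \<le> (1/16) / (real q)\<^sup>2"
    proof (rule divide_right_mono)
      have "\<epsilon> * \<epsilon> \<le> 1/100000 * (1/100)" using eps by (intro mult_mono) auto
      then show "\<epsilon> * 2 + 3840 * \<epsilon>\<^sup>2 + 3120 * \<epsilon> \<le> 1 / 16" using eps by (simp add: power2_eq_square)
    qed simp
    finally have t2: "(\<Sum>n\<in>{1..<N}. K n / (real n)\<^sup>2) \<le> (1/16) / (real q)\<^sup>2" .
    have "(\<Sum>n\<in>{1..<L}. K n / (real n)\<^sup>2) \<le> (\<Sum>n\<in>{1..<N} \<union> {N..<L}. K n / (real n)\<^sup>2)"
      by (intro sum_mono2 K0) auto
    also have "\<dots> = (\<Sum>n\<in>{1..<N}. K n / (real n)\<^sup>2) + (\<Sum>n\<in>{N..<L}. K n / (real n)\<^sup>2)"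
      by (intro sum.union_disjoint) auto
    finally show ?thesis using t1 t2 by (simp add: field_simps)
  qed
  have part: "\<bar>\<Sum>n<L. g n\<bar> \<le> (7/8) * M / (real q)\<^sup>2" for L
  proof -
    have g0: "g 0 = 0" using a0 q by (simp add: g_def)
    have "(\<Sum>n<L. g n) = (\<Sum>n\<in>{1..<L}. g n)"
      by (rule sum.mono_neutral_right) (use g0 in \<open>auto simp: not_less_eq_eq\<close>)
    then have "\<bar>\<Sum>n<L. g n\<bar> \<le> (\<Sum>n\<in>{1..<L}. \<bar>g n\<bar>)" by (metis sum_abs)
    also have "\<dots> \<le> (\<Sum>n\<in>{1..<L}. M * (if q dvd n \<and> n \<noteq> q then 1 / (real n)\<^sup>2 else 0) + M * (K n / (real n)\<^sup>2))"
      by (intro sum_mono gb) auto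
    also have "\<dots> = M * (\<Sum>n\<in>{1..<L}. if q dvd n \<and> n \<noteq> q then 1 / (real n)\<^sup>2 else 0) + M * (\<Sum>n\<in>{1..<L}. K n / (real n)\<^sup>2)"
      by (simp only: sum.distrib sum_distrib_left)
    also have "\<dots> \<le> M * ((3/4) / (real q)\<^sup>2) + M * ((1/8) / (real q)\<^sup>2)"
      by (intro add_mono mult_left_mono sum_proper_multiples_le q Ksum M)
    finally show ?thesis by (simp add: field_simps)
  qed
  have "(\<lambda>L. \<bar>\<Sum>n<L. g n\<bar>) \<longlonglongrightarrow> \<bar>0 - a q\<bar>" using gs unfolding sums_def by (intro tendsto_rabs)
  then have "\<bar>0 - a q\<bar> \<le> (7/8) * M / (real q)\<^sup>2" by (rule LIMSEQ_le_const2) (use part in auto)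
  then show ?thesis by simp
qed

text \<open>One application of \<open>perturbed_sampling_improves\<close> for each \<open>n\<close>
  shrinks the common bound for all coefficients by \<open>7/8\<close>, so repetition forces them to
  \<open>0\<close>.\<close>

theorem perturbed_sampling_unique:
  fixes u u1 u2 :: "real \<Rightarrow> real" and x e :: "nat \<Rightarrow> nat \<Rightarrow> real"
  assumes eps: "0 \<le> \<epsilon>" "\<epsilon> \<le> 1 / 100000"
    and per: "\<And>y. u (y + 1) = u y" and ev: "\<And>y. u (- y) = u y"
    and d1: "\<And>y. (u has_real_derivative u1 y) (at y)"
    and d2: "\<And>y. (u1 has_real_derivative u2 y) (at y)"
    and c2: "continuous_on UNIV u2"
    and mean: "integral {0..1} u = 0" and u0: "u 0 = 0"
    and x0: "\<And>q. q \<ge> 2 \<Longrightarrow> x q 0 = 0" and xq: "\<And>q. q \<ge> 2 \<Longrightarrow> x q q = 1"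
    and dx: "\<And>q j. q \<ge> 2 \<Longrightarrow> j < q \<Longrightarrow> \<bar>x q (Suc j) - x q j - 1 / real q\<bar> \<le> \<epsilon> / real q ^ 3"
    and e: "\<And>q j. q \<ge> 2 \<Longrightarrow> j < q \<Longrightarrow> \<bar>e q j\<bar> \<le> \<epsilon> / (real q)\<^sup>2"
    and zero: "\<And>q. q \<ge> 2 \<Longrightarrow> (\<Sum>j<q. u (x q j) * (1 + e q j)) = 0"
  shows "u y = 0"
proof -
  obtain a M where a0: "a 0 = integral {0..1} u" and aM: "\<And>n::nat. n \<ge> 1 \<Longrightarrow> \<bar>a n\<bar> \<le> M / (real n)\<^sup>2"
    and sums: "\<And>x. (\<lambda>n. a n * cos (2 * pi * real n * x)) sums u x"
    using cosine_series[OF per ev d1 d2 c2] by metis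
  have a00: "a 0 = 0" using a0 mean by simp
  have M0: "0 \<le> M" using aM[of 1] by auto
  have imp: "\<bar>a q\<bar> \<le> (7/8) * M' / (real q)\<^sup>2"
    if "0 \<le> M'" "\<And>n::nat. n \<ge> 1 \<Longrightarrow> \<bar>a n\<bar> \<le> M' / (real n)\<^sup>2" "q \<ge> 1" for M' q
  proof (cases "q = 1")
    case True
    show ?thesis
      \<comment> \<open>For \<open>q = 1\<close> the sampling is exact: \<open>real\<close> gives
        the single point \<open>0\<close> and the endpoint \<open>1\<close>, and the average is
        \<open>u 0\<close>.\<close>
      by (rule perturbed_sampling_improves[OF that(3,1) eps a00 that(2) sums, of real "\<lambda>_. 0"])
         (use True u0 eps in auto)
  next
    case False
    then have q: "q \<ge> 2" using that by simp
    show ?thesis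
      by (rule perturbed_sampling_improves[OF that(3,1) eps a00 that(2) sums x0[OF q] xq[OF q] dx[OF q] e[OF q] zero[OF q]])
  qed
  have it: "\<forall>n\<ge>1. \<bar>a n\<bar> \<le> ((7/8) ^ k * M) / (real n)\<^sup>2" for k
  proof (induction k)
    case 0 then show ?case using aM by simp
  next
    case (Suc k)
    show ?case using imp[of "(7/8) ^ k * M"] Suc.IH M0 by (simp add: mult.assoc)
  qed
  have "a n = 0" for n
  proof (cases "n = 0")
    case False
    have "(\<lambda>k. ((7/8) ^ k * M) / (real n)\<^sup>2) \<longlonglongrightarrow> (0 * M) / (real n)\<^sup>2"
      using False by (intro tendsto_intros LIMSEQ_power_zero) auto
    then have "\<bar>a n\<bar> \<le> (0 * M) / (real n)\<^sup>2"
      by (rule LIMSEQ_le_const) (use it[rule_format] False in auto)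
    then show ?thesis by simp
  qed (use a00 in simp)
  then have "(\<lambda>n. 0) sums u y" using sums[of y] by simp
  then show ?thesis using sums_zero sums_unique2 by blast
qed

section \<open>Chords in the tangent angle parametrisation\<close>

text \<open>A convex arc is parametrised by its tangent angle \<open>t\<close>; \<open>f t ^ 3\<close> is the radius of curvature, normalised
  to be close to \<open>1\<close>, and \<open>X\<close>, a primitive of its cube root \<open>f\<close>, is the Lazutkin parameter.\<close>
locale angle_curve =
  fixes f f1 f2 f3 X :: "real \<Rightarrow> real" and G :: "real \<Rightarrow> complex" and \<epsilon> :: real
  assumes eps: "0 \<le> \<epsilon>" "\<epsilon> \<le> 1 / 1000"
    and df: "(f has_real_derivative f1 t) (at t)" "(f1 has_real_derivative f2 t) (at t)"
      "(f2 has_real_derivative f3 t) (at t)"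
    and bf: "\<bar>f t - 1\<bar> \<le> \<epsilon>" "\<bar>f1 t\<bar> \<le> \<epsilon>" "\<bar>f2 t\<bar> \<le> \<epsilon>" "\<bar>f3 t\<bar> \<le> \<epsilon>"
    and dX: "(X has_real_derivative f t) (at t)"
    and dG: "(G has_vector_derivative of_real (f t ^ 3) * cis t) (at t)"
begin

text \<open>Reflection combined with reversal stays in the class and exchanges the two ends of a
  chord, so estimates at the start of a chord yield those at its end.\<close>

lemma reflected: "angle_curve (\<lambda>t. f (- t)) (\<lambda>t. - f1 (- t)) (\<lambda>t. f2 (- t)) (\<lambda>t. - f3 (- t))
   (\<lambda>t. - X (- t)) (\<lambda>t. - cnj (G (- t))) \<epsilon>"
proof
  fix t
  have m: "((\<lambda>t. g (- t)) has_real_derivative - g' (- t)) (at t)"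
    if "\<And>t. (g has_real_derivative g' t) (at t)" for g g' :: "real \<Rightarrow> real"
    using DERIV_mirror[of g "g' (- t)" t] that[of "- t"] by simp
  show "((\<lambda>t. f (- t)) has_real_derivative - f1 (- t)) (at t)" by (rule m[OF df(1)])
  show "((\<lambda>t. - f1 (- t)) has_real_derivative f2 (- t)) (at t)" using DERIV_minus[OF m[OF df(2)]] by simp
  show "((\<lambda>t. f2 (- t)) has_real_derivative - f3 (- t)) (at t)" by (rule m[OF df(3)])
  show "((\<lambda>t. - X (- t)) has_real_derivative f (- t)) (at t)" using DERIV_minus[OF m[OF dX]] by simp
  have "((\<lambda>t. G (- t)) has_vector_derivative (- 1) *\<^sub>R (of_real (f (- t) ^ 3) * cis (- t))) (at t)"
  proof -
    have "((\<lambda>t::real. - t) has_vector_derivative - 1) (at t)" by (auto intro!: derivative_eq_intros)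
    from vector_diff_chain_at[OF this dG[of "- t"]] show ?thesis by (simp add: o_def)
  qed
  then have "((\<lambda>t. - cnj (G (- t))) has_vector_derivative - cnj ((- 1) *\<^sub>R (of_real (f (- t) ^ 3) * cis (- t)))) (at t)"
    by (intro has_vector_derivative_minus bounded_linear.has_vector_derivative[OF bounded_linear_cnj])
  then show "((\<lambda>t. - cnj (G (- t))) has_vector_derivative of_real (f (- t) ^ 3) * cis t) (at t)"
    by (simp add: cis_cnj)
qed (use eps bf in auto)

definition \<rho>1 where "\<rho>1 t = 3 * f t ^ 2 * f1 t"
definition \<rho>2 where "\<rho>2 t = 6 * f t * f1 t ^ 2 + 3 * f t ^ 2 * f2 t"
definition \<rho>3 where "\<rho>3 t = 6 * f1 t ^ 3 + 18 * f t * f1 t * f2 t + 3 * f t ^ 2 * f3 t"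
text \<open>\<open>P\<close> is the coefficient of \<open>w ^ 3\<close> in half the Lazutkin length of a chord of angular width \<open>2 * w\<close>
  minus \<open>f\<close> times the angle of the chord at an endpoint. Two consecutive chords have the same \<open>P\<close> at
  their common endpoint, hence their Lazutkin lengths agree up to fourth order.\<close>
definition P where "P t = - f2 t / 3 + f1 t ^ 2 / f t"

lemma rho_derivs:
  "((\<lambda>t. f t ^ 3) has_real_derivative \<rho>1 t) (at t)"
  "(\<rho>1 has_real_derivative \<rho>2 t) (at t)"
  "(\<rho>2 has_real_derivative \<rho>3 t) (at t)"
  unfolding \<rho>1_def[abs_def] \<rho>2_def[abs_def] \<rho>3_def
  by (auto intro!: derivative_eq_intros df simp: power2_eq_square power3_eq_cube algebra_simps)

lemma f_bounds: "999/1000 \<le> f t" "f t \<le> 1001/1000"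
  using bf(1)[of t] eps by linarith+

lemma small_products: "\<bar>f1 t ^ 2\<bar> \<le> \<epsilon> / 1000" "\<bar>f1 t * f2 t\<bar> \<le> \<epsilon> / 1000" "\<bar>f1 t ^ 3\<bar> \<le> \<epsilon> / 1000"
proof -
  have e2: "\<epsilon> * \<epsilon> \<le> \<epsilon> / 1000" using mult_left_mono[OF eps(2,1)] by simp
  show a: "\<bar>f1 t ^ 2\<bar> \<le> \<epsilon> / 1000" using abs_mult_le[OF bf(2)[of t] bf(2)[of t]] e2 by (simp add: power2_eq_square)
  show "\<bar>f1 t * f2 t\<bar> \<le> \<epsilon> / 1000" using abs_mult_le[OF bf(2)[of t] bf(3)[of t]] e2 by simp
  have "\<bar>f1 t ^ 2 * f1 t\<bar> \<le> \<epsilon> / 1000 * 1" using abs_mult_le[OF a, of "f1 t" 1] bf(2)[of t] eps by auto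
  then show "\<bar>f1 t ^ 3\<bar> \<le> \<epsilon> / 1000" by (simp add: power2_eq_square power3_eq_cube)
qed

lemma f_sq_bound: "\<bar>f t ^ 2\<bar> \<le> 101/100"
proof -
  have "f t ^ 2 \<le> (1001/1000) ^ 2" using f_bounds[of t] by (intro power_mono) auto
  then show ?thesis by (simp add: power2_eq_square)
qed

lemma rho_bounds: "\<bar>\<rho>1 t\<bar> \<le> 4 * \<epsilon>" "\<bar>\<rho>2 t\<bar> \<le> 4 * \<epsilon>" "\<bar>\<rho>3 t\<bar> \<le> 4 * \<epsilon>"
proof -
  have f: "\<bar>f t\<bar> \<le> 2" using f_bounds[of t] by auto
  have a1: "\<bar>f t ^ 2 * f1 t\<bar> \<le> 101/100 * \<epsilon>" "\<bar>f t ^ 2 * f2 t\<bar> \<le> 101/100 * \<epsilon>" "\<bar>f t ^ 2 * f3 t\<bar> \<le> 101/100 * \<epsilon>"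
    by (intro abs_mult_le f_sq_bound bf)+
  have a2: "\<bar>f t * f1 t ^ 2\<bar> \<le> 2 * (\<epsilon> / 1000)" "\<bar>f t * (f1 t * f2 t)\<bar> \<le> 2 * (\<epsilon> / 1000)"
    by (intro abs_mult_le f small_products)+
  note a3 = small_products(3)[of t]
  show "\<bar>\<rho>1 t\<bar> \<le> 4 * \<epsilon>" unfolding \<rho>1_def mult.assoc using a1(1) eps by linarith
  show "\<bar>\<rho>2 t\<bar> \<le> 4 * \<epsilon>" unfolding \<rho>2_def mult.assoc using a1(2) a2(1) eps by linarith
  show "\<bar>\<rho>3 t\<bar> \<le> 4 * \<epsilon>" unfolding \<rho>3_def mult.assoc using a1(3) a2(2) a3 eps by linarith
qed

lemma P_bound: "\<bar>P t\<bar> \<le> \<epsilon>"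
proof -
  have "\<bar>f1 t ^ 2 / f t\<bar> \<le> \<epsilon> / 1000 * 2"
    unfolding divide_inverse using f_bounds[of t]
    by (intro abs_mult_le small_products[unfolded divide_inverse]) (auto simp: inverse_eq_divide field_simps)
  then show ?thesis unfolding P_def using bf(3)[of t] eps by linarith
qed

text \<open>The rotation by \<open>- (a + w)\<close> uses the tangent direction halfway between the
  two ends in angle, so relative tangent angles run over the symmetric interval from
  \<open>- w\<close> to \<open>w\<close>.\<close>

lemma chord_component_derivs: "((\<lambda>t. Im (G (a + t) * cis (- (a + w)))) has_real_derivative f (a + t) ^ 3 * sin (t - w)) (at t)"
          "((\<lambda>t. Re (G (a + t) * cis (- (a + w)))) has_real_derivative f (a + t) ^ 3 * cos (t - w)) (at t)"
proof -
  have "((\<lambda>t. G (a + t)) has_vector_derivative 1 *\<^sub>R (of_real (f (a + t) ^ 3) * cis (a + t))) (at t)"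
  proof -
    have "((\<lambda>t. a + t) has_vector_derivative 1) (at t)" by (auto intro!: derivative_eq_intros)
    from vector_diff_chain_at[OF this dG[of "a + t"]] show ?thesis by (simp add: o_def)
  qed
  then have v: "((\<lambda>t. G (a + t) * cis (- (a + w))) has_vector_derivative of_real (f (a + t) ^ 3) * cis (a + t) * cis (- (a + w))) (at t)"
    using bounded_linear.has_vector_derivative[OF bounded_linear_mult_left] by fastforce
  have e: "of_real (f (a + t) ^ 3) * cis (a + t) * cis (- (a + w)) = of_real (f (a + t) ^ 3) * cis (t - w)"
    by (simp add: mult.assoc cis_mult)
  show "((\<lambda>t. Im (G (a + t) * cis (- (a + w)))) has_real_derivative f (a + t) ^ 3 * sin (t - w)) (at t)"
    using bounded_linear.has_vector_derivative[OF bounded_linear_Im v] unfolding e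
    by (simp add: has_real_derivative_iff_has_vector_derivative)
  show "((\<lambda>t. Re (G (a + t) * cis (- (a + w)))) has_real_derivative f (a + t) ^ 3 * cos (t - w)) (at t)"
    using bounded_linear.has_vector_derivative[OF bounded_linear_Re v] unfolding e
    by (simp add: has_real_derivative_iff_has_vector_derivative)
qed

text \<open>With \<open>f ^ 3\<close> replaced by its second Taylor polynomial at \<open>a\<close>,
  the constant term integrates to \<open>0\<close> against the odd sine; the linear and quadratic
  terms give the same factor \<open>2 * (sin w - w * cos w)\<close>.\<close>

lemma chord_Im:
  assumes w: "0 < w"
  shows "\<bar>Im ((G (a + 2 * w) - G a) * cis (- (a + w))) - 2 * (sin w - w * cos w) * (\<rho>1 a + w * \<rho>2 a)\<bar> \<le> 11 * \<epsilon> * w ^ 5"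
proof -
  let ?r = "f a ^ 3"
  \<comment> \<open>Subtracting an explicit antiderivative of the Taylor polynomial times the sine
    leaves only the remainder in the derivative, so the mean value inequality replaces an
    integral.\<close>
  define k where "k t = Im (G (a + t) * cis (- (a + w)))
     - (- (?r + \<rho>1 a * t + \<rho>2 a * t\<^sup>2 / 2) * cos (t - w) + (\<rho>1 a + \<rho>2 a * t) * sin (t - w) + \<rho>2 a * cos (t - w))" for t
  have dk: "(k has_real_derivative (f (a + t) ^ 3 - (?r + \<rho>1 a * t + \<rho>2 a * t\<^sup>2 / 2)) * sin (t - w)) (at t)" for t
    unfolding k_def
    by (rule derivative_eq_intros chord_component_derivs refl | simp)+ (simp add: algebra_simps power2_eq_square)
  have "norm (k (2 * w) - k 0) \<le> (4 * \<epsilon> * (2 * w) ^ 3 / 6 * w) * norm (2 * w - 0)"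
  proof (rule field_differentiable_bound[of "{0..2 * w}" k])
    fix t assume t: "t \<in> {0..2 * w}"
    show "(k has_real_derivative (f (a + t) ^ 3 - (?r + \<rho>1 a * t + \<rho>2 a * t\<^sup>2 / 2)) * sin (t - w)) (at t within {0..2 * w})"
      using dk has_field_derivative_at_within by blast
    have "\<bar>f (a + t) ^ 3 - (?r + \<rho>1 a * t + \<rho>2 a * t\<^sup>2 / 2)\<bar> \<le> 4 * \<epsilon> * \<bar>t\<bar> ^ 3 / 6"
      by (rule taylor3_bound[of "\<lambda>t. f t ^ 3", OF rho_derivs rho_bounds(3)])
    also have "\<dots> \<le> 4 * \<epsilon> * (2 * w) ^ 3 / 6" using t eps by (intro divide_right_mono mult_left_mono power_mono) auto
    finally have 1: "\<bar>f (a + t) ^ 3 - (?r + \<rho>1 a * t + \<rho>2 a * t\<^sup>2 / 2)\<bar> \<le> 4 * \<epsilon> * (2 * w) ^ 3 / 6" .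
    have 2: "\<bar>sin (t - w)\<bar> \<le> w" using abs_sin_x_le_abs_x[of "t - w"] t by auto
    show "norm ((f (a + t) ^ 3 - (?r + \<rho>1 a * t + \<rho>2 a * t\<^sup>2 / 2)) * sin (t - w)) \<le> 4 * \<epsilon> * (2 * w) ^ 3 / 6 * w"
      unfolding real_norm_def by (rule abs_mult_le[OF 1 2])
  qed (use w in auto)
  also have "\<dots> = (64/6) * (\<epsilon> * w ^ 5)" using w by (simp add: eval_nat_numeral)
  also have "\<dots> \<le> 11 * (\<epsilon> * w ^ 5)" using w eps by (intro mult_right_mono) auto
  finally have "\<bar>k (2 * w) - k 0\<bar> \<le> 11 * \<epsilon> * w ^ 5" by simp
  moreover have "k (2 * w) - k 0 = Im ((G (a + 2 * w) - G a) * cis (- (a + w))) - 2 * (sin w - w * cos w) * (\<rho>1 a + w * \<rho>2 a)"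
    unfolding k_def left_diff_distrib minus_complex.sel by (simp add: algebra_simps power2_eq_square)
  ultimately show ?thesis by simp
qed

text \<open>First order suffices: the error enters the slope estimate only multiplied by
  \<open>slope_approx\<close>, which is itself of order \<open>\<epsilon> * w ^ 2\<close>.\<close>

lemma chord_Re:
  assumes w: "0 < w"
  shows "\<bar>Re ((G (a + 2 * w) - G a) * cis (- (a + w))) - 2 * sin w * (f a ^ 3 + \<rho>1 a * w)\<bar> \<le> 16 * \<epsilon> * w ^ 3"
proof -
  let ?r = "f a ^ 3"
  define k where "k t = Re (G (a + t) * cis (- (a + w)))
     - ((?r + \<rho>1 a * t) * sin (t - w) + \<rho>1 a * cos (t - w))" for t
  have dk: "(k has_real_derivative (f (a + t) ^ 3 - (?r + \<rho>1 a * t)) * cos (t - w)) (at t)" for t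
    unfolding k_def
    by (rule derivative_eq_intros chord_component_derivs refl | simp)+ (simp add: algebra_simps power2_eq_square)
  have "norm (k (2 * w) - k 0) \<le> (4 * \<epsilon> * (2 * w) ^ 2 / 2 * 1) * norm (2 * w - 0)"
  proof (rule field_differentiable_bound[of "{0..2 * w}" k])
    fix t assume t: "t \<in> {0..2 * w}"
    show "(k has_real_derivative (f (a + t) ^ 3 - (?r + \<rho>1 a * t)) * cos (t - w)) (at t within {0..2 * w})"
      using dk has_field_derivative_at_within by blast
    have "\<bar>f (a + t) ^ 3 - (?r + \<rho>1 a * t)\<bar> \<le> 4 * \<epsilon> * t ^ 2 / 2"
      by (rule taylor2_bound[of "\<lambda>t. f t ^ 3", OF rho_derivs(1,2) rho_bounds(2)])
    also have "\<dots> \<le> 4 * \<epsilon> * (2 * w) ^ 2 / 2" using t eps by (intro divide_right_mono mult_left_mono power_mono) auto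
    finally have 1: "\<bar>f (a + t) ^ 3 - (?r + \<rho>1 a * t)\<bar> \<le> 4 * \<epsilon> * (2 * w) ^ 2 / 2" .
    show "norm ((f (a + t) ^ 3 - (?r + \<rho>1 a * t)) * cos (t - w)) \<le> 4 * \<epsilon> * (2 * w) ^ 2 / 2 * 1"
      unfolding real_norm_def by (rule abs_mult_le[OF 1 abs_cos_le_one])
  qed (use w in auto)
  also have "\<dots> = 16 * \<epsilon> * w ^ 3" using w by (simp add: eval_nat_numeral)
  finally have "\<bar>k (2 * w) - k 0\<bar> \<le> 16 * \<epsilon> * w ^ 3" by simp
  moreover have "k (2 * w) - k 0 = Re ((G (a + 2 * w) - G a) * cis (- (a + w))) - 2 * sin w * (f a ^ 3 + \<rho>1 a * w)"
    unfolding k_def left_diff_distrib minus_complex.sel by (simp add: algebra_simps power2_eq_square)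
  ultimately show ?thesis by simp
qed

end

section \<open>Angles of a chord against its Lazutkin length\<close>

context angle_curve begin

text \<open>Third-order Taylor polynomial in \<open>w\<close> of the tangent of the angle between the chord from \<open>a\<close> to \<open>a + 2 * w\<close>
  and the direction \<open>a + w\<close>.\<close>
definition slope_approx where
  "slope_approx a w = (w ^ 2 * f1 a * f a + w ^ 3 * (f a * f2 a - f1 a ^ 2)) / f a ^ 2"

lemma slope_approx_le:
  assumes w: "0 < w" "w \<le> 17/10"
  shows "\<bar>slope_approx a w\<bar> \<le> 3 * \<epsilon> * w ^ 2"
proof -
  have f: "\<bar>f a\<bar> \<le> 1001/1000" using f_bounds[of a] by auto
  have 1: "\<bar>f1 a * f a\<bar> \<le> \<epsilon> * (1001/1000)" by (intro abs_mult_le bf f)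
  have 2: "\<bar>f a * f2 a\<bar> \<le> 1001/1000 * \<epsilon>" by (intro abs_mult_le bf f)
  have 3: "\<bar>f a * f2 a - f1 a ^ 2\<bar> \<le> 1002/1000 * \<epsilon>" using 2 small_products(1)[of a] by linarith
  have 4: "\<bar>w * (f a * f2 a - f1 a ^ 2)\<bar> \<le> 17/10 * (1002/1000 * \<epsilon>)" using w by (intro abs_mult_le 3) auto
  have 5: "\<bar>f1 a * f a + w * (f a * f2 a - f1 a ^ 2)\<bar> \<le> 275/100 * \<epsilon>" using 1 4 eps by linarith
  have 6: "(999/1000) ^ 2 \<le> f a ^ 2" using f_bounds[of a] by (intro power_mono) auto
  have "\<bar>slope_approx a w\<bar> = w ^ 2 * (\<bar>f1 a * f a + w * (f a * f2 a - f1 a ^ 2)\<bar> / f a ^ 2)"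
  proof -
    have "w ^ 2 * f1 a * f a + w ^ 3 * (f a * f2 a - f1 a ^ 2) = w ^ 2 * (f1 a * f a + w * (f a * f2 a - f1 a ^ 2))"
      by (simp add: algebra_simps power2_eq_square power3_eq_cube)
    then show ?thesis unfolding slope_approx_def by (simp only: abs_mult abs_divide) simp
  qed
  also have "\<dots> \<le> w ^ 2 * ((275/100 * \<epsilon>) / (999/1000) ^ 2)"
    using 5 6 eps by (intro mult_left_mono frac_le) auto
  also have "\<dots> \<le> w ^ 2 * (3 * \<epsilon>)" using eps by (intro mult_left_mono) (auto simp: power2_eq_square field_simps)
  finally show ?thesis by (simp add: mult_ac)
qed

text \<open>\<open>Im Z\<close> is compared with \<open>slope_approx a w * Re Z\<close>, and the
  difference is divided by \<open>Re Z\<close> only at the end, using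
  \<open>Re Z \<ge> 9/10 * w\<close>. This turns an error of order \<open>w ^ 5\<close> into one of
  order \<open>w ^ 4\<close>.\<close>

lemma chord_slope:
  fixes a w :: real
  assumes w: "0 < w" "w \<le> 17/10"
  defines "Z \<equiv> (G (a + 2 * w) - G a) * cis (- (a + w))"
  shows "Re Z > 0" "\<bar>Im Z / Re Z\<bar> \<le> 120 * \<epsilon> * w ^ 2" "\<bar>Im Z / Re Z - slope_approx a w\<bar> \<le> 40 * \<epsilon> * w ^ 4"
proof -
  define F p q where "F = f a" and "p = f1 a" and "q = f2 a"
  define T where "T = slope_approx a w"
  define EN where "EN = Im Z - 2 * (sin w - w * cos w) * (\<rho>1 a + w * \<rho>2 a)"
  define ED where "ED = Re Z - 2 * sin w * (f a ^ 3 + \<rho>1 a * w)"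
  define ES where "ES = sin w - w * cos w - w\<^sup>2 / 3 * sin w"
  have EN: "\<bar>EN\<bar> \<le> 11 * \<epsilon> * w ^ 5" unfolding EN_def Z_def by (rule chord_Im[OF w(1)])
  have ED: "\<bar>ED\<bar> \<le> 16 * \<epsilon> * w ^ 3" unfolding ED_def Z_def by (rule chord_Re[OF w(1)])
  have ES: "\<bar>ES\<bar> \<le> w ^ 5" unfolding ES_def using w by (intro sin_minus_cos_expansion) auto
  have F: "F \<noteq> 0" "999/1000 \<le> F" "F \<le> 1001/1000" using f_bounds[of a] by (auto simp: F_def)
  have sw: "sin w \<ge> w / 2" using w by (intro sin_ge_half) auto
  have sw2: "\<bar>sin w\<bar> \<le> w" using abs_sin_x_le_abs_x[of w] w by simp
  have w2: "w ^ 2 \<le> 289/100" using power_mono[of w "17/10" 2] w by (simp add: power2_eq_square)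
  have T: "\<bar>T\<bar> \<le> 3 * \<epsilon> * w ^ 2" unfolding T_def by (rule slope_approx_le[OF w])
  have TF: "T * (f a ^ 3 + \<rho>1 a * w) = (w ^ 2 * p * F + w ^ 3 * (F * q - p ^ 2)) * (F + 3 * p * w)"
    using F unfolding T_def slope_approx_def \<rho>1_def F_def[symmetric] p_def[symmetric] q_def[symmetric]
    by (simp add: divide_simps) (simp add: algebra_simps power2_eq_square power3_eq_cube)
  \<comment> \<open>\<open>slope_approx\<close> is the expansion of \<open>(w\<^sup>2 / 3) *
    (\<rho>1 a + w * \<rho>2 a) / (f a ^ 3 + \<rho>1 a * w)\<close> cut after \<open>w ^ 3\<close>,
    so a single term survives, quadratic in the small derivatives.\<close>
  have main: "2 * (w\<^sup>2 / 3 * sin w) * (\<rho>1 a + w * \<rho>2 a) - 2 * sin w * (T * (f a ^ 3 + \<rho>1 a * w))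
     = - (sin w * (6 * w ^ 4 * (p * (F * q - p ^ 2))))"
    unfolding TF unfolding \<rho>1_def \<rho>2_def F_def[symmetric] p_def[symmetric] q_def[symmetric]
    by (simp add: field_simps power2_eq_square power3_eq_cube power4_eq_xxxx)
  have NTD: "Im Z - T * Re Z = - (sin w * (6 * w ^ 4 * (p * (F * q - p ^ 2)))) + 2 * (ES * (\<rho>1 a + w * \<rho>2 a)) + EN - T * ED"
    unfolding main[symmetric] EN_def ED_def ES_def by (simp add: algebra_simps)
  have pq: "\<bar>p * (F * q - p ^ 2)\<bar> \<le> \<epsilon> * (2 * \<epsilon>)"
  proof (rule abs_mult_le)
    show "\<bar>p\<bar> \<le> \<epsilon>" unfolding p_def by (rule bf)
    have "\<bar>F * q\<bar> \<le> 1001/1000 * \<epsilon>" using F bf(3)[of a] by (intro abs_mult_le) (auto simp: q_def)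
    then show "\<bar>F * q - p ^ 2\<bar> \<le> 2 * \<epsilon>" using small_products(1)[of a] eps unfolding p_def by linarith
  qed
  have t1: "\<bar>sin w * (6 * w ^ 4 * (p * (F * q - p ^ 2)))\<bar> \<le> w * (6 * w ^ 4 * (\<epsilon> * (2 * \<epsilon>)))"
    using w by (intro abs_mult_le sw2 pq) auto
  have r: "\<bar>\<rho>1 a + w * \<rho>2 a\<bar> \<le> 11 * \<epsilon>"
  proof -
    have "\<bar>w * \<rho>2 a\<bar> \<le> 17/10 * (4 * \<epsilon>)" using w by (intro abs_mult_le rho_bounds) auto
    then show ?thesis using rho_bounds(1)[of a] eps by linarith
  qed
  have t2: "\<bar>ES * (\<rho>1 a + w * \<rho>2 a)\<bar> \<le> w ^ 5 * (11 * \<epsilon>)" by (rule abs_mult_le[OF ES r])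
  have t3: "\<bar>T * ED\<bar> \<le> (3 * \<epsilon> * w ^ 2) * (16 * \<epsilon> * w ^ 3)" by (rule abs_mult_le[OF T ED])
  have ee: "\<epsilon> * \<epsilon> * w ^ 5 \<le> (1/1000) * \<epsilon> * w ^ 5" using eps w by (intro mult_right_mono) auto
  have "\<bar>Im Z - T * Re Z\<bar> \<le> w * (6 * w ^ 4 * (\<epsilon> * (2 * \<epsilon>))) + 2 * (w ^ 5 * (11 * \<epsilon>)) + 11 * \<epsilon> * w ^ 5 + (3 * \<epsilon> * w ^ 2) * (16 * \<epsilon> * w ^ 3)"
    unfolding NTD using t1 t2 t3 EN by linarith
  also have "\<dots> = 60 * (\<epsilon> * \<epsilon> * w ^ 5) + 33 * (\<epsilon> * w ^ 5)"
    by (simp add: eval_nat_numeral)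
  also have "\<dots> \<le> 34 * (\<epsilon> * w ^ 5)" using ee mult_nonneg_nonneg[OF eps(1), of "w^5"] w by simp
  finally have NT: "\<bar>Im Z - T * Re Z\<bar> \<le> 34 * (\<epsilon> * w ^ 5)" .
  have D: "Re Z \<ge> 9/10 * w"
  proof -
    have "f a ^ 3 \<ge> (999/1000) ^ 3" using F unfolding F_def by (intro power_mono) auto
    moreover have "\<bar>\<rho>1 a * w\<bar> \<le> 4 * \<epsilon> * (17/10)" using w by (intro abs_mult_le rho_bounds) auto
    ultimately have "f a ^ 3 + \<rho>1 a * w \<ge> 98/100" using eps by (simp add: power3_eq_cube)
    then have "(2 * sin w) * (f a ^ 3 + \<rho>1 a * w) \<ge> w * (98/100)" using sw w by (intro mult_mono) auto
    moreover have "16 * \<epsilon> * w ^ 3 \<le> 5/100 * w"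
    proof -
      have "16 * \<epsilon> * w ^ 2 \<le> 16 * (1/1000) * (289/100)" using eps w2 by (intro mult_mono) auto
      then have "(16 * \<epsilon> * w ^ 2) * w \<le> 5/100 * w" using w by (intro mult_right_mono) auto
      then show ?thesis by (simp add: power2_eq_square power3_eq_cube)
    qed
    ultimately show ?thesis using ED unfolding ED_def by linarith
  qed
  show D0: "Re Z > 0" using D w by linarith
  have "\<bar>Im Z / Re Z - T\<bar> = \<bar>Im Z - T * Re Z\<bar> / Re Z" 
  proof -
    have "Im Z / Re Z - T = (Im Z - T * Re Z) / Re Z" using D0 by (simp add: field_simps)
    then show ?thesis using D0 by (simp only: abs_divide abs_of_pos)
  qed
  also have "\<dots> \<le> (34 * (\<epsilon> * w ^ 5)) / (9/10 * w)" using NT D w eps by (intro frac_le) auto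
  also have "\<dots> = (340/9) * \<epsilon> * w ^ 4" using w by (simp add: eval_nat_numeral)
  also have "\<dots> \<le> 40 * \<epsilon> * w ^ 4" using w eps by (intro mult_right_mono) auto
  finally have s: "\<bar>Im Z / Re Z - T\<bar> \<le> 40 * \<epsilon> * w ^ 4" .
  then show "\<bar>Im Z / Re Z - slope_approx a w\<bar> \<le> 40 * \<epsilon> * w ^ 4" by (simp add: T_def)
  have "40 * \<epsilon> * w ^ 4 = (40 * \<epsilon> * w ^ 2) * w ^ 2" by (simp add: eval_nat_numeral)
  also have "\<dots> \<le> (40 * \<epsilon> * w ^ 2) * (289/100)" using eps w2 by (intro mult_left_mono) auto
  finally have "40 * \<epsilon> * w ^ 4 \<le> 1156/10 * (\<epsilon> * w ^ 2)" by simp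
  moreover have "0 \<le> \<epsilon> * w ^ 2" using eps by simp
  ultimately show "\<bar>Im Z / Re Z\<bar> \<le> 120 * \<epsilon> * w ^ 2" using s T by simp
qed

text \<open>If \<open>\<psi>\<close> is the angle of the chord against the direction
  \<open>a + w\<close>, the angles at its ends are \<open>w + \<psi>\<close> and
  \<open>w - \<psi>\<close>, whose sum is exactly \<open>2 * w\<close>. In the last claim the orders
  \<open>w\<close> and \<open>w ^ 2\<close> of the two expansions cancel, and \<open>P a\<close> is
  what remains at order \<open>w ^ 3\<close>.\<close>

lemma chord_angle:
  fixes a w :: real
  assumes w: "0 < w" "w \<le> 17/10"
  defines "\<Delta> \<equiv> G (a + 2 * w) - G a"
  shows "\<Delta> \<noteq> 0" "\<bar>Arg (\<Delta> / cis a) - w\<bar> \<le> 120 * \<epsilon> * w ^ 2"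
    "Arg (cis (a + 2 * w) / \<Delta>) = 2 * w - Arg (\<Delta> / cis a)"
    "\<bar>(X (a + 2 * w) - X a) / 2 - f a * Arg (\<Delta> / cis a) - P a * w ^ 3\<bar> \<le> 60 * \<epsilon> * w ^ 4"
proof -
  define Z where "Z = \<Delta> * cis (- (a + w))"
  note sl = chord_slope[OF w, of a, folded \<Delta>_def, folded Z_def]
  define \<psi> where "\<psi> = arctan (Im Z / Re Z)"
  have w2: "w ^ 2 \<le> 289/100" using power_mono[of w "17/10" 2] w by (simp add: power2_eq_square)
  have \<psi>: "\<bar>\<psi>\<bar> \<le> 120 * \<epsilon> * w ^ 2"
  proof -
    have "\<bar>\<psi>\<bar> \<le> \<bar>Im Z / Re Z\<bar>" unfolding \<psi>_def by (rule abs_arctan_le)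
    then show ?thesis using sl(2) by linarith
  qed
  have "120 * \<epsilon> * w ^ 2 \<le> 120 * (1/1000) * (17/10 * w)"
    using eps w by (intro mult_mono) (auto simp: power2_eq_square)
  \<comment> \<open>This keeps \<open>w + \<psi>\<close> and \<open>w - \<psi>\<close> inside
    \<open>(0, pi)\<close>, where \<open>Arg\<close> returns them without a correction by
    \<open>2 * pi\<close>.\<close>
  then have \<psi>w: "\<bar>\<psi>\<bar> \<le> 204/1000 * w" using \<psi> by simp
  have bnd: "0 < w + \<psi>" "w + \<psi> < pi" "0 < w - \<psi>" "w - \<psi> < pi" using \<psi>w w pi_gt3 by linarith+
  have Znz: "Z \<noteq> 0" using sl(1) by auto
  then show nz: "\<Delta> \<noteq> 0" by (auto simp: Z_def)
  have "Arg Z = \<psi>" unfolding \<psi>_def using sl(1) by (simp add: arg_conv_arctan)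
  then have Zc: "Z = of_real (norm Z) * cis \<psi>" using rcis_cmod_Arg[of Z] by (simp add: rcis_def)
  have "\<Delta> = Z * cis (a + w)" unfolding Z_def by (simp add: cis_mult mult.assoc)
  then have Dc: "\<Delta> = of_real (norm Z) * cis (a + w + \<psi>)" using Zc by (metis add.commute cis_mult mult.assoc)
  have 1: "\<Delta> / cis a = rcis (norm Z) (w + \<psi>)"
  proof -
    have "cis (a + w + \<psi>) / cis a = cis (w + \<psi>)" by (simp add: cis_divide)
    moreover have "\<Delta> / cis a = of_real (norm Z) * (cis (a + w + \<psi>) / cis a)" by (subst Dc) simp
    ultimately show ?thesis by (simp only: rcis_def)
  qed
  have Ap: "Arg (\<Delta> / cis a) = w + \<psi>" unfolding 1 using bnd Znz by (intro Arg_rcis) auto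
  have 2: "cis (a + 2 * w) / \<Delta> = rcis (1 / norm Z) (w - \<psi>)"
  proof -
    have "cis (a + 2 * w) / cis (a + w + \<psi>) = cis (w - \<psi>)" by (simp add: cis_divide)
    moreover have "cis (a + 2 * w) / \<Delta> = of_real (1 / norm Z) * (cis (a + 2 * w) / cis (a + w + \<psi>))"
      by (subst Dc) simp
    ultimately show ?thesis by (simp only: rcis_def)
  qed
  have Am: "Arg (cis (a + 2 * w) / \<Delta>) = w - \<psi>" unfolding 2 using bnd Znz by (intro Arg_rcis) auto
  show "\<bar>Arg (\<Delta> / cis a) - w\<bar> \<le> 120 * \<epsilon> * w ^ 2" unfolding Ap using \<psi> by simp
  show "Arg (cis (a + 2 * w) / \<Delta>) = 2 * w - Arg (\<Delta> / cis a)" unfolding Ap Am by simp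
  define y where "y = Im Z / Re Z"
  have y: "\<bar>y\<bar> \<le> 120 * \<epsilon> * w ^ 2" unfolding y_def by (rule sl(2))
  have y1: "\<bar>y\<bar> \<le> 1"
  proof -
    have "120 * \<epsilon> * w ^ 2 \<le> 120 * (1/1000) * (289/100)" using eps w2 by (intro mult_mono) auto
    then show ?thesis using y by simp
  qed
  have E0: "0 \<le> \<epsilon> * w ^ 4" using eps by simp
  have "\<bar>\<psi> - y\<bar> \<le> y\<^sup>2" unfolding \<psi>_def y_def[symmetric] by (rule arctan_minus_self_le[OF y1])
  also have "\<dots> \<le> (120 * \<epsilon> * w ^ 2)\<^sup>2" using y by (intro abs_le_square_iff[THEN iffD1]) auto
  also have "\<dots> = 14400 * \<epsilon> * (\<epsilon> * w ^ 4)" by (simp add: eval_nat_numeral)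
  also have "\<dots> \<le> 14400 * (1/1000) * (\<epsilon> * w ^ 4)" using eps by (intro mult_right_mono mult_left_mono) auto
  finally have "\<bar>\<psi> - slope_approx a w\<bar> \<le> 55 * (\<epsilon> * w ^ 4)"
    using sl(3) E0 unfolding y_def mult.assoc by linarith
  then have e1: "\<bar>f a * (\<psi> - slope_approx a w)\<bar> \<le> 1001/1000 * (55 * (\<epsilon> * w ^ 4))"
    using f_bounds[of a] by (intro abs_mult_le) auto
  have e2: "\<bar>X (a + 2 * w) - (X a + f a * (2 * w) + f1 a * (2 * w)\<^sup>2 / 2 + f2 a * (2 * w) ^ 3 / 6)\<bar> \<le> \<epsilon> * (2 * w) ^ 4 / 24"
    by (rule taylor4_bound[OF dX df bf(4)])
  have "f a \<noteq> 0" using f_bounds[of a] by auto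
  then have e3: "f a * slope_approx a w + P a * w ^ 3 = f1 a * w ^ 2 + 2/3 * f2 a * w ^ 3"
    unfolding slope_approx_def P_def by (simp add: divide_simps) (simp add: algebra_simps power2_eq_square power3_eq_cube)
  have "(X (a + 2 * w) - X a) / 2 - f a * (w + \<psi>) - P a * w ^ 3
     = (X (a + 2 * w) - (X a + f a * (2 * w) + f1 a * (2 * w)\<^sup>2 / 2 + f2 a * (2 * w) ^ 3 / 6)) / 2
       - f a * (\<psi> - slope_approx a w)
       + ((f a * w + f1 a * w ^ 2 + 2/3 * f2 a * w ^ 3) - f a * w - (f a * slope_approx a w + P a * w ^ 3))"
    by (simp add: field_simps power2_eq_square power3_eq_cube)
  also have "\<dots> = (X (a + 2 * w) - (X a + f a * (2 * w) + f1 a * (2 * w)\<^sup>2 / 2 + f2 a * (2 * w) ^ 3 / 6)) / 2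
       - f a * (\<psi> - slope_approx a w)" unfolding e3 by simp
  finally show "\<bar>(X (a + 2 * w) - X a) / 2 - f a * Arg (\<Delta> / cis a) - P a * w ^ 3\<bar> \<le> 60 * \<epsilon> * w ^ 4"
  proof -
    assume *: "(X (a + 2 * w) - X a) / 2 - f a * (w + \<psi>) - P a * w ^ 3 =
      (X (a + 2 * w) - (X a + f a * (2 * w) + f1 a * (2 * w)\<^sup>2 / 2 + f2 a * (2 * w) ^ 3 / 6)) / 2
       - f a * (\<psi> - slope_approx a w)"
    have "\<epsilon> * (2 * w) ^ 4 / 24 = 2/3 * (\<epsilon> * w ^ 4)" by (simp add: power_mult_distrib)
    moreover have "\<bar>A / 2 - B\<bar> \<le> 60 * E" if "\<bar>A\<bar> \<le> 2/3 * E" "\<bar>B\<bar> \<le> 1001/1000 * (55 * E)" "0 \<le> E" for A B E :: real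
      using that by linarith
    ultimately show ?thesis unfolding Ap * mult.assoc[of 60] using e1 e2 E0 by metis
  qed
qed

text \<open>Obtained from \<open>chord_angle\<close> for the reflected curve. \<open>P\<close> is
  invariant because \<open>f1\<close>, the only odd ingredient, enters squared.\<close>

lemma chord_angle_end:
  fixes a w :: real
  assumes w: "0 < w" "w \<le> 17/10"
  defines "\<Delta> \<equiv> G (a + 2 * w) - G a"
  shows "\<bar>(X (a + 2 * w) - X a) / 2 - f (a + 2 * w) * Arg (cis (a + 2 * w) / \<Delta>) - P (a + 2 * w) * w ^ 3\<bar> \<le> 60 * \<epsilon> * w ^ 4"
proof -
  let ?b = "a + 2 * w"
  interpret r: angle_curve "\<lambda>t. f (- t)" "\<lambda>t. - f1 (- t)" "\<lambda>t. f2 (- t)" "\<lambda>t. - f3 (- t)"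
   "\<lambda>t. - X (- t)" "\<lambda>t. - cnj (G (- t))" \<epsilon> by (rule reflected)
  have nz: "\<Delta> \<noteq> 0" unfolding \<Delta>_def by (rule chord_angle(1)[OF w])
  have P: "r.P (- ?b) = P ?b" unfolding r.P_def P_def by (simp add: add.commute)
  have "cis ?b / \<Delta> = of_real (1 / (norm \<Delta>)\<^sup>2) * (cnj \<Delta> / cis (- ?b))"
  proof -
    have "cnj \<Delta> / cis (- ?b) = cnj \<Delta> * cis ?b" by (simp only: divide_inverse cis_inverse minus_minus)
    moreover have "cis ?b / \<Delta> = cis ?b * cnj \<Delta> / of_real ((norm \<Delta>)\<^sup>2)"
      by (subst complex_div_cnj) simp
    ultimately show ?thesis by (simp only: of_real_divide of_real_1) (simp only: mult_ac times_divide_eq_left times_divide_eq_right mult_1_left)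
  qed
  then have "Arg (cis ?b / \<Delta>) = Arg (cnj \<Delta> / cis (- ?b))" using nz by (simp only:) (rule Arg_times_of_real, simp)
  moreover have "- cnj (G (- (- ?b + 2 * w))) - (- cnj (G (- (- ?b)))) = cnj \<Delta>" unfolding \<Delta>_def by (simp add: add.commute)
  ultimately show ?thesis using r.chord_angle(4)[OF w, of "- ?b"] unfolding P by (simp add: \<Delta>_def add.commute[of "2 * w" a])
qed

end

section \<open>Orbits in the Lazutkin coordinate\<close>

text \<open>The derivative of \<open>sin t / t\<close> is at most \<open>t\<close> in absolute
  value. The estimate allows passing from angles to sines without separating the angle from its
  factor \<open>f\<close>.\<close>

lemma sinc_diff_le:
  fixes x y b :: real
  assumes "0 < x" "x \<le> b" "0 < y" "y \<le> b"
  shows "\<bar>sin y / y - sin x / x\<bar> \<le> b * \<bar>y - x\<bar>"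
proof -
  have "norm (sin y / y - sin x / x) \<le> b * norm (y - x)"
  proof (rule field_differentiable_bound[of "{0<..b}" "\<lambda>t. sin t / t" "\<lambda>t. (cos t * t - sin t) / t\<^sup>2"])
    fix t :: real assume t: "t \<in> {0<..b}"
    show "((\<lambda>t. sin t / t) has_real_derivative (cos t * t - sin t) / t\<^sup>2) (at t within {0<..b})"
      using t by (auto intro!: derivative_eq_intros simp: power2_eq_square)
    have s3: "\<bar>sin t - t\<bar> \<le> t ^ 3 / 6"
      using Maclaurin_sin_bound[of t 3] t by (simp add: eval_nat_numeral sin_coeff_def)
    have c: "\<bar>cos t - 1\<bar> \<le> t\<^sup>2 / 2" by (rule cos_minus_one_le)
    have "\<bar>t * (cos t - 1)\<bar> \<le> t * (t\<^sup>2 / 2)" using t c by (intro abs_mult_le) auto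
    moreover have "cos t * t - sin t = t * (cos t - 1) - (sin t - t)" by (simp add: algebra_simps)
    moreover have "t * (t\<^sup>2 / 2) = t ^ 3 / 2" by (simp add: power2_eq_square power3_eq_cube)
    moreover have "t ^ 3 \<ge> 0" using t by simp
    ultimately have "\<bar>cos t * t - sin t\<bar> \<le> t ^ 3" using s3 by linarith
    then have "\<bar>cos t * t - sin t\<bar> / t\<^sup>2 \<le> t ^ 3 / t\<^sup>2" by (intro divide_right_mono) auto
    also have "\<dots> = t" using t by (simp add: power2_eq_square power3_eq_cube)
    finally show "norm ((cos t * t - sin t) / t\<^sup>2) \<le> b" using t by simp
  qed (use assms in \<open>auto intro: convex_real_interval\<close>)
  then show ?thesis by simp
qed

lemma nat_chain_diff_le:
  fixes g :: "nat \<Rightarrow> real"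
  assumes step: "\<And>j. 0 < j \<Longrightarrow> j < q \<Longrightarrow> \<bar>g j - g (j - 1)\<bar> \<le> c" and c: "0 \<le> c"
    and ij: "i < q" "j < q"
  shows "\<bar>g i - g j\<bar> \<le> real q * c"
proof -
  have *: "\<bar>g (i + d) - g i\<bar> \<le> real d * c" if "i + d < q" for i d
    using that
  proof (induction d)
    case (Suc d)
    then show ?case using step[of "i + Suc d"] by (simp add: algebra_simps)
  qed simp
  have **: "\<bar>g j - g i\<bar> \<le> real q * c" if "i \<le> j" "j < q" for i j
  proof -
    have "\<bar>g j - g i\<bar> \<le> real (j - i) * c" using *[of i "j - i"] that by simp
    also have "\<dots> \<le> real q * c" using that c by (intro mult_right_mono) auto
    finally show ?thesis .
  qed
  show ?thesis using **[of i j] **[of j i] ij by (cases "i \<le> j") auto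
qed

lemma almost_const_mean:
  fixes g :: "nat \<Rightarrow> real"
  assumes q: "0 < q" and d: "\<And>i j. i < q \<Longrightarrow> j < q \<Longrightarrow> \<bar>g i - g j\<bar> \<le> c" and S: "(\<Sum>i<q. g i) = S" and j: "j < q"
  shows "\<bar>g j - S / real q\<bar> \<le> c"
proof -
  have "real q * g j - S = (\<Sum>i<q. g j - g i)" using S by (simp add: sum_subtractf)
  then have "\<bar>real q * g j - S\<bar> \<le> (\<Sum>i<q. \<bar>g j - g i\<bar>)" by (metis sum_abs)
  also have "\<dots> \<le> (\<Sum>i<q. c)" by (intro sum_mono d j) auto
  finally have "\<bar>real q * g j - S\<bar> \<le> real q * c" by simp
  moreover have "g j - S / real q = (real q * g j - S) / real q" using q by (simp add: field_simps)
  ultimately show ?thesis using q by (simp add: divide_le_eq mult.commute)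
qed

text \<open>In the variable \<open>1 / w\<close> one step of the recursion changes the value by at most a constant
  times \<open>\<beta>\<close>, so all half-angles stay comparable to their mean.\<close>
lemma half_angles_le:
  fixes w :: "nat \<Rightarrow> real" and q :: nat
  assumes q: "q \<ge> 1" and b: "0 \<le> \<beta>" "\<beta> \<le> 1/100"
    and pos: "\<And>j. j < q \<Longrightarrow> 0 < w j" and le: "\<And>j. j < q \<Longrightarrow> w j \<le> 17/10"
    and sum: "(\<Sum>j<q. w j) = pi"
    and step: "\<And>j. 0 < j \<Longrightarrow> j < q \<Longrightarrow> \<bar>w j - w (j - 1)\<bar> \<le> \<beta> * ((w j)\<^sup>2 + (w (j - 1))\<^sup>2)"
    and j: "j < q"
  shows "w j \<le> 4 / real q"
proof -
  \<comment> \<open>Neighbours are comparable a priori, which lets the sum of squares be replaced by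
    the product of the two half-angles, the denominator of the difference of their
    reciprocals.\<close>
  have ratio: "x \<le> 2 * y" if xy: "0 < x" "x \<le> 17/10" "0 < y" "y \<le> 17/10" "\<bar>x - y\<bar> \<le> \<beta> * (x\<^sup>2 + y\<^sup>2)" for x y
  proof -
    have "x * x \<le> 17/10 * x" "y * y \<le> 17/10 * y" using xy by (auto intro!: mult_right_mono)
    then have "x\<^sup>2 + y\<^sup>2 \<le> 17/10 * (x + y)" unfolding power2_eq_square distrib_left by linarith
    then have "\<beta> * (x\<^sup>2 + y\<^sup>2) \<le> 1/100 * (17/10 * (x + y))" using b xy by (intro mult_mono) auto
    then have "x - y \<le> 1/100 * (17/10 * (x + y))" using xy(5) by linarith
    then show ?thesis using xy by simp
  qed
  have st: "\<bar>1 / w j - 1 / w (j - 1)\<bar> \<le> 4 * \<beta>" if "0 < j" "j < q" for j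
  proof -
    let ?x = "w j" and ?y = "w (j - 1)"
    have xy: "0 < ?x" "?x \<le> 17/10" "0 < ?y" "?y \<le> 17/10" using pos le that by auto
    have s: "\<bar>?x - ?y\<bar> \<le> \<beta> * (?x\<^sup>2 + ?y\<^sup>2)" by (rule step[OF that])
    have r1: "?x \<le> 2 * ?y" by (rule ratio[OF xy s])
    have "\<bar>?y - ?x\<bar> \<le> \<beta> * (?y\<^sup>2 + ?x\<^sup>2)" using s by (simp add: abs_minus_commute add.commute)
    then have r2: "?y \<le> 2 * ?x" using ratio[OF xy(3,4,1,2)] by simp
    have "?x\<^sup>2 + ?y\<^sup>2 \<le> 4 * (?x * ?y)"
    proof -
      have "?x * ?x \<le> ?x * (2 * ?y)" "?y * ?y \<le> (2 * ?x) * ?y" using r1 r2 xy by (auto intro!: mult_left_mono mult_right_mono)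
      then show ?thesis by (simp add: power2_eq_square)
    qed
    then have "\<bar>?x - ?y\<bar> \<le> \<beta> * (4 * (?x * ?y))" using s b mult_left_mono[of "?x\<^sup>2 + ?y\<^sup>2" "4 * (?x * ?y)" \<beta>] by linarith
    moreover have "1 / ?x - 1 / ?y = (?y - ?x) / (?x * ?y)" using xy by (simp add: field_simps)
    then have "\<bar>1 / ?x - 1 / ?y\<bar> = \<bar>?x - ?y\<bar> / (?x * ?y)" using xy by (simp add: abs_minus_commute)
    ultimately show ?thesis using xy by (simp add: divide_le_eq mult_ac)
  qed
  have dif: "\<bar>1 / w i - 1 / w j\<bar> \<le> real q * (4 * \<beta>)" if "i < q" "j < q" for i j
    by (rule nat_chain_diff_le[where g = "\<lambda>j. 1 / w j"]) (use st b that in auto)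
  have "\<exists>i<q. w i \<le> pi / real q"
  proof (rule ccontr)
    assume n: "\<not> (\<exists>i<q. w i \<le> pi / real q)"
    have "(\<Sum>j<q. pi / real q) < (\<Sum>j<q. w j)"
    proof (rule sum_strict_mono)
      show "{..<q} \<noteq> {}" using q by (auto simp: lessThan_empty_iff)
      show "pi / real q < w i" if "i \<in> {..<q}" for i using n that by force
    qed simp
    then show False using sum q by simp
  qed
  then obtain i where i: "i < q" "w i \<le> pi / real q" by blast
  have "real q / pi \<le> 1 / w i" using i pos[OF i(1)] q by (simp add: field_simps)
  moreover have "real q / pi \<ge> real q * (3/10)"
    using q pi_less_4 pi_approx by (simp add: field_simps)
  \<comment> \<open>The total drift of \<open>1 / w\<close> over all steps is at most
    \<open>q * 4/100\<close>, against a starting value of at least \<open>q * 3/10\<close>; the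
    remaining \<open>26/100\<close> exceeds \<open>1/4\<close>.\<close>
  moreover have "real q * (4 * \<beta>) \<le> real q * (4/100)" using b by (intro mult_left_mono) auto
  ultimately have "1 / w j \<ge> real q * (26/100)" using dif[OF i(1) j] by (simp add: algebra_simps)
  then have "1 / w j \<ge> real q / 4" by (simp add: algebra_simps)
  then show ?thesis using pos[OF j] q by (simp add: field_simps)
qed

text \<open>At a common endpoint two consecutive chords have equal angles and the same values of
  \<open>f\<close> and \<open>P\<close>. Subtracting their expansions leaves \<open>P\<close> times
  a difference of cubes and fourth-order remainders, all of order \<open>\<epsilon> / q ^ 4\<close>;
  over \<open>q\<close> steps the lengths thus deviate from their mean by order
  \<open>\<epsilon> / q ^ 3\<close>.\<close>

lemma (in angle_curve) orbit_estimates: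
  fixes \<theta> :: "nat \<Rightarrow> real" and q :: nat
  assumes q: "q \<ge> 2" and eps': "\<epsilon> \<le> 1 / 20000"
    and \<theta>0: "\<theta> 0 = 0" and \<theta>q: "\<theta> q = 2 * pi"
    and inc: "\<And>j. j < q \<Longrightarrow> \<theta> j < \<theta> (Suc j)"
    and small: "\<And>j. j < q \<Longrightarrow> \<theta> (Suc j) - \<theta> j \<le> 34/10"
    and law: "\<And>j. 0 < j \<Longrightarrow> j < q \<Longrightarrow>
       Arg (cis (\<theta> j) / (G (\<theta> j) - G (\<theta> (j - 1)))) = Arg ((G (\<theta> (Suc j)) - G (\<theta> j)) / cis (\<theta> j))"
    and j: "j < q"
  defines "\<phi> \<equiv> \<lambda>j. Arg ((G (\<theta> (Suc j)) - G (\<theta> j)) / cis (\<theta> j))"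
    and "L \<equiv> X (2 * pi) - X 0"
  shows "\<bar>X (\<theta> (Suc j)) - X (\<theta> j) - L / real q\<bar> \<le> 62000 * \<epsilon> / real q ^ 3"
    and "\<bar>f (\<theta> j) * sin (\<phi> j) - L / (2 * pi) * sin (pi / real q)\<bar> \<le> 2000000 * \<epsilon> / real q ^ 3"
proof -
  have q0: "real q \<ge> 2" using q by simp
  define w where "w j = (\<theta> (Suc j) - \<theta> j) / 2" for j
  have wp: "0 < w j" "w j \<le> 17/10" if "j < q" for j using inc[OF that] small[OF that] by (auto simp: w_def)
  have \<theta>S: "\<theta> j + 2 * w j = \<theta> (Suc j)" for j by (simp add: w_def field_simps)
  define Y where "Y j = X (\<theta> (Suc j)) - X (\<theta> j)" for j
  define \<phi>m where "\<phi>m j = Arg (cis (\<theta> (Suc j)) / (G (\<theta> (Suc j)) - G (\<theta> j)))" for j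
  have c2: "\<bar>\<phi> j - w j\<bar> \<le> 120 * \<epsilon> * w j ^ 2" "\<phi>m j = 2 * w j - \<phi> j"
    "\<bar>Y j / 2 - f (\<theta> j) * \<phi> j - P (\<theta> j) * w j ^ 3\<bar> \<le> 60 * \<epsilon> * w j ^ 4"
    "\<bar>Y j / 2 - f (\<theta> (Suc j)) * \<phi>m j - P (\<theta> (Suc j)) * w j ^ 3\<bar> \<le> 60 * \<epsilon> * w j ^ 4" if "j < q" for j
    using chord_angle[OF wp[OF that], of "\<theta> j"] chord_angle_end[OF wp[OF that], of "\<theta> j"]
    unfolding \<theta>S \<phi>_def \<phi>m_def Y_def by auto
  have law': "\<phi>m (j - 1) = \<phi> j" if "0 < j" "j < q" for j
    using law[OF that] that unfolding \<phi>_def \<phi>m_def by simp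
  have sw: "(\<Sum>j<q. w j) = pi"
  proof -
    have "(\<Sum>j<q. w j) = (\<Sum>j<q. \<theta> (Suc j) - \<theta> j) / 2" by (simp add: w_def sum_divide_distrib)
    then show ?thesis using \<theta>0 \<theta>q by (simp add: sum_lessThan_telescope)
  qed
  \<comment> \<open>The reflection law equates one angle of each chord, and each angle differs from
    its own half-angle by at most \<open>120 * \<epsilon>\<close> times the square.\<close>
  have step: "\<bar>w j - w (j - 1)\<bar> \<le> 120 * \<epsilon> * ((w j)\<^sup>2 + (w (j - 1))\<^sup>2)" if "0 < j" "j < q" for j
  proof -
    have "j - 1 < q" using that by simp
    then show ?thesis using c2(1)[OF that(2)] c2(1,2)[of "j - 1"] law'[OF that] unfolding distrib_left by linarith
  qed
  have wq: "w j \<le> 4 / real q" if "j < q" for j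
    by (rule half_angles_le[of q "120 * \<epsilon>" w]) (use q eps eps' wp sw step that in auto)
  have wk: "w j ^ k \<le> 4 ^ k / real q ^ k" if "j < q" for j k
    using power_mono[OF wq[OF that], of k] wp[OF that] by (simp add: power_divide)
  have Ystep: "\<bar>Y j - Y (j - 1)\<bar> \<le> 62000 * \<epsilon> / real q ^ 4" if "0 < j" "j < q" for j
  proof -
    have j1: "j - 1 < q" using that by simp
    let ?x = "w j" and ?y = "w (j - 1)"
    have "?x\<^sup>2 + ?y\<^sup>2 \<le> 32 / (real q)\<^sup>2" using wk[OF that(2), of 2] wk[OF j1, of 2] by simp
    then have "120 * \<epsilon> * (?x\<^sup>2 + ?y\<^sup>2) \<le> 120 * (1/20000) * (32 / (real q)\<^sup>2)" using eps eps' by (intro mult_mono) auto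
    then have a: "\<bar>?x - ?y\<bar> \<le> (192/1000) / (real q)\<^sup>2" using step[OF that] by simp
    have "?x * ?y \<le> (4 / real q) * (4 / real q)" using wq[OF that(2)] wq[OF j1] wp[OF that(2)] wp[OF j1]
      by (intro mult_mono) auto
    then have "?x\<^sup>2 + ?x * ?y + ?y\<^sup>2 \<le> 48 / (real q)\<^sup>2"
      using wk[OF that(2), of 2] wk[OF j1, of 2] by (simp add: power2_eq_square)
    moreover have "?x\<^sup>2 + ?x * ?y + ?y\<^sup>2 \<ge> 0" using wp[OF that(2)] wp[OF j1] by simp
    ultimately have b: "\<bar>?x\<^sup>2 + ?x * ?y + ?y\<^sup>2\<bar> \<le> 48 / (real q)\<^sup>2" by simp
    have "\<bar>(?x - ?y) * (?x\<^sup>2 + ?x * ?y + ?y\<^sup>2)\<bar> \<le> (192/1000) / (real q)\<^sup>2 * (48 / (real q)\<^sup>2)"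
      by (rule abs_mult_le[OF a b])
    moreover have "(?x - ?y) * (?x\<^sup>2 + ?x * ?y + ?y\<^sup>2) = ?x ^ 3 - ?y ^ 3"
      by (simp add: algebra_simps power2_eq_square power3_eq_cube)
    ultimately have "\<bar>?x ^ 3 - ?y ^ 3\<bar> \<le> 10 / real q ^ 4"
      by (simp add: power2_eq_square power4_eq_xxxx)
    then have p: "\<bar>P (\<theta> j) * (?x ^ 3 - ?y ^ 3)\<bar> \<le> \<epsilon> * (10 / real q ^ 4)" by (intro abs_mult_le P_bound)
    have "\<theta> (Suc (j - 1)) = \<theta> j" using that by simp
    then have A1: "\<bar>Y (j - 1) / 2 - f (\<theta> j) * \<phi> j - P (\<theta> j) * ?y ^ 3\<bar> \<le> 60 * \<epsilon> * ?y ^ 4"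
      using c2(4)[OF j1] law'[OF that] by simp
    have A2: "\<bar>Y j / 2 - f (\<theta> j) * \<phi> j - P (\<theta> j) * ?x ^ 3\<bar> \<le> 60 * \<epsilon> * ?x ^ 4" by (rule c2(3)[OF that(2)])
    have w4: "60 * \<epsilon> * ?x ^ 4 \<le> 60 * \<epsilon> * (256 / real q ^ 4)" "60 * \<epsilon> * ?y ^ 4 \<le> 60 * \<epsilon> * (256 / real q ^ 4)"
      using wk[OF that(2), of 4] wk[OF j1, of 4] eps by (intro mult_left_mono; simp)+
    have "\<bar>Y j / 2 - Y (j - 1) / 2\<bar> \<le> \<epsilon> * (10 / real q ^ 4) + 2 * (60 * \<epsilon> * (256 / real q ^ 4))"
      using p A1 A2 w4 unfolding right_diff_distrib by linarith
    \<comment> \<open>\<open>30730 = 10 + 2 * 60 * 256\<close>, the \<open>256\<close> being the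
      fourth power of the \<open>4\<close> in \<open>w j \<le> 4 / real q\<close>.\<close>
    also have "\<dots> = 30730 * (\<epsilon> / real q ^ 4)" by simp
    finally have "\<bar>Y j - Y (j - 1)\<bar> \<le> 61460 * (\<epsilon> / real q ^ 4)" by linarith
    also have "\<dots> \<le> 62000 * (\<epsilon> / real q ^ 4)" using eps by (intro mult_right_mono) auto
    finally show ?thesis by simp
  qed
  have Yd: "\<bar>Y i - Y j\<bar> \<le> 62000 * \<epsilon> / real q ^ 3" if "i < q" "j < q" for i j
  proof -
    have "\<bar>Y i - Y j\<bar> \<le> real q * (62000 * \<epsilon> / real q ^ 4)"
      by (rule nat_chain_diff_le[where g = Y]) (use Ystep that eps in auto)
    also have "\<dots> = 62000 * \<epsilon> / real q ^ 3" using q0 by (simp add: eval_nat_numeral)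
    finally show ?thesis .
  qed
  have sY: "(\<Sum>j<q. Y j) = L"
    unfolding Y_def L_def using sum_lessThan_telescope[of "\<lambda>j. X (\<theta> j)" q] \<theta>0 \<theta>q by simp
  have Yj: "\<bar>Y j - L / real q\<bar> \<le> 62000 * \<epsilon> / real q ^ 3"
    by (rule almost_const_mean[where g = Y, OF _ Yd sY j]) (use q in auto)
  then show "\<bar>X (\<theta> (Suc j)) - X (\<theta> j) - L / real q\<bar> \<le> 62000 * \<epsilon> / real q ^ 3" by (simp add: Y_def)

  define E where "E = \<epsilon> / real q ^ 3"
  have E0: "0 \<le> E" using eps by (simp add: E_def)
  define F where "F = f (\<theta> j)"
  define h where "h = \<phi> j"
  have F: "\<bar>F - 1\<bar> \<le> \<epsilon>" "\<bar>F\<bar> \<le> 1001/1000" using bf(1)[of "\<theta> j"] f_bounds[of "\<theta> j"] by (auto simp: F_def)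
  have Fh: "\<bar>F * h - L / (2 * real q)\<bar> \<le> 47000 * E"
  proof -
    have "\<bar>P (\<theta> j) * w j ^ 3\<bar> \<le> \<epsilon> * (64 / real q ^ 3)" using wk[OF j, of 3] wp[OF j] by (intro abs_mult_le P_bound) auto
    moreover have "60 * \<epsilon> * w j ^ 4 \<le> 15360 * E"
    proof -
      have "w j ^ 4 \<le> 256 / real q ^ 4" using wk[OF j, of 4] by simp
      also have "\<dots> \<le> 256 / real q ^ 3" using q0 by (intro divide_left_mono power_increasing) auto
      finally have "60 * \<epsilon> * w j ^ 4 \<le> 60 * \<epsilon> * (256 / real q ^ 3)" using eps by (intro mult_left_mono) auto
      then show ?thesis by (simp add: E_def)
    qed
    moreover have "\<epsilon> * (64 / real q ^ 3) = 64 * E" "62000 * \<epsilon> / real q ^ 3 = 62000 * E" by (simp_all add: E_def)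
    moreover have "L / (2 * real q) = (L / real q) / 2" by simp
    ultimately show ?thesis using c2(3)[OF j] Yj E0 unfolding F_def h_def by linarith
  qed
  have h1: "0 < h" "h \<le> 6 / real q"
  proof -
    have "w j * w j \<le> 17/10 * w j" using wp[OF j] by (intro mult_right_mono) auto
    then have "120 * \<epsilon> * w j ^ 2 \<le> 120 * (1/20000) * (17/10 * w j)"
      using eps eps' wp[OF j] by (intro mult_mono) (auto simp: power2_eq_square)
    then have h: "\<bar>h - w j\<bar> \<le> 2/100 * w j" using c2(1)[OF j] wp[OF j] unfolding h_def by simp
    show "0 < h" using h wp[OF j] by linarith
    have "h \<le> 3/2 * w j" using h wp[OF j] by linarith
    also have "\<dots> \<le> 3/2 * (4 / real q)" by (intro mult_left_mono wq j) auto
    finally show "h \<le> 6 / real q" by simp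
  qed
  have L: "\<bar>L - 2 * pi\<bar> \<le> 7 * \<epsilon>"
  proof -
    have "norm ((X (2 * pi) - 2 * pi) - (X 0 - 0)) \<le> \<epsilon> * norm (2 * pi - 0)"
    proof (rule field_differentiable_bound[of UNIV "\<lambda>t. X t - t" "\<lambda>t. f t - 1"])
      fix t
      show "((\<lambda>t. X t - t) has_real_derivative f t - 1) (at t within UNIV)"
        by (auto intro!: derivative_eq_intros dX)
      show "norm (f t - 1) \<le> \<epsilon>" using bf(1)[of t] by simp
    qed auto
    then have "\<bar>L - 2 * pi\<bar> \<le> \<epsilon> * (2 * pi)" by (simp add: L_def algebra_simps)
    also have "\<dots> \<le> \<epsilon> * 7" using eps pi_approx by (intro mult_left_mono) auto
    finally show ?thesis by simp
  qed
  \<comment> \<open>Only first order in \<open>1 / q\<close> is available here, because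
    \<open>F\<close> itself varies by \<open>\<epsilon>\<close>.\<close>
  have hp: "\<bar>h - pi / real q\<bar> \<le> 50000 * \<epsilon> / real q"
  proof -
    have a: "\<bar>(F - 1) * h\<bar> \<le> \<epsilon> * (6 / real q)" using h1 by (intro abs_mult_le F) auto
    have b: "\<bar>L / (2 * real q) - pi / real q\<bar> \<le> 4 * (\<epsilon> / real q)"
    proof -
      have "L / (2 * real q) - pi / real q = (L - 2 * pi) / (2 * real q)" using q0 by (simp add: field_simps)
      then have "\<bar>L / (2 * real q) - pi / real q\<bar> = \<bar>L - 2 * pi\<bar> / (2 * real q)" using q0 by simp
      also have "\<dots> \<le> (7 * \<epsilon>) / (2 * real q)" using L q0 by (intro divide_right_mono) auto
      also have "\<dots> = 7/2 * (\<epsilon> / real q)" by simp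
      also have "\<dots> \<le> 4 * (\<epsilon> / real q)" using eps by (intro mult_right_mono) auto
      finally show ?thesis .
    qed
    have c: "E \<le> \<epsilon> / real q" unfolding E_def using eps q0 by (intro divide_left_mono) (auto simp: self_le_power)
    have "h - pi / real q = - ((F - 1) * h) + (F * h - L / (2 * real q)) + (L / (2 * real q) - pi / real q)"
      by (simp add: algebra_simps)
    then have "\<bar>h - pi / real q\<bar> \<le> \<epsilon> * (6 / real q) + 47000 * E + 4 * (\<epsilon> / real q)" using a b Fh by linarith
    also have "\<dots> \<le> 47010 * (\<epsilon> / real q)" using c by simp
    also have "\<dots> \<le> 50000 * (\<epsilon> / real q)" using eps by (intro mult_right_mono) auto
    finally show ?thesis by simp
  qed
  define x where "x = pi / real q"
  have x: "0 < x" "x \<le> 6 / real q" using q0 pi_less_4 by (auto simp: x_def divide_right_mono)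
  have sc: "\<bar>sin h / h - sin x / x\<bar> \<le> (6 / real q) * (50000 * \<epsilon> / real q)"
  proof -
    have "\<bar>sin h / h - sin x / x\<bar> \<le> (6 / real q) * \<bar>h - x\<bar>" by (rule sinc_diff_le[OF x h1])
    also have "\<dots> \<le> (6 / real q) * (50000 * \<epsilon> / real q)" using hp by (intro mult_left_mono) (auto simp: x_def)
    finally show ?thesis .
  qed
  have Fh6: "\<bar>F * h\<bar> \<le> 1001/1000 * (6 / real q)" using h1 by (intro abs_mult_le F) auto
  have t1: "\<bar>(F * h) * (sin h / h - sin x / x)\<bar> \<le> (1001/1000 * (6 / real q)) * ((6 / real q) * (50000 * \<epsilon> / real q))"
    by (rule abs_mult_le[OF Fh6 sc])
  have "\<bar>sin x / x\<bar> \<le> 1" using abs_sin_x_le_abs_x[of x] x by (simp add: divide_le_eq)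
  then have t2: "\<bar>(sin x / x) * (F * h - L / (2 * real q))\<bar> \<le> 1 * (47000 * E)" by (intro abs_mult_le Fh)
  have "(sin x / x) * (L / (2 * real q)) = L / (2 * pi) * sin x" using q0 by (simp add: x_def mult.commute)
  \<comment> \<open>The product \<open>F * h\<close> is known to order
    \<open>\<epsilon> / q ^ 3\<close>, each factor alone only up to a relative error of order
    \<open>\<epsilon>\<close>. Hence \<open>F * h\<close> is kept together, and the cruder bound on
    \<open>h\<close> is spent on \<open>sin h / h\<close> only.\<close>
  then have "F * sin h - L / (2 * pi) * sin x = (F * h) * (sin h / h - sin x / x) + (sin x / x) * (F * h - L / (2 * real q))"
    using h1 by (simp add: algebra_simps)
  then have "\<bar>F * sin h - L / (2 * pi) * sin x\<bar> \<le> (1001/1000 * (6 / real q)) * ((6 / real q) * (50000 * \<epsilon> / real q)) + 1 * (47000 * E)"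
    by (simp only:) (rule order_trans[OF abs_triangle_ineq add_mono[OF t1 t2]])
  also have "\<dots> = 1848800 * E" by (simp add: E_def power3_eq_cube)
  also have "\<dots> \<le> 2000000 * E" using E0 by simp
  finally show "\<bar>f (\<theta> j) * sin (\<phi> j) - L / (2 * pi) * sin (pi / real q)\<bar> \<le> 2000000 * \<epsilon> / real q ^ 3"
    by (simp add: F_def h_def x_def E_def)
qed

section \<open>Curves close to a circle\<close>

lemma Ck_has_vd: "Ck m f \<Longrightarrow> k < m \<Longrightarrow> (vd k f has_vector_derivative vd (Suc k) f t) (at t)"
  unfolding Ck_def by blast

lemma Ck_continuous_vd:
  assumes "Ck m f" "k \<le> m" shows "continuous_on A (vd k f)"
proof (cases "k = m")
  case True then show ?thesis using assms continuous_on_subset unfolding Ck_def by blast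
next
  case False
  then show ?thesis using assms Ck_has_vd[of m f k] 
    by (intro continuous_at_imp_continuous_on ballI has_vector_derivative_continuous) auto
qed

lemma vd_diff:
  assumes f: "Ck m f" and g: "Ck m g"
  shows "k \<le> m \<Longrightarrow> vd k (\<lambda>t. f t - g t) = (\<lambda>t. vd k f t - vd k g t)"
proof (induction k)
  case (Suc k)
  then have e: "vd k (\<lambda>t. f t - g t) = (\<lambda>t. vd k f t - vd k g t)" by simp
  have "((\<lambda>t. vd k f t - vd k g t) has_vector_derivative (vd (Suc k) f t - vd (Suc k) g t)) (at t)" for t
    using Suc.prems by (intro has_vector_derivative_diff Ck_has_vd[OF f] Ck_has_vd[OF g]) auto
  then show ?case unfolding vd.simps(2)[of k "\<lambda>t. f t - g t"] e by (auto intro!: ext vector_derivative_at simp del: vd.simps)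
qed simp

lemma Ck_diff: assumes f: "Ck m f" and g: "Ck m g" shows "Ck m (\<lambda>t. f t - g t)"
  unfolding Ck_def
proof (intro conjI allI impI)
  fix k t assume k: "k < m"
  show "(vd k (\<lambda>t. f t - g t) has_vector_derivative vd (Suc k) (\<lambda>t. f t - g t) t) (at t)"
    using k vd_diff[OF f g, of k] vd_diff[OF f g, of "Suc k"]
    by (auto simp del: vd.simps intro!: has_vector_derivative_diff Ck_has_vd[OF f] Ck_has_vd[OF g])
next
  show "continuous_on UNIV (vd m (\<lambda>t. f t - g t))"
    unfolding vd_diff[OF f g order_refl] by (intro continuous_intros Ck_continuous_vd[OF f] Ck_continuous_vd[OF g]) auto
qed

lemma vd_shift:
  assumes f: "Ck m f"
  shows "k \<le> m \<Longrightarrow> vd k (\<lambda>t. f (t + a)) = (\<lambda>t. vd k f (t + a))"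
proof (induction k)
  case (Suc k)
  have "((\<lambda>t. vd k f (t + a)) has_vector_derivative vd (Suc k) f (t + a)) (at t)" for t
  proof -
    have "((\<lambda>t. t + a) has_vector_derivative 1) (at t)" by (auto intro!: derivative_eq_intros)
    from vector_diff_chain_at[OF this Ck_has_vd[OF f, of k "t + a"]] Suc.prems show ?thesis by (simp add: o_def)
  qed
  then show ?case using Suc unfolding vd.simps(2)[of k "\<lambda>t. f (t + a)"] by (auto intro!: ext vector_derivative_at simp del: vd.simps)
qed simp

lemma vd_periodic:
  assumes f: "Ck m f" and per: "\<And>t. f (t + 1) = f t" and k: "k \<le> m"
  shows "vd k f (t + 1) = vd k f t"
  using vd_shift[OF f k, of 1] per by (metis (no_types, lifting) ext)

text \<open>A real \<open>SUP\<close> bounds its members only if the set is bounded above;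
  continuity on the compact interval provides this for every summand.\<close>

lemma Cnorm_bound:
  assumes f: "Ck m f" and k: "k \<le> m" and s: "s \<in> {0..1}"
  shows "norm (vd k f s) \<le> Cnorm m f"
proof -
  have bd: "bdd_above ((\<lambda>s. norm (vd i f s)) ` {0..1})" if "i \<le> m" for i
    by (intro bounded_imp_bdd_above compact_imp_bounded compact_continuous_image continuous_intros Ck_continuous_vd[OF f that]) auto
  have nn: "0 \<le> (SUP s\<in>{0..1}. norm (vd i f s))" if "i \<le> m" for i
  proof -
    have "norm (vd i f 0) \<le> (SUP s\<in>{0..1}. norm (vd i f s))" by (intro cSUP_upper bd that) auto
    then show ?thesis using norm_ge_zero order_trans by blast
  qed
  have "norm (vd k f s) \<le> (SUP s\<in>{0..1}. norm (vd k f s))" by (intro cSUP_upper bd k s)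
  also have "\<dots> \<le> Cnorm m f" unfolding Cnorm_def using k nn by (intro member_le_sum) auto
  finally show ?thesis .
qed

lemma exp_vderiv: "((\<lambda>s. exp (2 * pi * \<i> * complex_of_real s)) has_vector_derivative 2 * pi * \<i> * exp (2 * pi * \<i> * complex_of_real t)) (at t)"
  by (rule has_vector_derivative_real_field) (auto intro!: derivative_eq_intros)

text \<open>The total function \<open>vd\<close> carries no differentiability by itself, so the
  closed form and the existence of the derivatives are proved in one induction.\<close>

lemma vd_tangent_disk_Suc:
  "vd (Suc k) (tangent_disk \<eta>) = (\<lambda>s. vd 1 \<eta> 0 * (2 * pi * \<i>) ^ k * exp (2 * pi * \<i> * complex_of_real s))"
  and tangent_disk_has_vd: "(vd k (tangent_disk \<eta>) has_vector_derivative vd (Suc k) (tangent_disk \<eta>) t) (at t)"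
proof -
  have d0: "(tangent_disk \<eta> has_vector_derivative vd 1 \<eta> 0 * exp (2 * pi * \<i> * complex_of_real t)) (at t)" for t
  proof -
    have "((\<lambda>s. \<eta> 0 + vd 1 \<eta> 0 / (2 * pi * \<i>) * (exp (2 * pi * \<i> * complex_of_real s) - 1)) has_vector_derivative
       0 + vd 1 \<eta> 0 / (2 * pi * \<i>) * (2 * pi * \<i> * exp (2 * pi * \<i> * complex_of_real t) - 0)) (at t)"
      by (intro has_vector_derivative_add has_vector_derivative_const has_vector_derivative_mult_right has_vector_derivative_diff exp_vderiv)
    then show ?thesis unfolding tangent_disk_def[abs_def] by (simp add: field_simps)
  qed
  have *: "vd (Suc k) (tangent_disk \<eta>) = (\<lambda>s. vd 1 \<eta> 0 * (2 * pi * \<i>) ^ k * exp (2 * pi * \<i> * complex_of_real s))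
     \<and> (\<forall>t. (vd k (tangent_disk \<eta>) has_vector_derivative vd (Suc k) (tangent_disk \<eta>) t) (at t))" for k
  proof (induction k)
    case 0
    have "vd (Suc 0) (tangent_disk \<eta>) = (\<lambda>s. vd 1 \<eta> 0 * exp (2 * pi * \<i> * complex_of_real s))"
      using vector_derivative_at[OF d0] by auto
    then show ?case using d0 by simp
  next
    case (Suc k)
    have d: "((\<lambda>s. vd 1 \<eta> 0 * (2 * pi * \<i>) ^ k * exp (2 * pi * \<i> * complex_of_real s)) has_vector_derivative
       vd 1 \<eta> 0 * (2 * pi * \<i>) ^ k * (2 * pi * \<i> * exp (2 * pi * \<i> * complex_of_real t))) (at t)" for t
      by (intro has_vector_derivative_mult_right exp_vderiv)
    have e: "vd (Suc (Suc k)) (tangent_disk \<eta>) = (\<lambda>t. vd 1 \<eta> 0 * (2 * pi * \<i>) ^ Suc k * exp (2 * pi * \<i> * complex_of_real t))"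
      unfolding vd.simps(2)[of "Suc k"] conjunct1[OF Suc.IH] using vector_derivative_at[OF d]
      by (auto simp: mult_ac)
    show ?case using d unfolding e conjunct1[OF Suc.IH] by (simp add: mult_ac)
  qed
  show "vd (Suc k) (tangent_disk \<eta>) = (\<lambda>s. vd 1 \<eta> 0 * (2 * pi * \<i>) ^ k * exp (2 * pi * \<i> * complex_of_real s))" using * by blast
  show "(vd k (tangent_disk \<eta>) has_vector_derivative vd (Suc k) (tangent_disk \<eta>) t) (at t)" using * by blast
qed

lemma Ck_tangent_disk: "Ck m (tangent_disk \<eta>)"
  unfolding Ck_def
proof (intro conjI allI impI)
  show "continuous_on UNIV (vd m (tangent_disk \<eta>))"
    using tangent_disk_has_vd[of m \<eta>] by (intro continuous_at_imp_continuous_on ballI has_vector_derivative_continuous) auto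
qed (rule tangent_disk_has_vd)

lemma tangent_disk_periodic: "tangent_disk \<eta> (s + 1) = tangent_disk \<eta> s"
proof -
  have "exp (2 * pi * \<i> * complex_of_real (s + 1)) = exp (2 * pi * \<i> * complex_of_real s) * exp (2 * pi * \<i>)"
    unfolding of_real_add distrib_left exp_add by simp
  then show ?thesis by (simp add: tangent_disk_def)
qed

section \<open>Arc-length parametrisations of the same boundary differ by a shift\<close>

lemma tangent_disk_chord:
  assumes u: "norm (vd 1 \<eta> 0) = 1" and le: "\<bar>t - s\<bar> \<le> 1/2"
  shows "\<bar>t - s\<bar> / 2 \<le> norm (tangent_disk \<eta> t - tangent_disk \<eta> s)"
proof -
  have "tangent_disk \<eta> t - tangent_disk \<eta> s
    = vd 1 \<eta> 0 / (2 * pi * \<i>) * exp (2 * pi * \<i> * complex_of_real s) * (exp (2 * pi * \<i> * complex_of_real (t - s)) - 1)"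
    unfolding tangent_disk_def by (simp add: field_simps flip: exp_add)
  also have "exp (2 * pi * \<i> * complex_of_real (t - s)) = cis (2 * pi * (t - s))" by (simp add: cis_conv_exp mult_ac)
  also have "exp (2 * pi * \<i> * complex_of_real s) = cis (2 * pi * s)" by (simp add: cis_conv_exp mult_ac)
  finally have e: "norm (tangent_disk \<eta> t - tangent_disk \<eta> s) = norm (cis (2 * pi * (t - s)) - 1) / (2 * pi)"
    using u by (simp add: norm_mult norm_divide)
  have n: "norm (cis (2 * pi * (t - s)) - 1) = 2 * \<bar>sin (pi * (t - s))\<bar>"
    unfolding norm_cis_minus_one by (simp add: mult.assoc)
  have "\<bar>sin (pi * (t - s))\<bar> = \<bar>sin (pi * \<bar>t - s\<bar>)\<bar>" 
  proof (cases "s \<le> t")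
    case False
    then have "pi * (t - s) = - (pi * \<bar>t - s\<bar>)" by (simp add: algebra_simps)
    then show ?thesis by (simp only: sin_minus abs_minus_cancel)
  qed simp
  moreover have "sin (pi * \<bar>t - s\<bar>) \<ge> pi * \<bar>t - s\<bar> / 2"
  proof (rule sin_ge_half)
    have "pi * \<bar>t - s\<bar> \<le> (34/10) * (1/2)" using le pi_approx by (intro mult_mono) auto
    then show "pi * \<bar>t - s\<bar> \<le> 17/10" by simp
  qed simp
  ultimately have "norm (cis (2 * pi * (t - s)) - 1) \<ge> pi * \<bar>t - s\<bar>" unfolding n by linarith
  then have "norm (cis (2 * pi * (t - s)) - 1) / (2 * pi) \<ge> pi * \<bar>t - s\<bar> / (2 * pi)" by (intro divide_right_mono) auto
  then show ?thesis unfolding e by simp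
qed

text \<open>A counterclockwise unit tangent is determined by a supporting line at the boundary point.\<close>
lemma tangent_unique:
  fixes \<gamma> \<eta> :: "real \<Rightarrow> complex"
  assumes conv: "convex \<Omega>" and op: "open \<Omega>"
    and g: "perim1_arclen m \<Omega> \<gamma>" and h: "perim1_arclen m \<Omega> \<eta>" and m: "m \<ge> 1"
    and eq: "\<gamma> s = \<eta> t"
  shows "vd 1 \<gamma> s = vd 1 \<eta> t"
proof -
  let ?p = "\<gamma> s"
  have img: "\<mu> \<tau> \<in> frontier \<Omega>" if "perim1_arclen m \<Omega> \<mu>" for \<mu> \<tau>
  proof -
    have "\<mu> \<tau> = \<mu> (frac \<tau>)" using that by (intro periodic_frac) (auto simp: perim1_arclen_def)
    moreover have "frac \<tau> \<in> {0..1}" using frac_ge_0[of \<tau>] frac_lt_1[of \<tau>] by auto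
    ultimately show ?thesis using that unfolding perim1_arclen_def by blast
  qed
  have ne: "\<Omega> \<noteq> {}" using img[OF g, of s] by auto
  have "?p \<notin> \<Omega>" using img[OF g, of s] op by (simp add: frontier_def interior_open)
  then have "\<Omega> \<inter> {?p} = {}" by auto
  then obtain n b where n: "n \<noteq> 0" "\<And>x. x \<in> \<Omega> \<Longrightarrow> inner n x \<le> b" "\<And>x. x \<in> {?p} \<Longrightarrow> inner n x \<ge> b"
    using separating_hyperplane_sets[OF conv convex_singleton[of ?p] ne] by blast
  have cl: "inner n x \<le> b" if "x \<in> closure \<Omega>" for x
  proof -
    have "closure \<Omega> \<subseteq> {x. inner n x \<le> b}" using n(2) by (intro closure_minimal closed_halfspace_le) auto
    then show ?thesis using that by auto
  qed
  have fr: "inner n x \<le> inner n ?p" if "x \<in> closure \<Omega>" for x using cl[OF that] n(3)[of ?p] by auto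
  have tang: "\<i> * vd 1 \<mu> \<tau> = - sgn n" if mu: "perim1_arclen m \<Omega> \<mu>" and p: "\<mu> \<tau> = ?p" for \<mu> \<tau>
  proof -
    let ?v = "vd 1 \<mu> \<tau>"
    have ck: "Ck m \<mu>" and u: "norm ?v = 1" using mu by (auto simp: perim1_arclen_def)
    have d: "(\<mu> has_vector_derivative ?v) (at \<tau>)" using Ck_has_vd[OF ck, of 0 \<tau>] m by simp
    have "((\<lambda>t. inner n (\<mu> t)) has_real_derivative inner n ?v) (at \<tau>)"
      using bounded_linear.has_vector_derivative[OF bounded_linear_inner_right d]
      by (simp add: has_real_derivative_iff_has_vector_derivative)
    then have z: "inner n ?v = 0"
    proof (rule DERIV_local_max[of _ _ _ 1])
      show "\<forall>y. \<bar>\<tau> - y\<bar> < 1 \<longrightarrow> inner n (\<mu> y) \<le> inner n (\<mu> \<tau>)"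
        using fr img[OF mu] p by (auto simp: frontier_def)
    qed simp
    \<comment> \<open>Tangency leaves the sign of the direction open; the inward normal of the
      counterclockwise orientation fixes it.\<close>
    obtain e where e: "e > 0" "\<And>t. 0 < t \<and> t < e \<Longrightarrow> \<mu> \<tau> + complex_of_real t * \<i> * ?v \<in> \<Omega>"
      using mu unfolding perim1_arclen_def by blast
    have "\<mu> \<tau> + complex_of_real (e/2) * \<i> * ?v \<in> \<Omega>" using e(1) by (intro e(2)) simp
    then have "inner n (\<mu> \<tau> + complex_of_real (e/2) * \<i> * ?v) \<le> inner n ?p" using fr closure_subset by blast
    moreover have "complex_of_real (e/2) * \<i> * ?v = (e/2) *\<^sub>R (\<i> * ?v)" by (simp add: scaleR_conv_of_real)
    ultimately have "inner n (\<mu> \<tau> + (e/2) *\<^sub>R (\<i> * ?v)) \<le> inner n ?p" by (simp only:)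
    then have "(e/2) * inner n (\<i> * ?v) \<le> 0" unfolding p inner_add_right inner_scaleR_right by simp
    then have le: "inner n (\<i> * ?v) \<le> 0" using e(1) by (simp add: mult_le_0_iff)
    obtain v1 v2 where v: "?v = Complex v1 v2" by (cases ?v)
    obtain n1 n2 where nn: "n = Complex n1 n2" by (cases n)
    have vv: "v1\<^sup>2 + v2\<^sup>2 = 1" using u v by (simp add: cmod_def)
    have z': "n1 * v1 + n2 * v2 = 0" using z v nn by (simp add: inner_complex_def)
    define k where "k = n1 * v2 - n2 * v1"
    have le': "k \<ge> 0" using le v nn by (simp add: inner_complex_def k_def)
    have "n1 = k * v2" "n2 = - k * v1"
    proof -
      have a: "n1 * v1 = - (n2 * v2)" using z' by simp
      have "n1 = n1 * (v1\<^sup>2 + v2\<^sup>2)" using vv by simp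
      also have "\<dots> = (n1 * v1) * v1 + n1 * v2\<^sup>2" by (simp add: algebra_simps power2_eq_square)
      also have "\<dots> = k * v2" unfolding a k_def by (simp add: algebra_simps power2_eq_square)
      finally show "n1 = k * v2" .
      have b: "n2 * v2 = - (n1 * v1)" using z' by simp
      have "n2 = n2 * (v1\<^sup>2 + v2\<^sup>2)" using vv by simp
      also have "\<dots> = n2 * v1\<^sup>2 + (n2 * v2) * v2" by (simp add: algebra_simps power2_eq_square)
      also have "\<dots> = - k * v1" unfolding b k_def by (simp add: algebra_simps power2_eq_square)
      finally show "n2 = - k * v1" .
    qed
    then have nk: "n = of_real (- k) * (\<i> * ?v)" unfolding v nn by (simp add: complex_eq_iff)
    have k0: "k > 0" using le' n(1) nk by (cases "k = 0") auto
    have "norm n = k" using k0 nk u by (simp add: norm_mult)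
    then show ?thesis using nk k0 by (simp add: sgn_div_norm scaleR_conv_of_real)
  qed
  have "\<i> * vd 1 \<gamma> s = \<i> * vd 1 \<eta> t" using tang[OF g refl] tang[OF h eq[symmetric]] by simp
  then show ?thesis by simp
qed

lemma vector_derivative_norm_bound:
  fixes f :: "real \<Rightarrow> 'a::real_normed_vector"
  assumes d: "\<And>x. (f has_vector_derivative f' x) (at x)" and B: "\<And>x. norm (f' x) \<le> B"
  shows "norm (f t - f s) \<le> B * norm (t - s)"
proof (rule differentiable_bound[of UNIV f "\<lambda>x h. h *\<^sub>R f' x"])
  show "(f has_derivative (\<lambda>h. h *\<^sub>R f' x)) (at x within UNIV)" for x
    using d[of x] by (simp add: has_vector_derivative_def)
  show "onorm (\<lambda>h. h *\<^sub>R f' x) \<le> B" for x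
  proof (rule onorm_bound)
    show "0 \<le> B" using order_trans[OF norm_ge_zero B] .
    show "norm (h *\<^sub>R f' x) \<le> B * norm h" for h
      using mult_right_mono[OF B[of x], of "norm h"] by (simp add: mult.commute)
  qed
qed auto

text \<open>Gronwall's argument: the squared norm damped by \<open>exp (- (2 * K) * s)\<close>
  cannot increase.\<close>

lemma zero_of_norm_deriv_le:
  fixes D :: "real \<Rightarrow> complex"
  assumes d: "\<And>s. (D has_vector_derivative D' s) (at s)" and le: "\<And>s. norm (D' s) \<le> K * norm (D s)"
    and D0: "D 0 = 0" and s: "s \<ge> 0"
  shows "D s = 0"
proof -
  let ?Q = "\<lambda>s. inner (D s) (D s) * exp (- (2 * K) * s)"
  have "?Q s \<le> ?Q 0"
  proof (rule DERIV_nonpos_imp_nonincreasing[OF s])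
    fix x
    have "((\<lambda>s. inner (D s) (D s)) has_real_derivative 2 * inner (D x) (D' x)) (at x)"
      using bounded_bilinear.has_vector_derivative[OF bounded_bilinear_inner d d, of x]
      by (simp add: has_real_derivative_iff_has_vector_derivative inner_commute)
    then have "(?Q has_real_derivative (2 * inner (D x) (D' x)) * exp (- (2 * K) * x) + inner (D x) (D x) * (exp (- (2 * K) * x) * (- (2 * K)))) (at x)"
      by (auto intro!: derivative_eq_intros)
    moreover have "(2 * inner (D x) (D' x)) * exp (- (2 * K) * x) + inner (D x) (D x) * (exp (- (2 * K) * x) * (- (2 * K))) \<le> 0"
    proof -
      have "inner (D x) (D' x) \<le> norm (D x) * norm (D' x)" by (rule norm_cauchy_schwarz)
      also have "\<dots> \<le> norm (D x) * (K * norm (D x))" by (intro mult_left_mono le) auto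
      also have "\<dots> = K * inner (D x) (D x)" by (simp add: dot_square_norm power2_eq_square)
      finally have "2 * (inner (D x) (D' x) - K * inner (D x) (D x)) \<le> 0" by simp
      then have "(2 * (inner (D x) (D' x) - K * inner (D x) (D x))) * exp (- (2 * K) * x) \<le> 0"
        by (rule mult_nonpos_nonneg) auto
      then show ?thesis by (simp add: algebra_simps)
    qed
    ultimately show "\<exists>y. DERIV ?Q x :> y \<and> y \<le> 0" by blast
  qed
  then have "inner (D s) (D s) * exp (- (2 * K) * s) \<le> 0" using D0 by simp
  then have "inner (D s) (D s) \<le> 0" by (simp add: mult_le_0_iff)
  then show ?thesis by (metis inner_ge_zero inner_eq_zero_iff order_antisym)
qed

text \<open>\<open>Cnorm\<close> looks at one period only; periodicity of the curve and of the disk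
  extends the bound to all \<open>s\<close>.\<close>

lemma arclen_near_circle:
  assumes eta: "perim1_arclen m \<Omega> \<eta>" and m: "m \<ge> 2"
    and cl: "Cnorm m (\<lambda>s. \<eta> s - tangent_disk \<eta> s) \<le> \<delta>"
    and k: "k < m"
  shows "norm (vd (Suc k) \<eta> s - (2 * pi * \<i>) ^ k * (vd 1 \<eta> 0 * exp (2 * pi * \<i> * complex_of_real s))) \<le> \<delta>"
proof -
  let ?h = "\<lambda>s. \<eta> s - tangent_disk \<eta> s"
  have ck: "Ck m \<eta>" and per: "\<And>s. \<eta> (s + 1) = \<eta> s" using eta by (auto simp: perim1_arclen_def)
  have ch: "Ck m ?h" by (rule Ck_diff[OF ck Ck_tangent_disk])
  have ph: "vd (Suc k) ?h (s + 1) = vd (Suc k) ?h s" for s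
    using k per tangent_disk_periodic by (intro vd_periodic[OF ch]) auto
  have "vd (Suc k) ?h s = vd (Suc k) ?h (frac s)" by (rule periodic_frac[where f = "vd (Suc k) ?h", OF ph])
  moreover have "frac s \<in> {0..1}" using frac_ge_0[of s] frac_lt_1[of s] by auto
  ultimately have "norm (vd (Suc k) ?h s) \<le> \<delta>" using Cnorm_bound[OF ch, of "Suc k" "frac s"] k cl by auto
  moreover have "vd (Suc k) ?h s = vd (Suc k) \<eta> s - vd (Suc k) (tangent_disk \<eta>) s"
    using vd_diff[OF ck Ck_tangent_disk, of "Suc k" \<eta>] k by (metis Suc_leI)
  ultimately show ?thesis unfolding vd_tangent_disk_Suc by (simp only: mult_ac)
qed

text \<open>Makes the unit tangent a Lipschitz function of the boundary point. Chords of the disk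
  are at least half the arc, the perturbation takes away at most a tenth of the arc, and the tangent
  turns at rate at most \<open>7\<close>; \<open>7 / (1/2 - 1/10)\<close> is below
  \<open>20\<close>.\<close>

lemma tangent_lipschitz_chord:
  assumes eta: "perim1_arclen m \<Omega> \<eta>" and m: "m \<ge> 2"
    and cl: "Cnorm m (\<lambda>s. \<eta> s - tangent_disk \<eta> s) \<le> \<delta>" and \<delta>: "\<delta> \<le> 1/10"
  shows "norm (vd 1 \<eta> t - vd 1 \<eta> s) \<le> 20 * norm (\<eta> t - \<eta> s)"
proof -
  have ck: "Ck m \<eta>" and per: "\<And>s. \<eta> (s + 1) = \<eta> s" and u: "norm (vd 1 \<eta> 0) = 1"
    using eta by (auto simp: perim1_arclen_def)
  have per1: "vd 1 \<eta> (s + 1) = vd 1 \<eta> s" for s using vd_periodic[OF ck per, of 1] m by simp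
  note near = arclen_near_circle[OF eta m cl]
  have b2: "norm (vd 2 \<eta> r) \<le> 7" for r
  proof -
    have "vd 2 \<eta> r = (vd (Suc 1) \<eta> r - (2 * pi * \<i>) ^ 1 * (vd 1 \<eta> 0 * exp (2 * pi * \<i> * complex_of_real r)))
        + (2 * pi * \<i>) ^ 1 * (vd 1 \<eta> 0 * exp (2 * pi * \<i> * complex_of_real r))" by (simp add: numeral_2_eq_2)
    then have "norm (vd 2 \<eta> r) \<le> \<delta> + norm ((2 * pi * \<i>) ^ 1 * (vd 1 \<eta> 0 * exp (2 * pi * \<i> * complex_of_real r)))"
      using near[of 1 r] m by (simp only:) (rule order_trans[OF norm_triangle_ineq], simp)
    also have "norm ((2 * pi * \<i>) ^ 1 * (vd 1 \<eta> 0 * exp (2 * pi * \<i> * complex_of_real r))) = 2 * pi"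
      using u by (simp add: norm_mult)
    finally show ?thesis using \<delta> pi_approx by simp
  qed
  have base: "norm (vd 1 \<eta> t - vd 1 \<eta> s) \<le> 20 * norm (\<eta> t - \<eta> s)" if ts: "\<bar>t - s\<bar> \<le> 1/2" for t s
  proof -
    let ?h = "\<lambda>s. \<eta> s - tangent_disk \<eta> s"
    have "norm (vd 1 \<eta> t - vd 1 \<eta> s) \<le> 7 * norm (t - s)"
      by (rule vector_derivative_norm_bound[OF _ b2]) (use Ck_has_vd[OF ck, of 1] m in \<open>simp add: numeral_2_eq_2\<close>)
    moreover have "norm (?h t - ?h s) \<le> (1/10) * norm (t - s)"
    proof (rule vector_derivative_norm_bound[where f = ?h and f' = "\<lambda>x. vd 1 \<eta> x - vd 1 (tangent_disk \<eta>) x"])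
      show "(?h has_vector_derivative vd 1 \<eta> x - vd 1 (tangent_disk \<eta>) x) (at x)" for x
        using has_vector_derivative_diff[OF Ck_has_vd[OF ck, of 0 x] tangent_disk_has_vd[of 0 \<eta> x]] m by simp
      show "norm (vd 1 \<eta> x - vd 1 (tangent_disk \<eta>) x) \<le> 1/10" for x
        using near[of 0 x] m \<delta> vd_tangent_disk_Suc[of 0 \<eta>] by simp
    qed
    moreover have "\<bar>t - s\<bar> / 2 \<le> norm (tangent_disk \<eta> t - tangent_disk \<eta> s)" by (rule tangent_disk_chord[OF u ts])
    moreover have "norm (tangent_disk \<eta> t - tangent_disk \<eta> s) \<le> norm (\<eta> t - \<eta> s) + norm (?h t - ?h s)"
      using norm_triangle_ineq4[of "\<eta> t - \<eta> s" "?h t - ?h s"] by (simp add: algebra_simps)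
    moreover have R: "a \<le> 20 * e" if "a \<le> 7 * d" "h \<le> (1/10) * d" "d / 2 \<le> b" "b \<le> e + h" "0 \<le> d" for a b d e h :: real
      using that by linarith
    ultimately show ?thesis by (intro R[of "norm (vd 1 \<eta> t - vd 1 \<eta> s)" "\<bar>t - s\<bar>" "norm (?h t - ?h s)" "norm (tangent_disk \<eta> t - tangent_disk \<eta> s)" "norm (\<eta> t - \<eta> s)"]) (simp_all only: real_norm_def abs_ge_zero)
  qed
  \<comment> \<open>Periodicity brings the parameters within half a period, the range in which
    chords control arcs.\<close>
  define n where "n = round (t - s)"
  have "\<bar>(t - real_of_int n) - s\<bar> \<le> 1/2"
    using of_int_round_abs_le[of "t - s"] by (simp add: n_def abs_minus_commute algebra_simps)
  from base[OF this] show ?thesis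
    using periodic_add_int[of \<eta> t "- n", OF per] periodic_add_int[of "vd 1 \<eta>" t "- n", OF per1] by simp
qed

text \<open>Both curves follow the same tangent field on the boundary, which is Lipschitz, so
  uniqueness of trajectories identifies them once their starting points are matched.\<close>

lemma arclen_shift:
  assumes conv: "convex \<Omega>" and op: "open \<Omega>"
    and g: "perim1_arclen m \<Omega> \<gamma>" and h: "perim1_arclen m \<Omega> \<eta>" and m: "m \<ge> 2"
    and cl: "Cnorm m (\<lambda>s. \<eta> s - tangent_disk \<eta> s) \<le> \<delta>" and \<delta>: "\<delta> \<le> 1/10"
  obtains a where "\<And>s. \<gamma> s = \<eta> (s + a)"
proof -
  have ckg: "Ck m \<gamma>" and pg: "\<And>s. \<gamma> (s + 1) = \<gamma> s" and ckh: "Ck m \<eta>" and ph: "\<And>s. \<eta> (s + 1) = \<eta> s"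
    and img: "\<gamma> ` {0..1} = frontier \<Omega>" "\<eta> ` {0..1} = frontier \<Omega>"
    using g h by (auto simp: perim1_arclen_def)
  have ex: "\<exists>t. \<gamma> s = \<eta> t" for s
  proof -
    have "\<gamma> s = \<gamma> (frac s)" by (rule periodic_frac[where f = \<gamma>, OF pg])
    moreover have "frac s \<in> {0..1}" using frac_ge_0[of s] frac_lt_1[of s] by auto
    ultimately have "\<gamma> s \<in> \<eta> ` {0..1}" using img imageI[of "frac s" "{0..1}" \<gamma>] by metis
    then show ?thesis by auto
  qed
  obtain a where a: "\<gamma> 0 = \<eta> a" using ex by blast
  define D where "D s = \<gamma> s - \<eta> (s + a)" for s
  have dD: "(D has_vector_derivative vd 1 \<gamma> s - vd 1 \<eta> (s + a)) (at s)" for s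
  proof -
    have "((\<lambda>t. t + a) has_vector_derivative 1) (at s)" by (auto intro!: derivative_eq_intros)
    from vector_diff_chain_at[OF this Ck_has_vd[OF ckh, of 0 "s + a"]]
    have "((\<lambda>s. \<eta> (s + a)) has_vector_derivative vd 1 \<eta> (s + a)) (at s)" using m by (simp add: o_def)
    moreover have "(\<gamma> has_vector_derivative vd 1 \<gamma> s) (at s)" using Ck_has_vd[OF ckg, of 0 s] m by simp
    ultimately show ?thesis unfolding D_def[abs_def] by (intro has_vector_derivative_diff)
  qed
  have le: "norm (vd 1 \<gamma> s - vd 1 \<eta> (s + a)) \<le> 20 * norm (D s)" for s
  proof -
    obtain t where t: "\<gamma> s = \<eta> t" using ex by blast
    have "vd 1 \<gamma> s = vd 1 \<eta> t" using m by (intro tangent_unique[OF conv op g h _ t]) auto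
    then show ?thesis using tangent_lipschitz_chord[OF h m cl \<delta>, of t "s + a"] t by (simp add: D_def)
  qed
  have D0: "D s = 0" if "s \<ge> 0" for s
    by (rule zero_of_norm_deriv_le[OF dD le _ that]) (simp add: D_def a)
  have "D s = 0" for s
  proof -
    have "D (s + 1) = D s" for s using pg[of s] ph[of "s + a"] by (simp add: D_def algebra_simps)
    then have "D s = D (frac s)" by (rule periodic_frac[where f = D])
    then show ?thesis using D0[of "frac s"] frac_ge_0[of s] by simp
  qed
  then show thesis using that[of a] by (simp add: D_def)
qed

text \<open>Transfers the closeness from the unspecified parametrisation \<open>\<eta>\<close> to
  \<open>\<gamma>\<close>. The unit vector \<open>T\<close>, depending on \<open>s\<close>, absorbs
  the shift and the position of the disk.\<close>

lemma near_circle_derivatives: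
  assumes dom: "marked_sym_domain r \<delta> \<Omega> c \<gamma>" and \<delta>: "\<delta> \<le> 1/10" and r: "r \<ge> 1"
  shows "\<exists>T. norm T = 1 \<and> (\<forall>k\<le>r. norm (vd (Suc k) \<gamma> s - (2 * pi * \<i>) ^ k * T) \<le> \<delta>)"
proof -
  let ?O = "(\<lambda>z. c *\<^sub>R z) ` \<Omega>"
  obtain \<eta> where c: "0 < c" and sc: "strictly_convex_domain \<Omega>" and g: "perim1_arclen (r + 1) ?O \<gamma>"
    and h: "perim1_arclen (r + 1) ?O \<eta>" and cl: "Cnorm (r + 1) (\<lambda>s. \<eta> s - tangent_disk \<eta> s) \<le> \<delta>"
    using dom unfolding marked_sym_domain_def by blast
  have conv: "convex ?O" using sc convex_scaling unfolding strictly_convex_domain_def by blast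
  have op: "open ?O" using sc c open_scaling[of c \<Omega>] unfolding strictly_convex_domain_def by auto
  have r2: "r + 1 \<ge> 2" using r by simp
  obtain a where a: "\<And>s. \<gamma> s = \<eta> (s + a)" using arclen_shift[OF conv op g h r2 cl \<delta>] by blast
  have ckh: "Ck (r + 1) \<eta>" and u: "norm (vd 1 \<eta> 0) = 1" using h by (auto simp: perim1_arclen_def)
  have ga: "\<gamma> = (\<lambda>s. \<eta> (s + a))" using a by auto
  let ?T = "vd 1 \<eta> 0 * exp (2 * pi * \<i> * complex_of_real (s + a))"
  have "norm ?T = 1" using u by (simp add: norm_mult)
  moreover have "norm (vd (Suc k) \<gamma> s - (2 * pi * \<i>) ^ k * ?T) \<le> \<delta>" if "k \<le> r" for k
  proof -
    have "vd (Suc k) \<gamma> s = vd (Suc k) \<eta> (s + a)" unfolding ga using vd_shift[OF ckh, of "Suc k" a] that by (simp del: vd.simps)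
    then show ?thesis using arclen_near_circle[OF h r2 cl, of k "s + a"] that by simp
  qed
  ultimately show ?thesis by blast
qed

section \<open>Tangent angle, curvature and the data of \<open>angle_curve\<close>\<close>

lemma ex_antiderivative:
  fixes g :: "real \<Rightarrow> real"
  assumes c: "continuous_on UNIV g"
  obtains F where "F 0 = 0" "\<And>x. (F has_real_derivative g x) (at x)"
proof -
  obtain H where H: "\<forall>x. - \<infinity> < ereal x \<longrightarrow> ereal x < \<infinity> \<longrightarrow> (H has_vector_derivative g x) (at x)"
    using einterval_antiderivative[of "- \<infinity>" \<infinity> g] c by (auto simp: continuous_on_eq_continuous_at)
  show thesis
  proof (rule that[of "\<lambda>x. H x - H 0"])
    show "((\<lambda>x. H x - H 0) has_real_derivative g x) (at x)" for x
      using H by (auto intro!: derivative_eq_intros simp: has_real_derivative_iff_has_vector_derivative)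
  qed simp
qed

text \<open>The positive lower bound on the derivative forces at least linear growth, hence
  surjectivity onto the line. Serves both the tangent angle and the Lazutkin coordinate.\<close>

lemma ex_inverse_deriv:
  fixes g g' :: "real \<Rightarrow> real"
  assumes d: "\<And>x. (g has_real_derivative g' x) (at x)" and m: "0 < m" "\<And>x. m \<le> g' x"
  obtains h where "\<And>x. h (g x) = x" "\<And>y. g (h y) = y" "\<And>y. (h has_real_derivative 1 / g' (h y)) (at y)"
proof -
  have mono: "strict_mono g"
  proof (rule strict_monoI)
    fix x y :: real assume "x < y"
    then show "g x < g y"
    proof (rule DERIV_pos_imp_increasing)
      show "\<exists>y. DERIV g z :> y \<and> 0 < y" for z using d[of z] m(1) m(2)[of z] by (intro exI[of _ "g' z"]) auto
    qed
  qed
  have cont: "isCont g x" for x using d DERIV_isCont by blast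
  have grow: "g y - g x \<ge> m * (y - x)" if "x \<le> y" for x y
  proof (cases "x < y")
    case True
    then obtain z where "g y - g x = (y - x) * g' z" using MVT2[of x y g g'] d by auto
    then show ?thesis using m(2)[of z] True by (simp add: mult.commute mult_left_mono)
  qed (use that in simp)
  have surj: "\<exists>x. g x = y" for y
  proof -
    define N where "N = \<bar>y - g 0\<bar> / m"
    have N: "N \<ge> 0" "m * N = \<bar>y - g 0\<bar>" using m by (auto simp: N_def)
    have "g (- N) \<le> y" using grow[of "- N" 0] N by simp
    moreover have "y \<le> g N" using grow[of 0 N] N by simp
    ultimately show ?thesis using IVT[of g "- N" y N] cont N by auto
  qed
  define h where "h = inv g"
  have hg: "h (g x) = x" for x unfolding h_def using strict_mono_imp_inj_on[OF mono] by (simp add: inv_f_f)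
  have gh: "g (h y) = y" for y unfolding h_def using surj by (metis f_inv_into_f rangeI)
  have ch: "isCont h y" for y
    using isCont_inverse_function[where d = 1 and x = "h y" and g = h and f = g] hg cont gh by simp
  have "(h has_real_derivative inverse (g' (h y))) (at y)" for y
    by (rule DERIV_inverse_function[where f = g and g = h and x = y and D = "g' (h y)" and a = "y - 1" and b = "y + 1"]) (use d gh ch m(1) m(2)[of "h y"] in auto)
  then show thesis using that[of h] hg gh by (simp add: inverse_eq_divide)
qed

text \<open>The unknown direction drops out since \<open>cnj T * T = 1\<close>. The
  \<open>1600\<close> majorises \<open>(2 * pi) ^ 4\<close>, and \<open>4000\<close> exceeds
  \<open>1600 + 1600 + 1\<close>.\<close>

lemma Im_cnj_near:
  fixes T p p' z z' :: complex
  assumes T: "norm T = 1" and z: "norm (z - p * T) \<le> \<delta>" and z': "norm (z' - p' * T) \<le> \<delta>"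
    and p: "norm p \<le> 1600" "norm p' \<le> 1600" and \<delta>: "\<delta> \<le> 1"
  shows "\<bar>Im (cnj z * z') - Im (cnj p * p')\<bar> \<le> 4000 * \<delta>"
proof -
  define e where "e = z - p * T"
  define e' where "e' = z' - p' * T"
  have \<delta>0: "0 \<le> \<delta>" using z norm_ge_zero order_trans by blast
  have e: "norm e \<le> \<delta>" "norm e' \<le> \<delta>" "norm e' \<le> 1" using z z' \<delta> by (auto simp: e_def e'_def)
  have TT: "cnj T * T = 1" using T complex_norm_square[of T] by (simp add: mult.commute)
  have "cnj z * z' = cnj p * p' * (cnj T * T) + cnj p * cnj T * e' + cnj e * p' * T + cnj e * e'"
    by (simp add: e_def e'_def algebra_simps)
  then have "cnj z * z' - cnj p * p' = cnj p * cnj T * e' + cnj e * p' * T + cnj e * e'" using TT by simp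
  then have "norm (cnj z * z' - cnj p * p') \<le> norm (cnj p * cnj T * e') + norm (cnj e * p' * T) + norm (cnj e * e')"
    by (metis add_mono_thms_linordered_semiring(3) norm_triangle_ineq order_trans)
  also have "norm (cnj p * cnj T * e') \<le> 1600 * 1 * \<delta>" unfolding norm_mult complex_mod_cnj using T e p by (intro mult_mono) auto
  also have "norm (cnj e * p' * T) \<le> \<delta> * 1600 * 1" unfolding norm_mult complex_mod_cnj using T e p \<delta>0 by (intro mult_mono) auto
  also have "norm (cnj e * e') \<le> \<delta> * 1" unfolding norm_mult complex_mod_cnj using e \<delta>0 by (intro mult_mono) auto
  finally have "norm (cnj z * z' - cnj p * p') \<le> 4000 * \<delta>" using \<delta>0 by simp
  moreover have "\<bar>Im (cnj z * z') - Im (cnj p * p')\<bar> \<le> norm (cnj z * z' - cnj p * p')"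
    using abs_Im_le_cmod[of "cnj z * z' - cnj p * p'"] by simp
  ultimately show ?thesis by linarith
qed

text \<open>Successive derivatives of \<open>curvature\<close> by the product rule; a derivative
  times its own conjugate is real and drops out.\<close>

definition curv_d1 :: "(real \<Rightarrow> complex) \<Rightarrow> real \<Rightarrow> real" where
  "curv_d1 \<gamma> s = Im (cnj (vd 1 \<gamma> s) * vd 3 \<gamma> s)"
definition curv_d2 :: "(real \<Rightarrow> complex) \<Rightarrow> real \<Rightarrow> real" where
  "curv_d2 \<gamma> s = Im (cnj (vd 1 \<gamma> s) * vd 4 \<gamma> s) + Im (cnj (vd 2 \<gamma> s) * vd 3 \<gamma> s)"
definition curv_d3 :: "(real \<Rightarrow> complex) \<Rightarrow> real \<Rightarrow> real" where
  "curv_d3 \<gamma> s = Im (cnj (vd 1 \<gamma> s) * vd 5 \<gamma> s) + 2 * Im (cnj (vd 2 \<gamma> s) * vd 4 \<gamma> s)"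

lemma Im_cnj_vd_deriv:
  assumes ck: "Ck m \<gamma>" and jk: "j < m" "k < m"
  shows "((\<lambda>s. Im (cnj (vd j \<gamma> s) * vd k \<gamma> s)) has_real_derivative
     Im (cnj (vd j \<gamma> s) * vd (Suc k) \<gamma> s) + Im (cnj (vd (Suc j) \<gamma> s) * vd k \<gamma> s)) (at s)"
proof -
  have "((\<lambda>s. cnj (vd j \<gamma> s)) has_vector_derivative cnj (vd (Suc j) \<gamma> s)) (at s)"
    by (rule bounded_linear.has_vector_derivative[OF bounded_linear_cnj Ck_has_vd[OF ck jk(1)]])
  from bounded_linear.has_vector_derivative[OF bounded_linear_Im has_vector_derivative_mult[OF this Ck_has_vd[OF ck jk(2)]]]
  show ?thesis by (simp add: has_real_derivative_iff_has_vector_derivative del: vd.simps)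
qed

lemma curvature_derivs:
  assumes ck: "Ck m \<gamma>" and m: "5 \<le> m"
  shows "(curvature \<gamma> has_real_derivative curv_d1 \<gamma> s) (at s)"
    "(curv_d1 \<gamma> has_real_derivative curv_d2 \<gamma> s) (at s)"
    "(curv_d2 \<gamma> has_real_derivative curv_d3 \<gamma> s) (at s)"
proof -
  have n: "Suc 1 = 2" "Suc 2 = 3" "Suc 3 = 4" "Suc 4 = 5" by auto
  note D = Im_cnj_vd_deriv[OF ck]
  have self: "Im (cnj z * z) = 0" for z by simp
  show "(curvature \<gamma> has_real_derivative curv_d1 \<gamma> s) (at s)"
    using D[of 1 2 s] m unfolding curvature_def[abs_def] curv_d1_def n self by simp
  show "(curv_d1 \<gamma> has_real_derivative curv_d2 \<gamma> s) (at s)"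
    using D[of 1 3 s] m unfolding curv_d1_def[abs_def] curv_d2_def n by simp
  show "(curv_d2 \<gamma> has_real_derivative curv_d3 \<gamma> s) (at s)"
    using DERIV_add[OF D[of 1 4 s] D[of 2 3 s]] m unfolding curv_d2_def[abs_def] curv_d3_def n self by (simp add: algebra_simps del: vd.simps)
qed

text \<open>On the circle the main terms are \<open>2 * pi\<close> for the curvature and
  \<open>0\<close> for its derivatives; in \<open>curv_d2\<close> two terms
  \<open>(2 * pi) ^ 3\<close> of opposite sign cancel. The factor \<open>12000\<close> is
  \<open>3 * 4000\<close>, for the coefficients \<open>1\<close> and \<open>2\<close> of
  \<open>curv_d3\<close>.\<close>

lemma curvature_bounds:
  assumes near: "\<And>s. \<exists>T. norm T = 1 \<and> (\<forall>k\<le>4. norm (vd (Suc k) \<gamma> s - (2 * pi * \<i>) ^ k * T) \<le> \<delta>)"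
    and \<delta>: "\<delta> \<le> 1"
  shows "\<bar>curvature \<gamma> s - 2 * pi\<bar> \<le> 12000 * \<delta>" "\<bar>curv_d1 \<gamma> s\<bar> \<le> 12000 * \<delta>"
    "\<bar>curv_d2 \<gamma> s\<bar> \<le> 12000 * \<delta>" "\<bar>curv_d3 \<gamma> s\<bar> \<le> 12000 * \<delta>"
proof -
  obtain T where T: "norm T = 1" "\<And>k. k \<le> 4 \<Longrightarrow> norm (vd (Suc k) \<gamma> s - (2 * pi * \<i>) ^ k * T) \<le> \<delta>" using near by blast
  have \<delta>0: "0 \<le> \<delta>" using T(2)[of 0] norm_ge_zero order_trans by blast
  have pw: "norm ((2 * pi * \<i>) ^ k) \<le> 1600" if "k \<le> 4" for k
  proof -
    have "norm ((2 * pi * \<i>) ^ k) = (2 * pi) ^ k" by (simp add: norm_power norm_mult)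
    also have "\<dots> \<le> (2 * pi) ^ 4" using that pi_gt3 by (intro power_increasing) auto
    also have "\<dots> \<le> (63/10) ^ 4" using pi_approx by (intro power_mono) auto
    finally show ?thesis by (simp add: power4_eq_xxxx)
  qed
  have I: "\<bar>Im (cnj (vd (Suc j) \<gamma> s) * vd (Suc k) \<gamma> s) - Im (cnj ((2 * pi * \<i>) ^ j) * (2 * pi * \<i>) ^ k)\<bar> \<le> 4000 * \<delta>"
    if "j \<le> 4" "k \<le> 4" for j k
    using that by (intro Im_cnj_near[OF T(1) T(2) T(2) pw pw \<delta>])
  have i2: "\<i> ^ 2 = (- 1 :: complex)" "\<i> ^ 3 = - \<i>" "\<i> ^ 4 = 1" by (simp_all add: power2_eq_square power3_eq_cube power4_eq_xxxx)
  have v: "Im (cnj ((2 * pi * \<i>) ^ 0) * (2 * pi * \<i>) ^ 1) = 2 * pi"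
    "Im (cnj ((2 * pi * \<i>) ^ 0) * (2 * pi * \<i>) ^ 2) = 0"
    "Im (cnj ((2 * pi * \<i>) ^ 0) * (2 * pi * \<i>) ^ 3) = - ((2 * pi) ^ 3)"
    "Im (cnj ((2 * pi * \<i>) ^ 1) * (2 * pi * \<i>) ^ 2) = (2 * pi) ^ 3"
    "Im (cnj ((2 * pi * \<i>) ^ 0) * (2 * pi * \<i>) ^ 4) = 0"
    "Im (cnj ((2 * pi * \<i>) ^ 1) * (2 * pi * \<i>) ^ 3) = 0"
    by (simp_all add: power_mult_distrib i2 power2_eq_square power3_eq_cube flip: of_real_power)
  have n: "Suc 0 = 1" "Suc 1 = 2" "Suc 2 = 3" "Suc 3 = 4" "Suc 4 = 5" by auto
  show "\<bar>curvature \<gamma> s - 2 * pi\<bar> \<le> 12000 * \<delta>"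
    using I[of 0 1] \<delta>0 unfolding curvature_def v n by linarith
  show "\<bar>curv_d1 \<gamma> s\<bar> \<le> 12000 * \<delta>" using I[of 0 2] \<delta>0 unfolding curv_d1_def v n by linarith
  show "\<bar>curv_d2 \<gamma> s\<bar> \<le> 12000 * \<delta>" using I[of 0 3] I[of 1 2] \<delta>0 unfolding curv_d2_def v n by linarith
  show "\<bar>curv_d3 \<gamma> s\<bar> \<le> 12000 * \<delta>" using I[of 0 4] I[of 1 3] \<delta>0 unfolding curv_d3_def v n by linarith
qed

text \<open>\<open>\<theta> s\<close> is the tangent angle at arc length \<open>s\<close> relative to the tangent \<open>c\<close> at the marked point; \<open>G\<close> is the
  curve rotated and rescaled to the normalisation of \<open>angle_curve\<close>.\<close>
locale near_circle = angle_curve f f1 f2 f3 X G \<epsilon>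
  for f f1 f2 f3 X :: "real \<Rightarrow> real" and G :: "real \<Rightarrow> complex" and \<epsilon> :: real +
  fixes \<gamma> :: "real \<Rightarrow> complex" and \<theta> \<kappa> \<kappa>' :: "real \<Rightarrow> real" and c :: complex
  assumes c: "norm c = 1"
    and vd1: "vd 1 \<gamma> s = c * cis (\<theta> s)"
    and d\<gamma>: "(\<gamma> has_vector_derivative c * cis (\<theta> s)) (at s)"
    and d\<theta>: "(\<theta> has_real_derivative \<kappa> s) (at s)"
    and d\<kappa>: "(\<kappa> has_real_derivative \<kappa>' s) (at s)"
    and c\<kappa>': "continuous_on UNIV \<kappa>'"
    and \<kappa>_ge: "6 \<le> \<kappa> s"
    and \<theta>0: "\<theta> 0 = 0" and \<theta>_per: "\<theta> (s + 1) = \<theta> s + 2 * pi" and \<theta>_odd: "\<theta> (- s) = - \<theta> s"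
    and \<gamma>_per: "\<gamma> (s + 1) = \<gamma> s"
    and \<gamma>_sym: "\<gamma> (- s) - \<gamma> (- t) = - (c ^ 2) * cnj (\<gamma> s - \<gamma> t)"
    and G\<theta>: "G (\<theta> s) = 2 * pi / c * \<gamma> s"
    and f\<kappa>: "f (\<theta> s) ^ 3 * \<kappa> s = 2 * pi"
    and X0: "X 0 = 0" and f_even: "f (- t) = f t" and f_per: "f (t + 2 * pi) = f t"

text \<open>The Frenet equation: constant speed makes the acceleration normal, and its normal
  component is the curvature.\<close>

lemma unit_speed_second_derivative:
  assumes ck: "Ck m \<gamma>" and m: "2 \<le> m" and u: "\<And>s. norm (vd 1 \<gamma> s) = 1"
  shows "vd 2 \<gamma> s = \<i> * of_real (curvature \<gamma> s) * vd 1 \<gamma> s"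
proof -
  let ?a = "vd 1 \<gamma> s" and ?b = "vd 2 \<gamma> s"
  have d: "(vd 1 \<gamma> has_vector_derivative ?b) (at s)" using Ck_has_vd[OF ck, of 1 s] m by (simp add: numeral_2_eq_2 del: vd.simps)
  have "((\<lambda>s. inner (vd 1 \<gamma> s) (vd 1 \<gamma> s)) has_vector_derivative inner ?a ?b + inner ?b ?a) (at s)"
    by (rule bounded_bilinear.has_vector_derivative[OF bounded_bilinear_inner d d])
  moreover have "(\<lambda>s. inner (vd 1 \<gamma> s) (vd 1 \<gamma> s)) = (\<lambda>s. 1)" using u by (simp add: dot_square_norm del: vd.simps)
  ultimately have "((\<lambda>s. 1::real) has_vector_derivative inner ?a ?b + inner ?b ?a) (at s)" by (simp del: vd.simps)
  then have "inner ?a ?b + inner ?b ?a = 0"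
    using vector_derivative_unique_at[OF _ has_vector_derivative_const] by blast
  then have re: "Re (cnj ?a * ?b) = 0" by (simp add: inner_complex_def algebra_simps del: vd.simps)
  have "cnj ?a * ?b = \<i> * of_real (curvature \<gamma> s)"
    using re by (simp add: complex_eq_iff curvature_def del: vd.simps)
  then have "?a * (cnj ?a * ?b) = \<i> * of_real (curvature \<gamma> s) * ?a" by simp
  moreover have "?a * cnj ?a = 1" using complex_norm_square[of ?a] u[of s] by simp
  ultimately show ?thesis by (metis mult.assoc mult_1)
qed

lemma vector_derivative_zero_constant:
  fixes W :: "real \<Rightarrow> 'a::real_normed_vector"
  assumes "\<And>s. (W has_vector_derivative 0) (at s)"
  shows "W s = W t"
  using vector_derivative_norm_bound[of W "\<lambda>_. 0" 0 s t] assms by simp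

text \<open>\<open>\<theta>\<close> integrates the curvature and \<open>\<sigma>\<close> inverts it.
  All data are first built as functions of arc length, where differentiating in the angle means
  differentiating in \<open>s\<close> and dividing by \<open>k\<close>, and then composed with
  \<open>\<sigma>\<close>.\<close>

lemma near_circle_construct:
  fixes \<gamma> :: "real \<Rightarrow> complex"
  assumes ck: "Ck m \<gamma>" and m: "5 \<le> m" and per: "\<And>s. \<gamma> (s + 1) = \<gamma> s" and u: "\<And>s. norm (vd 1 \<gamma> s) = 1"
    and near: "\<And>s. \<exists>T. norm T = 1 \<and> (\<forall>k\<le>4. norm (vd (Suc k) \<gamma> s - (2 * pi * \<i>) ^ k * T) \<le> \<delta>)"
    and refl: "norm v = 1" "\<And>s. \<gamma> (- s) = reflection p v (\<gamma> s)"
    and \<delta>: "12000 * \<delta> \<le> 1 / 1000"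
  obtains f f1 f2 f3 X G \<theta> where
    "near_circle f f1 f2 f3 X G (12000 * \<delta>) \<gamma> \<theta> (curvature \<gamma>) (curv_d1 \<gamma>) (vd 1 \<gamma> 0)"
proof -
  define E where "E = 12000 * \<delta>"
  define k k1 k2 k3 where "k = curvature \<gamma>" and "k1 = curv_d1 \<gamma>" and "k2 = curv_d2 \<gamma>" and "k3 = curv_d3 \<gamma>"
  define c where "c = vd 1 \<gamma> 0"
  have \<delta>1: "\<delta> \<le> 1" using \<delta> by simp
  note cb = curvature_bounds[OF near \<delta>1, folded E_def k_def k1_def k2_def k3_def]
  note cd = curvature_derivs[OF ck m, folded k_def k1_def k2_def k3_def]
  have E: "0 \<le> E" "E \<le> 1/1000" using cb(2)[of 0] \<delta> by (auto simp: E_def)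
  have k6: "6 \<le> k s" for s using cb(1)[of s] E pi_approx by simp
  have kc: "continuous_on UNIV k" using DERIV_continuous_on[of UNIV k k1] cd(1) by blast
  obtain \<theta> where \<theta>0: "\<theta> 0 = 0" and d\<theta>: "\<And>s. (\<theta> has_real_derivative k s) (at s)" using ex_antiderivative[OF kc] by blast
  obtain \<sigma> where \<sigma>: "\<And>s. \<sigma> (\<theta> s) = s" "\<And>t. \<theta> (\<sigma> t) = t" "\<And>t. (\<sigma> has_real_derivative 1 / k (\<sigma> t)) (at t)"
    using ex_inverse_deriv[OF d\<theta>, of 6] k6 by (metis zero_less_numeral)
  have pull: "((\<lambda>t. A (\<sigma> t)) has_real_derivative B (\<sigma> t)) (at t)"
    if "\<And>s. (A has_real_derivative k s * B s) (at s)" for A B t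
    using DERIV_chain2[OF that \<sigma>(3), of t] k6[of "\<sigma> t"] by simp
  define F where "F s = exp ((ln (2 * pi) - ln (k s)) / 3)" for s
  \<comment> \<open>\<open>L1\<close>, \<open>L2\<close> and \<open>L3\<close> are the first three
    derivatives of \<open>ln k\<close> in the tangent angle; those of \<open>F\<close>, the cube
    root of \<open>2 * pi / k\<close>, follow from them.\<close>
  define L1 where "L1 s = k1 s * (1 / k s) ^ 2" for s
  define L2 where "L2 s = k2 s * (1 / k s) ^ 3 - 2 * k1 s ^ 2 * (1 / k s) ^ 4" for s
  define L3 where "L3 s = k3 s * (1 / k s) ^ 4 - 7 * k1 s * k2 s * (1 / k s) ^ 5 + 8 * k1 s ^ 3 * (1 / k s) ^ 6" for s
  define F1 where "F1 s = - (1/3) * (L1 s * F s)" for s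
  define F2 where "F2 s = - (1/3) * (L2 s * F s + L1 s * F1 s)" for s
  define F3 where "F3 s = - (1/3) * (L3 s * F s + 2 * (L2 s * F1 s) + L1 s * F2 s)" for s
  have knz: "k s \<noteq> 0" "k s > 0" for s using k6[of s] by auto
  have dF: "(F has_real_derivative k s * F1 s) (at s)" for s
    unfolding F_def[abs_def] F1_def L1_def
    by (rule derivative_eq_intros cd refl knz | simp)+ (use knz[of s] in \<open>simp add: F_def field_simps power2_eq_square\<close>)
  have dL1: "(L1 has_real_derivative k s * L2 s) (at s)" for s
    unfolding L1_def[abs_def] L2_def
    by (rule derivative_eq_intros cd refl knz | simp)+ (use knz[of s] in \<open>simp add: field_simps eval_nat_numeral\<close>)
  have dL2: "(L2 has_real_derivative k s * L3 s) (at s)" for s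
    unfolding L2_def[abs_def] L3_def
    by (rule derivative_eq_intros cd refl knz | simp)+ (use knz[of s] in \<open>simp add: field_simps eval_nat_numeral\<close>)
  have dF1: "(F1 has_real_derivative k s * F2 s) (at s)" for s
    unfolding F1_def[abs_def] F2_def
    by (rule derivative_eq_intros dF dL1 refl | simp)+ (simp add: F1_def field_simps)
  have dF2: "(F2 has_real_derivative k s * F3 s) (at s)" for s
    unfolding F2_def[abs_def] F3_def
    by (rule derivative_eq_intros dF dF1 dL1 dL2 refl | simp)+ (simp add: F2_def field_simps)
  have F0: "F s > 0" for s by (simp add: F_def)
  have Fk: "F s ^ 3 * k s = 2 * pi" for s
  proof -
    have "F s ^ 3 = exp (ln (2 * pi) - ln (k s))" unfolding F_def exp_of_nat_mult[symmetric] by simp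
    also have "\<dots> = 2 * pi / k s" using knz by (simp add: exp_diff)
    finally show ?thesis using knz by simp
  qed
  have F_1: "\<bar>F s - 1\<bar> \<le> E" for s
  proof -
    \<comment> \<open>The cube is explicit, so \<open>F - 1\<close> is reached by factoring
      \<open>F ^ 3 - 1\<close> and discarding a factor that is at least \<open>1\<close>.\<close>
    have "\<bar>F s - 1\<bar> * 1 \<le> \<bar>F s - 1\<bar> * (F s ^ 2 + F s + 1)" using F0[of s] by (intro mult_left_mono) auto
    also have "\<dots> = \<bar>(F s - 1) * (F s ^ 2 + F s + 1)\<bar>" using F0[of s] by (simp add: abs_mult)
    also have "(F s - 1) * (F s ^ 2 + F s + 1) = F s ^ 3 - 1" by (simp add: algebra_simps power2_eq_square power3_eq_cube)
    also have "\<dots> = (2 * pi - k s) / k s" using Fk[of s] knz[of s] by (simp add: field_simps)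
    also have "\<bar>\<dots>\<bar> = \<bar>k s - 2 * pi\<bar> / k s" using knz[of s] by (simp add: abs_minus_commute)
    also have "\<dots> \<le> E / 1" using cb(1)[of s] k6[of s] E by (intro frac_le) auto
    finally show ?thesis by simp
  qed
  have F11: "\<bar>F s\<bar> \<le> 11/10" for s using F_1[of s] E by linarith
  have ik: "\<bar>(1 / k s) ^ n\<bar> \<le> 1" for s n using k6[of s] by (simp add: power_le_one)
  have EE: "E * E \<le> (1/1000) * E" using E by (intro mult_right_mono) auto
  have k12: "\<bar>k1 s ^ 2\<bar> \<le> (1/1000) * E" for s
    using abs_mult_le[OF cb(2)[of s] cb(2)[of s]] EE by (simp add: power2_eq_square)
  have k1k2: "\<bar>k1 s * k2 s\<bar> \<le> (1/1000) * E" for s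
    using abs_mult_le[OF cb(2)[of s] cb(3)[of s]] EE by simp
  have k13: "\<bar>k1 s ^ 3\<bar> \<le> (1/1000) * E" for s
  proof -
    have "\<bar>k1 s\<bar> \<le> 1" using cb(2)[of s] E by linarith
    then have "\<bar>k1 s ^ 2 * k1 s\<bar> \<le> (1/1000) * E * 1" by (intro abs_mult_le k12)
    then show ?thesis by (simp add: power2_eq_square power3_eq_cube)
  qed
  have bL1: "\<bar>L1 s\<bar> \<le> E" for s unfolding L1_def using abs_mult_le[OF cb(2)[of s] ik[of s 2]] by simp
  have bL2: "\<bar>L2 s\<bar> \<le> 12/10 * E" for s
    unfolding L2_def mult.assoc using abs_mult_le[OF cb(3)[of s] ik[of s 3]] abs_mult_le[OF k12[of s] ik[of s 4]] E(1) by linarith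
  have bL3: "\<bar>L3 s\<bar> \<le> 12/10 * E" for s
    using abs_mult_le[OF cb(4)[of s] ik[of s 4]] abs_mult_le[OF k1k2[of s] ik[of s 5]] abs_mult_le[OF k13[of s] ik[of s 6]] E(1)
    unfolding L3_def mult.assoc by linarith
  have bF1: "\<bar>F1 s\<bar> \<le> E" for s
    unfolding F1_def using abs_mult_le[OF bL1[of s] F11[of s]] E(1) by linarith
  have b1: "\<bar>F1 s\<bar> \<le> 1/1000" for s using bF1[of s] E by linarith
  have bF2: "\<bar>F2 s\<bar> \<le> E" for s
    unfolding F2_def distrib_left using abs_mult_le[OF bL2[of s] F11[of s]] abs_mult_le[OF bL1[of s] b1[of s]] E(1) by linarith
  have b2: "\<bar>F2 s\<bar> \<le> 1/1000" for s using bF2[of s] E by linarith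
  have bF3: "\<bar>F3 s\<bar> \<le> E" for s
    unfolding F3_def distrib_left using abs_mult_le[OF bL3[of s] F11[of s]] abs_mult_le[OF bL2[of s] b1[of s]] abs_mult_le[OF bL1[of s] b2[of s]] E(1) by linarith
  define f f1 f2 f3 where "f = (\<lambda>t. F (\<sigma> t))" and "f1 = (\<lambda>t. F1 (\<sigma> t))" and "f2 = (\<lambda>t. F2 (\<sigma> t))" and "f3 = (\<lambda>t. F3 (\<sigma> t))"
  have df: "(f has_real_derivative f1 t) (at t)" "(f1 has_real_derivative f2 t) (at t)" "(f2 has_real_derivative f3 t) (at t)" for t
    unfolding f_def f1_def f2_def f3_def by (rule pull[OF dF] pull[OF dF1] pull[OF dF2])+
  have "continuous_on UNIV f" using DERIV_continuous_on[of UNIV f f1] df(1) by blast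
  then obtain X where X0: "X 0 = 0" and dX: "\<And>t. (X has_real_derivative f t) (at t)" using ex_antiderivative by blast
  have c1: "norm c = 1" unfolding c_def by (rule u)
  then have c_nonzero: "c \<noteq> 0" by auto
  have cc: "c * cnj c = 1" using complex_norm_square[of c] c1 by simp
  have d1: "(\<gamma> has_vector_derivative vd 1 \<gamma> s) (at s)" for s using Ck_has_vd[OF ck, of 0 s] m by simp
  have d2: "(vd 1 \<gamma> has_vector_derivative vd 2 \<gamma> s) (at s)" for s
    using Ck_has_vd[OF ck, of 1 s] m by (simp add: numeral_2_eq_2 del: vd.simps)
  have v2: "vd 2 \<gamma> s = \<i> * of_real (k s) * vd 1 \<gamma> s" for s
    unfolding k_def using m by (intro unit_speed_second_derivative[OF ck _ u]) auto
  have v1: "vd 1 \<gamma> s = c * cis (\<theta> s)" for s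
  proof -
    have dcis: "((\<lambda>s. cis (- \<theta> s)) has_vector_derivative - (\<i> * of_real (k s) * cis (- \<theta> s))) (at s)" for s
    proof -
      have "((\<lambda>s. exp (\<i> * of_real (- \<theta> s))) has_vector_derivative exp (\<i> * of_real (- \<theta> s)) * (\<i> * of_real (- k s))) (at s)"
      proof -
        have "((\<lambda>s. - \<theta> s) has_real_derivative - k s) (at s)" by (rule DERIV_minus[OF d\<theta>])
        then have "((\<lambda>s. \<i> * of_real (- \<theta> s)) has_vector_derivative \<i> * of_real (- k s)) (at s)"
          by (intro has_vector_derivative_mult_right has_vector_derivative_of_real)
        from field_vector_diff_chain_at[OF this DERIV_exp] show ?thesis by (simp add: o_def mult.commute)
      qed
      then show ?thesis by (simp add: cis_conv_exp mult_ac)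
    qed
    \<comment> \<open>The tangent rotated back by \<open>\<theta>\<close> is constant, by the Frenet
      equation.\<close>
    have "((\<lambda>s. vd 1 \<gamma> s * cis (- \<theta> s)) has_vector_derivative vd 1 \<gamma> s * (- (\<i> * of_real (k s) * cis (- \<theta> s))) + vd 2 \<gamma> s * cis (- \<theta> s)) (at s)" for s
      by (rule has_vector_derivative_mult[OF d2 dcis])
    then have "((\<lambda>s. vd 1 \<gamma> s * cis (- \<theta> s)) has_vector_derivative 0) (at s)" for s
      unfolding v2 by (simp add: algebra_simps)
    then have "vd 1 \<gamma> s * cis (- \<theta> s) = vd 1 \<gamma> 0 * cis (- \<theta> 0)" by (rule vector_derivative_zero_constant)
    then have "vd 1 \<gamma> s * cis (- \<theta> s) * cis (\<theta> s) = c * cis (\<theta> s)" using \<theta>0 by (simp add: c_def)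
    then show ?thesis by (simp add: mult.assoc cis_mult)
  qed
  define G where "G t = 2 * pi / c * \<gamma> (\<sigma> t)" for t
  have dG: "(G has_vector_derivative of_real (f t ^ 3) * cis t) (at t)" for t
  proof -
    have "(\<sigma> has_vector_derivative 1 / k (\<sigma> t)) (at t)" using \<sigma>(3) by (simp add: has_real_derivative_iff_has_vector_derivative)
    from vector_diff_chain_at[OF this d1] have "((\<lambda>t. \<gamma> (\<sigma> t)) has_vector_derivative (1 / k (\<sigma> t)) *\<^sub>R vd 1 \<gamma> (\<sigma> t)) (at t)" by (simp add: o_def)
    then have "(G has_vector_derivative 2 * pi / c * ((1 / k (\<sigma> t)) *\<^sub>R vd 1 \<gamma> (\<sigma> t))) (at t)"
      unfolding G_def[abs_def] by (rule has_vector_derivative_mult_right)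
    moreover have "2 * pi / c * ((1 / k (\<sigma> t)) *\<^sub>R vd 1 \<gamma> (\<sigma> t)) = of_real (2 * pi / k (\<sigma> t)) * cis t"
      unfolding v1 \<sigma>(2) using c_nonzero by (simp add: scaleR_conv_of_real field_simps)
    moreover have "2 * pi / k (\<sigma> t) = f t ^ 3" unfolding f_def using Fk[of "\<sigma> t"] knz[of "\<sigma> t"] by (simp add: field_simps)
    ultimately show ?thesis by simp
  qed
  have vper: "vd j \<gamma> (s + 1) = vd j \<gamma> s" if "j \<le> m" for j s by (rule vd_periodic[OF ck per that])
  have kper: "k (s + 1) = k s" for s unfolding k_def curvature_def using vper[of 1 s] vper[of 2 s] m by simp
  have \<theta>per: "\<theta> (s + 1) = \<theta> s + 2 * pi" for s
  proof -
    have "((\<lambda>s. \<theta> (s + 1) - \<theta> s) has_real_derivative k (s + 1) - k s) (at s)" for s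
      using DERIV_shift[of \<theta> "k (s + 1)" s 1] d\<theta> by (intro DERIV_diff) auto
    then have "((\<lambda>s. \<theta> (s + 1) - \<theta> s) has_vector_derivative 0) (at s)" for s
      using kper by (simp add: has_real_derivative_iff_has_vector_derivative)
    then have 1: "\<theta> (s + 1) - \<theta> s = \<theta> (0 + 1) - \<theta> 0" by (rule vector_derivative_zero_constant)
    \<comment> \<open>The turning number: closing up makes \<open>\<theta> 1\<close> a multiple of
      \<open>2 * pi\<close>, and a curvature within \<open>1\<close> of \<open>2 * pi\<close> leaves
      only the multiple by \<open>1\<close>.\<close>
    have "c * cis (\<theta> 1) = c * cis (\<theta> 0)" using v1[of 1] v1[of 0] vper[of 1 0] m by simp
    then have "cis (\<theta> 1) = 1" using c_nonzero \<theta>0 by simp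
    then have "cos (\<theta> 1) = 1" by (metis cis.sel(1) one_complex.sel(1))
    then obtain n :: int where n: "\<theta> 1 = n * 2 * pi" using cos_one_2pi_int by auto
    obtain z where z: "\<theta> 1 - \<theta> 0 = (1 - 0) * k z" using MVT2[of 0 1 \<theta> k] d\<theta> by auto
    have "\<bar>\<theta> 1 - 2 * pi\<bar> \<le> 1" using z \<theta>0 cb(1)[of z] E by simp
    moreover have "\<theta> 1 - 2 * pi = of_int (n - 1) * (2 * pi)" using n by (simp add: algebra_simps)
    ultimately have "\<bar>real_of_int (n - 1)\<bar> * (2 * pi) \<le> 1" by (simp add: abs_mult)
    have "n = 1"
    proof (rule ccontr)
      assume "n \<noteq> 1"
      then have "\<bar>real_of_int (n - 1)\<bar> \<ge> 1" by linarith
      then have "\<bar>real_of_int (n - 1)\<bar> * (2 * pi) \<ge> 1 * (2 * pi)" by (intro mult_right_mono) auto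
      then show False using \<open>\<bar>real_of_int (n - 1)\<bar> * (2 * pi) \<le> 1\<close> pi_gt3 by linarith
    qed
    then show ?thesis using 1 n \<theta>0 by simp
  qed
  have sym0: "\<gamma> (- s) - \<gamma> (- t) = v\<^sup>2 * cnj (\<gamma> s - \<gamma> t)" for s t
    unfolding refl(2) reflection_def by (simp add: algebra_simps)
  have mir: "((\<lambda>s. H (- s)) has_vector_derivative - H' (- s)) (at s)"
    if "\<And>s. (H has_vector_derivative H' s) (at s)" for H H' :: "real \<Rightarrow> complex" and s
  proof -
    have "((\<lambda>t::real. - t) has_vector_derivative - 1) (at s)" by (auto intro!: derivative_eq_intros)
    from vector_diff_chain_at[OF this that[of "- s"]] show ?thesis by (simp add: o_def)
  qed
  have vsym: "- vd 1 \<gamma> (- s) = v\<^sup>2 * cnj (vd 1 \<gamma> s)" for s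
  proof -
    have "((\<lambda>s. \<gamma> (- s)) has_vector_derivative v\<^sup>2 * cnj (vd 1 \<gamma> s)) (at s)"
    proof -
      have "((\<lambda>s. \<gamma> (- 0) + v\<^sup>2 * cnj (\<gamma> s - \<gamma> 0)) has_vector_derivative 0 + v\<^sup>2 * cnj (vd 1 \<gamma> s - 0)) (at s)"
        by (intro has_vector_derivative_add has_vector_derivative_mult_right has_vector_derivative_const
           bounded_linear.has_vector_derivative[OF bounded_linear_cnj] has_vector_derivative_diff d1)
      moreover have "(\<lambda>s. \<gamma> (- 0) + v\<^sup>2 * cnj (\<gamma> s - \<gamma> 0)) = (\<lambda>s. \<gamma> (- s))" using sym0[of _ 0] by (auto simp: algebra_simps)
      ultimately show ?thesis by simp
    qed
    then show ?thesis using mir[OF d1, of s] vector_derivative_unique_at by blast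
  qed
  \<comment> \<open>Differentiating the symmetry at the marked point shows that the axis is
    perpendicular to the tangent there.\<close>
  have v2c: "v\<^sup>2 = - (c ^ 2)"
  proof -
    have "v\<^sup>2 * cnj c = - c" using vsym[of 0] by (simp add: c_def)
    then have "v\<^sup>2 * (c * cnj c) = - c * c" by (simp add: mult_ac)
    then show ?thesis unfolding cc by (simp add: power2_eq_square)
  qed
  have \<theta>odd: "\<theta> (- s) = - \<theta> s" and keven: "k (- s) = k s" for s
  proof -
    have cs: "cis (\<theta> (- s)) = cis (- \<theta> s)" for s
    proof -
      have "c * cis (\<theta> (- s)) = c ^ 2 * cnj (c * cis (\<theta> s))" using vsym[of s] unfolding v1 v2c by simp
      also have "\<dots> = c * (c * cnj c) * cis (- \<theta> s)" by (simp add: power2_eq_square cis_cnj)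
      finally show ?thesis using c_nonzero cc by simp
    qed
    have e: "vd 2 \<gamma> (- s) = - (c ^ 2) * cnj (vd 2 \<gamma> s)" for s
    proof -
      have "((\<lambda>s. vd 1 \<gamma> (- s)) has_vector_derivative - vd 2 \<gamma> (- s)) (at s)" by (rule mir[OF d2])
      moreover have "((\<lambda>s. vd 1 \<gamma> (- s)) has_vector_derivative c ^ 2 * cnj (vd 2 \<gamma> s)) (at s)"
      proof -
        have "((\<lambda>s. c ^ 2 * cnj (vd 1 \<gamma> s)) has_vector_derivative c ^ 2 * cnj (vd 2 \<gamma> s)) (at s)"
          by (intro has_vector_derivative_mult_right bounded_linear.has_vector_derivative[OF bounded_linear_cnj] d2)
        moreover have "(\<lambda>s. c ^ 2 * cnj (vd 1 \<gamma> s)) = (\<lambda>s. vd 1 \<gamma> (- s))"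
          using vsym unfolding v2c by (metis (no_types, lifting) minus_minus mult_minus_left)
        ultimately show ?thesis by simp
      qed
      ultimately have "- vd 2 \<gamma> (- s) = c ^ 2 * cnj (vd 2 \<gamma> s)" using vector_derivative_unique_at by blast
      then show ?thesis by (metis minus_minus mult_minus_left)
    qed
    have ke: "k (- s) = k s" for s
    proof -
      have "vd 1 \<gamma> (- s) = c ^ 2 * cnj (vd 1 \<gamma> s)" using vsym[of s] unfolding v2c by simp
      then have "cnj (vd 1 \<gamma> (- s)) * vd 2 \<gamma> (- s) = cnj (c ^ 2 * cnj (vd 1 \<gamma> s)) * (- (c ^ 2) * cnj (vd 2 \<gamma> s))" unfolding e by simp
      also have "\<dots> = - ((c * cnj c) ^ 2) * (vd 1 \<gamma> s * cnj (vd 2 \<gamma> s))" by (simp add: power2_eq_square mult_ac)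
      finally have "cnj (vd 1 \<gamma> (- s)) * vd 2 \<gamma> (- s) = - (vd 1 \<gamma> s * cnj (vd 2 \<gamma> s))" unfolding cc by simp
      then show ?thesis unfolding k_def curvature_def by (simp add: algebra_simps del: vd.simps)
    qed
    show "k (- s) = k s" by (rule ke)
    have "((\<lambda>s. \<theta> (- s) + \<theta> s) has_real_derivative - k (- s) + k s) (at s)" for s
      using DERIV_mirror[of \<theta> "k (- s)" s] d\<theta> by (intro DERIV_add) auto
    then have "((\<lambda>s. \<theta> (- s) + \<theta> s) has_vector_derivative 0) (at s)" for s
      using ke by (simp add: has_real_derivative_iff_has_vector_derivative)
    then have "\<theta> (- s) + \<theta> s = \<theta> (- 0) + \<theta> 0" by (rule vector_derivative_zero_constant)
    then show "\<theta> (- s) = - \<theta> s" using \<theta>0 by simp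
  qed
  have \<sigma>odd: "\<sigma> (- t) = - \<sigma> t" for t using \<sigma>(1)[of "- \<sigma> t"] \<theta>odd[of "\<sigma> t"] \<sigma>(2)[of t] by simp
  have \<sigma>per: "\<sigma> (t + 2 * pi) = \<sigma> t + 1" for t using \<sigma>(1)[of "\<sigma> t + 1"] \<theta>per[of "\<sigma> t"] \<sigma>(2)[of t] by simp
  have ck1: "continuous_on UNIV k1" using DERIV_continuous_on[of UNIV k1 k2] cd(2) by blast
  have "near_circle f f1 f2 f3 X G E \<gamma> \<theta> k k1 c"
  proof
    show "f (\<theta> s) ^ 3 * k s = 2 * pi" for s unfolding f_def \<sigma> by (rule Fk)
    show "\<gamma> (- s) - \<gamma> (- t) = - (c ^ 2) * cnj (\<gamma> s - \<gamma> t)" for s t using sym0[of s t] unfolding v2c .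
    show "(\<gamma> has_vector_derivative c * cis (\<theta> s)) (at s)" for s using d1[of s] unfolding v1 .
    show "f (- t) = f t" for t unfolding f_def \<sigma>odd F_def keven ..
    show "f (t + 2 * pi) = f t" for t unfolding f_def \<sigma>per F_def kper ..
    show "G (\<theta> s) = 2 * pi / c * \<gamma> s" for s unfolding G_def \<sigma> ..
  qed (use E df dX dG F_1 bF1 bF2 bF3 c1 v1 d\<theta> cd(1) k6 \<theta>0 \<theta>per \<theta>odd per X0 ck1 in \<open>auto simp: f_def f1_def f2_def f3_def simp del: vd.simps\<close>)
  then show thesis using that unfolding E_def k_def k1_def c_def by blast
qed

section \<open>Maximal orbits\<close>

lemma norm_has_real_derivative:
  fixes u :: "real \<Rightarrow> complex"
  assumes d: "(u has_vector_derivative u') (at x)" and nz: "u x \<noteq> 0"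
  shows "((\<lambda>x. norm (u x)) has_real_derivative inner (u x) u' / norm (u x)) (at x)"
proof -
  have "((\<lambda>s. inner (u s) (u s)) has_vector_derivative inner (u x) u' + inner u' (u x)) (at x)"
    by (rule bounded_bilinear.has_vector_derivative[OF bounded_bilinear_inner d d])
  then have i: "((\<lambda>s. inner (u s) (u s)) has_real_derivative 2 * inner (u x) u') (at x)"
    by (simp add: has_real_derivative_iff_has_vector_derivative inner_commute)
  have "((\<lambda>s. sqrt (inner (u s) (u s))) has_real_derivative inverse (sqrt (inner (u x) (u x))) / 2 * (2 * inner (u x) u')) (at x)"
    by (rule DERIV_chain2[OF DERIV_real_sqrt i]) (use nz in auto)
  then show ?thesis by (simp add: norm_eq_sqrt_inner field_simps)
qed

lemma Arg_cnj_eq_inverse: "z \<noteq> 0 \<Longrightarrow> Arg (cnj z) = Arg (inverse z)"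
proof -
  assume z: "z \<noteq> 0"
  have "cnj z = of_real ((norm z)\<^sup>2) * inverse z" using z complex_norm_square[of z] by (simp add: field_simps)
  then show ?thesis using z by (simp only:) (rule Arg_times_of_real, simp)
qed

lemma Im_inverse_neg: "0 < Im z \<Longrightarrow> Im (inverse z) < 0"
proof -
  assume z: "0 < Im z"
  have "0 < (Re z)\<^sup>2 + (Im z)\<^sup>2" using z by (simp add: sum_power2_gt_zero_iff)
  then show ?thesis using z by (simp add: divide_neg_pos)
qed

section \<open>Angles and lengths of chords of the curve\<close>

context near_circle begin

text \<open>The quotients in \<open>out_angle\<close> and \<open>in_angle\<close> are oriented so
  that both lie in \<open>(0, pi)\<close> for a chord run through counterclockwise, and the
  reflection law reads \<open>in_angle = out_angle\<close>.\<close>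

definition out_angle :: "real \<Rightarrow> real \<Rightarrow> real" where "out_angle s s' = Arg ((\<gamma> s' - \<gamma> s) / vd 1 \<gamma> s)"
definition in_angle :: "real \<Rightarrow> real \<Rightarrow> real" where "in_angle s s' = Arg (vd 1 \<gamma> s' / (\<gamma> s' - \<gamma> s))"

lemma c_nonzero: "c \<noteq> 0" using c by auto

lemma vd1_nz: "vd 1 \<gamma> s \<noteq> 0" unfolding vd1 using c_nonzero by simp

lemma vd1_norm: "norm (vd 1 \<gamma> s) = 1" unfolding vd1 by (simp add: norm_mult c)

lemma c_cnj: "c * cnj c = 1" using complex_norm_square[of c] c by simp

lemma \<theta>_less: assumes "a < b" shows "\<theta> a < \<theta> b"
proof (rule DERIV_pos_imp_increasing[OF assms])
  show "\<exists>y. DERIV \<theta> x :> y \<and> 0 < y" for x using d\<theta>[of x] \<kappa>_ge[of x] by (intro exI[of _ "\<kappa> x"]) auto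
qed

lemma \<theta>_half: "\<theta> (1/2) = pi"
  using \<theta>_per[of "- (1/2)"] \<theta>_odd[of "1/2"] by simp

lemma \<theta>_nonneg: "0 \<le> a \<Longrightarrow> 0 \<le> \<theta> a"
  using \<theta>_less[of 0 a] \<theta>0 by (cases "a = 0") auto

lemma \<theta>_le_pi: "a \<le> 1/2 \<Longrightarrow> \<theta> a \<le> pi"
  using \<theta>_less[of a "1/2"] \<theta>_half by (metis less_eq_real_def)

lemma \<theta>_refl: "\<theta> (1 - s) = 2 * pi - \<theta> s"
  using \<theta>_per[of "- s"] \<theta>_odd[of s] by simp

lemma \<theta>_one: "\<theta> 1 = 2 * pi" using \<theta>_per[of 0] \<theta>0 by simp

lemma vd1_per: "vd 1 \<gamma> (s + 1) = vd 1 \<gamma> s"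
proof -
  have "cis (\<theta> s + 2 * pi) = cis (\<theta> s)" by (simp add: complex_eq_iff)
  then show ?thesis unfolding vd1 \<theta>_per by simp
qed

lemma angles_shift:
  "out_angle (s + 1) t = out_angle s t" "out_angle s (t + 1) = out_angle s t"
  "in_angle (s + 1) t = in_angle s t" "in_angle s (t + 1) = in_angle s t"
  unfolding out_angle_def in_angle_def vd1_per \<gamma>_per by simp_all

lemma chord_G: "\<gamma> t - \<gamma> s = c / (2 * pi) * (G (\<theta> t) - G (\<theta> s))"
  unfolding G\<theta> using c_nonzero by (simp add: field_simps)

lemma out_angle_G: "out_angle s t = Arg ((G (\<theta> t) - G (\<theta> s)) / cis (\<theta> s))"
proof -
  have "(\<gamma> t - \<gamma> s) / vd 1 \<gamma> s = of_real (1 / (2 * pi)) * ((G (\<theta> t) - G (\<theta> s)) / cis (\<theta> s))"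
    unfolding chord_G vd1 using c_nonzero by simp
  then show ?thesis unfolding out_angle_def by (simp only:) (rule Arg_times_of_real, simp)
qed

lemma in_angle_G: "in_angle s t = Arg (cis (\<theta> t) / (G (\<theta> t) - G (\<theta> s)))"
proof -
  have "vd 1 \<gamma> t / (\<gamma> t - \<gamma> s) = of_real (2 * pi) * (cis (\<theta> t) / (G (\<theta> t) - G (\<theta> s)))"
    unfolding chord_G vd1 using c_nonzero by simp
  then show ?thesis unfolding in_angle_def by (simp only:) (rule Arg_times_of_real, simp)
qed

text \<open>The limit \<open>34/10\<close> lies above \<open>pi\<close>, the turning between the
  marked and the auxiliary point, so that chords of a \<open>2\<close>-gon are covered.\<close>

lemma chord_facts:
  assumes ab: "a < b" and le: "\<theta> b - \<theta> a \<le> 34/10"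
  shows "\<gamma> a \<noteq> \<gamma> b" "0 < out_angle a b" "out_angle a b < pi" "0 < in_angle a b" "in_angle a b < pi"
    "out_angle a b + in_angle a b = \<theta> b - \<theta> a"
    "\<bar>out_angle a b - (\<theta> b - \<theta> a) / 2\<bar> \<le> 120 * \<epsilon> * ((\<theta> b - \<theta> a) / 2) ^ 2"
proof -
  define w where "w = (\<theta> b - \<theta> a) / 2"
  have w: "0 < w" "w \<le> 17/10" using \<theta>_less[OF ab] le by (auto simp: w_def)
  have b: "\<theta> a + 2 * w = \<theta> b" by (simp add: w_def field_simps)
  note ch = chord_angle[OF w, of "\<theta> a", unfolded b, folded out_angle_G in_angle_G]
  show "\<gamma> a \<noteq> \<gamma> b" using ch(1) chord_G[of b a] c_nonzero by auto
  show s: "out_angle a b + in_angle a b = \<theta> b - \<theta> a" using ch(3) b by linarith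
  show "\<bar>out_angle a b - (\<theta> b - \<theta> a) / 2\<bar> \<le> 120 * \<epsilon> * ((\<theta> b - \<theta> a) / 2) ^ 2" using ch(2) by (simp add: w_def)
  have "120 * \<epsilon> * w ^ 2 \<le> 120 * (1/1000) * (17/10 * w)"
    using eps w by (intro mult_mono) (auto simp: power2_eq_square)
  then have d: "\<bar>out_angle a b - w\<bar> \<le> 204/1000 * w" using ch(2) by simp
  then show "0 < out_angle a b" "out_angle a b < pi" using w pi_gt3 by linarith+
  show "0 < in_angle a b" "in_angle a b < pi" using d s b w pi_gt3 by linarith+
qed

text \<open>The reflection conjugates the quotient of chord and tangent and reverses the chord; a
  conjugate has the argument of the inverse, which turns an outgoing into an incoming angle.\<close>

lemma angle_mirror:
  assumes "\<gamma> a \<noteq> \<gamma> b"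
  shows "out_angle (- b) (- a) = in_angle a b"
proof -
  have c4: "vd 1 \<gamma> (- b) = c ^ 2 * cnj (vd 1 \<gamma> b)"
  proof -
    have "c ^ 2 * cnj (vd 1 \<gamma> b) = c * (c * cnj c) * cis (- \<theta> b)" unfolding vd1 by (simp add: power2_eq_square cis_cnj)
    then show ?thesis unfolding c_cnj vd1 \<theta>_odd by simp
  qed
  have "(\<gamma> (- a) - \<gamma> (- b)) / vd 1 \<gamma> (- b) = - (c ^ 2) * cnj (\<gamma> a - \<gamma> b) / (c ^ 2 * cnj (vd 1 \<gamma> b))"
    unfolding \<gamma>_sym c4 ..
  also have "- (c ^ 2) * cnj (\<gamma> a - \<gamma> b) = c ^ 2 * cnj (\<gamma> b - \<gamma> a)" by (simp add: algebra_simps)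
  also have "c ^ 2 * cnj (\<gamma> b - \<gamma> a) / (c ^ 2 * cnj (vd 1 \<gamma> b)) = cnj ((\<gamma> b - \<gamma> a) / vd 1 \<gamma> b)"
    unfolding complex_cnj_divide using c_nonzero by (intro nonzero_mult_divide_mult_cancel_left) simp
  finally have "out_angle (- b) (- a) = Arg (cnj ((\<gamma> b - \<gamma> a) / vd 1 \<gamma> b))" by (simp add: out_angle_def)
  also have "\<dots> = Arg (inverse ((\<gamma> b - \<gamma> a) / vd 1 \<gamma> b))" using assms vd1_nz by (intro Arg_cnj_eq_inverse) (auto simp del: vd.simps)
  also have "\<dots> = in_angle a b" by (simp add: in_angle_def del: vd.simps)
  finally show ?thesis .
qed

lemma angle_mirror_one:
  assumes "\<gamma> a \<noteq> \<gamma> b"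
  shows "out_angle (1 - b) (1 - a) = in_angle a b" "in_angle (1 - b) (1 - a) = out_angle a b"
proof -
  show 1: "out_angle (1 - b) (1 - a) = in_angle a b"
    using angle_mirror[OF assms] angles_shift(1)[of "- b" "1 - a"] angles_shift(2)[of "- b" "- a"] by simp
  have "\<gamma> (- b) \<noteq> \<gamma> (- a)" using \<gamma>_sym[of b a] assms c_nonzero by auto
  from angle_mirror[OF this] show "in_angle (1 - b) (1 - a) = out_angle a b"
    using angles_shift(3)[of "- b" "1 - a"] angles_shift(4)[of "- b" "- a"] by simp
qed

text \<open>Equality would make both chords point in the same direction, but at \<open>x\<close> the
  tangent lies strictly to the left of the first and strictly to the right of the second.\<close>

lemma strict_triangle:
  assumes ax: "a < x" and xb: "x < b" and le: "\<theta> b - \<theta> a \<le> 34/10"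
  shows "chordL \<gamma> a b < chordL \<gamma> a x + chordL \<gamma> x b"
proof (rule ccontr)
  assume n: "\<not> ?thesis"
  let ?u = "\<gamma> x - \<gamma> a" and ?v = "\<gamma> b - \<gamma> x"
  have l1: "\<theta> x - \<theta> a \<le> 34/10" and l2: "\<theta> b - \<theta> x \<le> 34/10" using \<theta>_less[OF ax] \<theta>_less[OF xb] le by auto
  note f1 = chord_facts[OF ax l1] and f2 = chord_facts[OF xb l2]
  have unz: "?u \<noteq> 0" and vnz: "?v \<noteq> 0" using f1(1) f2(1) by auto
  have "norm (?u + ?v) = norm ?u + norm ?v"
    using n norm_triangle_ineq[of ?u ?v] unfolding chordL_def by (simp add: norm_minus_commute)
  then have "norm ?u *\<^sub>R ?v = norm ?v *\<^sub>R ?u" by (rule norm_triangle_eq[THEN iffD1])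
  then have "?v = of_real (norm ?v / norm ?u) * ?u" using unz by (simp add: scaleR_conv_of_real field_simps)
  then have e: "?v / vd 1 \<gamma> x = of_real (norm ?v / norm ?u) * inverse (vd 1 \<gamma> x / ?u)"
    by (metis inverse_divide times_divide_eq_right)
  have "sin (in_angle a x) > 0" "sin (out_angle x b) > 0" using f1 f2 by (auto intro: sin_gt_zero)
  then have i1: "Im (vd 1 \<gamma> x / ?u) > 0" and i2: "Im (?v / vd 1 \<gamma> x) > 0"
    unfolding in_angle_def out_angle_def using unz vnz vd1_nz[of x]
    by (simp_all add: sin_Arg zero_less_divide_iff del: vd.simps)
  have "Im (inverse (vd 1 \<gamma> x / ?u)) < 0" using Im_inverse_neg i1 by blast
  moreover have "norm ?v / norm ?u > 0" using unz vnz by simp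
  ultimately have "Im (?v / vd 1 \<gamma> x) < 0" unfolding e by (simp add: mult_pos_neg del: vd.simps inverse_divide inverse_complex.simps times_divide_eq_left of_real_divide)
  then show False using i2 by simp
qed

lemma chordL_deriv_right:
  assumes "\<gamma> a \<noteq> \<gamma> x"
  shows "((\<lambda>x. chordL \<gamma> a x) has_real_derivative cos (in_angle a x)) (at x)"
proof -
  have d: "((\<lambda>x. \<gamma> x - \<gamma> a) has_vector_derivative vd 1 \<gamma> x) (at x)"
  proof -
    have "((\<lambda>x. \<gamma> x - \<gamma> a) has_vector_derivative c * cis (\<theta> x) - 0) (at x)"
      by (intro has_vector_derivative_diff d\<gamma> has_vector_derivative_const)
    then show ?thesis unfolding vd1 by simp
  qed
  have nz: "\<gamma> x - \<gamma> a \<noteq> 0" using assms by auto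
  have "Re (vd 1 \<gamma> x / (\<gamma> x - \<gamma> a)) = inner (\<gamma> x - \<gamma> a) (vd 1 \<gamma> x) / (norm (\<gamma> x - \<gamma> a))\<^sup>2"
    by (simp add: Re_divide inner_complex_def cmod_power2 mult.commute del: vd.simps)
  then have "cos (in_angle a x) = inner (\<gamma> x - \<gamma> a) (vd 1 \<gamma> x) / norm (\<gamma> x - \<gamma> a)"
    unfolding in_angle_def using nz vd1_nz[of x] vd1_norm[of x]
    by (simp add: cos_Arg norm_divide power2_eq_square del: vd.simps)
  then show ?thesis using norm_has_real_derivative[OF d nz] by (simp add: chordL_def norm_minus_commute del: vd.simps)
qed

lemma chordL_deriv_left:
  assumes "\<gamma> x \<noteq> \<gamma> b"
  shows "((\<lambda>x. chordL \<gamma> x b) has_real_derivative - cos (out_angle x b)) (at x)"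
proof -
  have e: "(\<lambda>x. chordL \<gamma> x b) = (\<lambda>x. chordL \<gamma> b x)" by (auto simp: chordL_def norm_minus_commute)
  have nz: "\<gamma> x - \<gamma> b \<noteq> 0" using assms by auto
  have "vd 1 \<gamma> x / (\<gamma> x - \<gamma> b) = - inverse ((\<gamma> b - \<gamma> x) / vd 1 \<gamma> x)"
  proof -
    have "vd 1 \<gamma> x / (\<gamma> x - \<gamma> b) = vd 1 \<gamma> x / (- (\<gamma> b - \<gamma> x))" by (simp only: minus_diff_eq)
    then show ?thesis by (simp only: inverse_divide minus_divide_right)
  qed
  then have "cos (in_angle b x) = Re (- inverse ((\<gamma> b - \<gamma> x) / vd 1 \<gamma> x)) / norm (- inverse ((\<gamma> b - \<gamma> x) / vd 1 \<gamma> x))"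
    unfolding in_angle_def using nz vd1_nz[of x] by (simp add: cos_Arg del: vd.simps)
  also have "\<dots> = - cos (out_angle x b)"
  proof -
    let ?z = "(\<gamma> b - \<gamma> x) / vd 1 \<gamma> x"
    have "?z \<noteq> 0" using nz vd1_nz[of x] by auto
    moreover have "Re (- inverse z) / norm (- inverse z) = - (Re z / norm z)" if "z \<noteq> 0" for z :: complex
    proof -
      have "Re (inverse z) = Re z / (norm z)\<^sup>2" by (simp add: cmod_power2)
      then have "Re (- inverse z) / norm (- inverse z) = - (Re z / (norm z)\<^sup>2) / inverse (norm z)"
        unfolding uminus_complex.sel norm_minus_cancel norm_inverse by (simp only:)
      also have "\<dots> = - (Re z / norm z)" using that by (simp add: power2_eq_square divide_inverse)
      finally show ?thesis .
    qed
    ultimately show ?thesis by (simp only: out_angle_def cos_Arg not_False_eq_True)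
  qed
  finally show ?thesis unfolding e using chordL_deriv_right[of b x] assms by auto
qed

text \<open>The strict triangle inequality keeps the maximum away from the ends. The derivative of
  the length is the difference of the cosines of the two angles, and the cosine is injective on
  \<open>[0, pi]\<close>.\<close>

lemma two_chord_max:
  assumes ab: "a < b" and le: "\<theta> b - \<theta> a \<le> 34/10" and x: "a \<le> x" "x \<le> b"
    and max: "\<And>y. a \<le> y \<Longrightarrow> y \<le> b \<Longrightarrow> chordL \<gamma> a y + chordL \<gamma> y b \<le> chordL \<gamma> a x + chordL \<gamma> x b"
  shows "a < x" "x < b" "in_angle a x = out_angle x b"
proof -
  have "chordL \<gamma> a b < chordL \<gamma> a ((a + b) / 2) + chordL \<gamma> ((a + b) / 2) b" using ab le by (intro strict_triangle) auto
  also have "\<dots> \<le> chordL \<gamma> a x + chordL \<gamma> x b" using ab by (intro max) auto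
  finally have "x \<noteq> a" "x \<noteq> b" by (auto simp: chordL_def)
  then show ax: "a < x" and xb: "x < b" using x by auto
  have l1: "\<theta> x - \<theta> a \<le> 34/10" and l2: "\<theta> b - \<theta> x \<le> 34/10" using \<theta>_less[OF ax] \<theta>_less[OF xb] le by auto
  note f1 = chord_facts[OF ax l1] and f2 = chord_facts[OF xb l2]
  have der: "((\<lambda>y. chordL \<gamma> a y + chordL \<gamma> y b) has_real_derivative cos (in_angle a x) + - cos (out_angle x b)) (at x)"
    by (intro DERIV_add chordL_deriv_right chordL_deriv_left f1(1) f2(1))
  have "cos (in_angle a x) + - cos (out_angle x b) = 0"
  proof (rule DERIV_local_max[OF der, of "min (x - a) (b - x)"])
    show "\<forall>y. \<bar>x - y\<bar> < min (x - a) (b - x) \<longrightarrow> chordL \<gamma> a y + chordL \<gamma> y b \<le> chordL \<gamma> a x + chordL \<gamma> x b"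
      by (intro allI impI max) auto
  qed (use ax xb in auto)
  then have "cos (in_angle a x) = cos (out_angle x b)" by simp
  then show "in_angle a x = out_angle x b"
    by (rule cos_inj_pi[OF less_imp_le[OF f1(4)] less_imp_le[OF f1(5)] less_imp_le[OF f2(2)] less_imp_le[OF f2(3)]])
qed

text \<open>Signed, and measured along \<open>c\<close>: the axis passes through
  \<open>\<gamma> (1/2)\<close> perpendicularly to \<open>c\<close>. On the half
  \<open>[0, 1/2]\<close> this removes the norm from the length of a mirror chord.\<close>

definition axis_dist :: "real \<Rightarrow> real" where "axis_dist y = Re (cnj c * (\<gamma> y - \<gamma> (1/2)))"

lemma axis_dist_deriv: "(axis_dist has_real_derivative cos (\<theta> y)) (at y)"
proof -
  have "((\<lambda>y. cnj c * (\<gamma> y - \<gamma> (1/2))) has_vector_derivative cnj c * (c * cis (\<theta> y) - 0)) (at y)"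
    by (intro has_vector_derivative_mult_right has_vector_derivative_diff d\<gamma> has_vector_derivative_const)
  moreover have "cnj c * (c * cis (\<theta> y) - 0) = (c * cnj c) * cis (\<theta> y)" by (simp add: mult_ac)
  ultimately have "((\<lambda>y. cnj c * (\<gamma> y - \<gamma> (1/2))) has_vector_derivative cis (\<theta> y)) (at y)"
    by (simp only: c_cnj mult_1_left)
  from bounded_linear.has_vector_derivative[OF bounded_linear_Re this]
  show ?thesis unfolding axis_dist_def[abs_def] has_real_derivative_iff_has_vector_derivative cis.sel .
qed

lemma chord_mirror: "\<gamma> y - \<gamma> (- y) = of_real (2 * axis_dist y) * c"
proof -
  let ?z = "cnj c * (\<gamma> y - \<gamma> (1/2))"
  have h: "\<gamma> (- (1/2)) = \<gamma> (1/2)" using \<gamma>_per[of "- (1/2)"] by simp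
  have "cnj c * (\<gamma> (- y) - \<gamma> (1/2)) = cnj c * (- (c ^ 2) * cnj (\<gamma> y - \<gamma> (1/2)))" using \<gamma>_sym[of y "1/2"] h by simp
  also have "\<dots> = - ((c * cnj c) * cnj ?z)" by (simp add: power2_eq_square mult_ac)
  finally have "cnj c * (\<gamma> (- y) - \<gamma> (1/2)) = - cnj ?z" unfolding c_cnj by simp
  then have "cnj c * (\<gamma> y - \<gamma> (- y)) = ?z + cnj ?z" by (simp add: algebra_simps)
  also have "\<dots> = of_real (2 * axis_dist y)" unfolding axis_dist_def by (rule complex_add_cnj)
  finally have "c * cnj c * (\<gamma> y - \<gamma> (- y)) = of_real (2 * axis_dist y) * c" by (simp add: mult_ac)
  then show ?thesis unfolding c_cnj by simp
qed

lemma chordL_mirror: "chordL \<gamma> y (- y) = 2 * \<bar>axis_dist y\<bar>"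
  unfolding chordL_def chord_mirror by (simp add: norm_mult c)

lemma axis_dist_half: "axis_dist (1/2) = 0" by (simp add: axis_dist_def)

lemma axis_dist_zero: "axis_dist 0 = 0" using chordL_mirror[of 0] by (simp add: chordL_def)

text \<open>The derivative \<open>cos (\<theta> y)\<close> changes sign only at the angle
  \<open>pi / 2\<close>, and \<open>axis_dist\<close> vanishes at both ends; the mean value theorem
  is applied towards the end on the same side.\<close>

lemma axis_dist_pos:
  assumes y: "0 < y" "y < 1/2"
  shows "0 < axis_dist y"
proof (cases "\<theta> y \<le> pi / 2")
  case True
  obtain z where z: "0 < z" "z < y" "axis_dist y - axis_dist 0 = (y - 0) * cos (\<theta> z)"
    using MVT2[of 0 y axis_dist "\<lambda>y. cos (\<theta> y)"] axis_dist_deriv y by blast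
  have "cos (\<theta> z) > 0" using \<theta>_less[OF z(1)] \<theta>_less[OF z(2)] True \<theta>0 by (intro cos_gt_zero_pi) auto
  then show ?thesis using z(3) y axis_dist_zero by simp
next
  case False
  obtain z where z: "y < z" "z < 1/2" "axis_dist (1/2) - axis_dist y = (1/2 - y) * cos (\<theta> z)"
    using MVT2[of y "1/2" axis_dist "\<lambda>y. cos (\<theta> y)"] axis_dist_deriv y by blast
  have "pi / 2 < \<theta> z" "\<theta> z < pi" using \<theta>_less[OF z(1)] \<theta>_less[OF z(2)] False \<theta>_half by auto
  then have "cos (\<theta> z) < 0" using cos_gt_zero_pi[of "pi - \<theta> z"] by simp
  then have "(1/2 - y) * cos (\<theta> z) < 0" using y by (intro mult_pos_neg) auto
  then show ?thesis using z(3) axis_dist_half by simp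
qed

text \<open>The chord to the mirror image crosses the axis perpendicularly, in direction
  \<open>- c\<close>, while the tangent makes the angle \<open>\<theta> y\<close> with
  \<open>c\<close>.\<close>

lemma out_angle_mirror:
  assumes y: "0 < y" "y < 1/2"
  shows "out_angle y (1 - y) = pi - \<theta> y"
proof -
  have "\<gamma> (1 - y) = \<gamma> (- y)" using \<gamma>_per[of "- y"] by simp
  then have "\<gamma> (1 - y) - \<gamma> y = - (of_real (2 * axis_dist y) * c)" using chord_mirror[of y] by (simp add: algebra_simps)
  moreover have "- (A * c) / (c * w) = A * (- inverse w)" for A w using c_nonzero by (simp add: divide_inverse)
  ultimately have "(\<gamma> (1 - y) - \<gamma> y) / vd 1 \<gamma> y = of_real (2 * axis_dist y) * (- inverse (cis (\<theta> y)))"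
    unfolding vd1 by (simp only:)
  also have "- inverse (cis (\<theta> y)) = cis (pi - \<theta> y)" by (simp add: complex_eq_iff cis_inverse)
  finally have "(\<gamma> (1 - y) - \<gamma> y) / vd 1 \<gamma> y = rcis (2 * axis_dist y) (pi - \<theta> y)" by (simp only: rcis_def)
  moreover have "0 < \<theta> y" "\<theta> y < pi" using \<theta>_less[OF y(1)] \<theta>_less[OF y(2)] \<theta>0 \<theta>_half by auto
  ultimately show ?thesis unfolding out_angle_def using axis_dist_pos[OF y] by (simp only:) (rule Arg_rcis, auto)
qed

text \<open>The point \<open>\<gamma> (1/2)\<close> lies on the axis, and the chord to it is not
  perpendicular to the axis: its angle against \<open>c\<close> is strictly between \<open>0\<close>
  and \<open>pi\<close>.\<close>

lemma axis_dist_less_chord: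
  assumes a: "0 \<le> a" "a < 1/2"
  shows "\<bar>axis_dist a\<bar> < chordL \<gamma> a (1/2)"
proof -
  have ta: "0 \<le> \<theta> a" using \<theta>_nonneg a by simp
  have le: "\<theta> (1/2) - \<theta> a \<le> 34/10" using ta \<theta>_half pi_approx by simp
  note f = chord_facts[OF a(2) le]
  let ?z = "cnj c * (\<gamma> (1/2) - \<gamma> a)"
  let ?q = "(\<gamma> (1/2) - \<gamma> a) / vd 1 \<gamma> a"
  have qnz: "?q \<noteq> 0" using f(1) vd1_nz[of a] by auto
  have "?z = cnj c * c * cis (\<theta> a) * ?q" unfolding vd1 using c_nonzero by simp
  also have "\<dots> = (c * cnj c) * cis (\<theta> a) * (of_real (norm ?q) * cis (out_angle a (1/2)))"
    using rcis_cmod_Arg[of ?q] unfolding out_angle_def rcis_def by (simp only: mult_ac)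
  finally have z: "?z = of_real (norm ?q) * cis (\<theta> a + out_angle a (1/2))" unfolding c_cnj by (simp add: cis_mult mult_ac)
  have "sin (\<theta> a + out_angle a (1/2)) > 0"
    using f(2-6) ta \<theta>_half by (intro sin_gt_zero) auto
  then have im: "Im ?z \<noteq> 0" unfolding z using qnz by (simp del: vd.simps)
  have n: "norm ?z = chordL \<gamma> a (1/2)" by (simp add: norm_mult c chordL_def norm_minus_commute)
  have r: "axis_dist a = - Re ?z" unfolding axis_dist_def by (simp add: algebra_simps)
  have "(Re ?z)\<^sup>2 < (norm ?z)\<^sup>2" unfolding cmod_power2 using im by simp
  then have "\<bar>Re ?z\<bar>\<^sup>2 < (norm ?z)\<^sup>2" unfolding power2_abs .
  then have "\<bar>Re ?z\<bar> < norm ?z" by (rule power2_less_imp_less) (rule norm_ge_zero)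
  then show ?thesis unfolding n r by simp
qed

text \<open>The last point of an odd orbit maximizes a chord plus its distance from the axis. The
  choice \<open>x = a\<close> loses against \<open>1/2\<close> by
  \<open>axis_dist_less_chord\<close>; at \<open>1/2\<close> the derivative is negative. At an
  interior critical point the incoming angle is \<open>pi - \<theta> x\<close>, which gives the
  reflection law and bounds the turning along the mirror chord, twice this angle.\<close>

lemma mirror_chord_max:
  assumes eps': "\<epsilon> \<le> 1 / 20000" and a: "0 \<le> a" "a < 1/2" and x: "a \<le> x" "x \<le> 1/2"
    and max: "\<And>y. a \<le> y \<Longrightarrow> y \<le> 1/2 \<Longrightarrow> 2 * chordL \<gamma> a y + chordL \<gamma> y (- y) \<le> 2 * chordL \<gamma> a x + chordL \<gamma> x (- x)"
  shows "a < x" "x < 1/2" "in_angle a x = out_angle x (1 - x)" "\<theta> (1 - x) - \<theta> x \<le> 34/10"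
proof -
  have "chordL \<gamma> a (- a) < 2 * chordL \<gamma> a (1/2)" unfolding chordL_mirror using axis_dist_less_chord[OF a] by simp
  also have "\<dots> \<le> 2 * chordL \<gamma> a x + chordL \<gamma> x (- x)" using max[of "1/2"] a unfolding chordL_mirror axis_dist_half by simp
  finally have "x \<noteq> a" by (auto simp: chordL_def)
  then show ax: "a < x" using x by simp
  have ta: "0 \<le> \<theta> a" using \<theta>_nonneg a by simp
  have tx: "\<theta> x \<le> pi" using \<theta>_le_pi x by simp
  have le: "\<theta> x - \<theta> a \<le> 34/10" using ta tx pi_approx by simp
  note f = chord_facts[OF ax le]
  have nn: "axis_dist y \<ge> 0" if "a \<le> y" "y \<le> 1/2" for y
    using axis_dist_pos[of y] axis_dist_zero axis_dist_half that a by (metis less_eq_real_def order_trans)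
  let ?h = "\<lambda>y. 2 * chordL \<gamma> a y + 2 * axis_dist y"
  have hm: "?h y \<le> ?h x" if "a \<le> y" "y \<le> 1/2" for y
    using max[OF that] nn[OF that] nn[OF x] unfolding chordL_mirror by simp
  have dh: "(?h has_real_derivative 2 * cos (in_angle a x) + 2 * cos (\<theta> x)) (at x)"
    by (intro DERIV_add DERIV_cmult chordL_deriv_right f(1) axis_dist_deriv)
  show xh: "x < 1/2"
  proof (rule ccontr)
    assume "\<not> x < 1/2"
    then have xe: "x = 1/2" using x by simp
    have "cos (in_angle a x) < cos 0" using f(4,5) by (intro cos_monotone_0_pi) auto
    then have "2 * cos (in_angle a x) + 2 * cos (\<theta> x) < 0" unfolding xe \<theta>_half by simp
    \<comment> \<open>At the right end of the interval, a negative derivative means that moving left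
      increases the value.\<close>
    from has_real_derivative_neg_dec_left[OF dh this] obtain d where d: "d > 0" "\<And>h. 0 < h \<Longrightarrow> h < d \<Longrightarrow> ?h x < ?h (x - h)" by auto
    define h where "h = min d (x - a) / 2"
    have h: "0 < h" "h < d" "h < x - a" using d(1) ax by (auto simp: h_def min_def)
    then show False using d(2)[OF h(1,2)] hm[of "x - h"] x by auto
  qed
  have "2 * cos (in_angle a x) + 2 * cos (\<theta> x) = 0"
  proof (rule DERIV_local_max[OF dh, of "min (x - a) (1/2 - x)"])
    show "\<forall>y. \<bar>x - y\<bar> < min (x - a) (1/2 - x) \<longrightarrow> ?h y \<le> ?h x" by (intro allI impI hm) auto
  qed (use ax xh in auto)
  then have ce: "cos (in_angle a x) = cos (pi - \<theta> x)" by simp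
  have tx': "\<theta> x < pi" using \<theta>_less[OF xh] \<theta>_half by simp
  have "0 < \<theta> x" using ta \<theta>_less[OF ax] by simp
  then have e: "in_angle a x = pi - \<theta> x" using tx'
    by (intro cos_inj_pi[OF less_imp_le[OF f(4)] less_imp_le[OF f(5)] _ _ ce]) simp_all
  then show "in_angle a x = out_angle x (1 - x)" using out_angle_mirror[of x] a ax xh by simp
  have "((\<theta> x - \<theta> a) / 2) ^ 2 \<le> (17/10) ^ 2" using le \<theta>_less[OF ax] by (intro power_mono) auto
  then have "120 * \<epsilon> * ((\<theta> x - \<theta> a) / 2) ^ 2 \<le> 120 * (1/20000) * (17/10) ^ 2" using eps eps' by (intro mult_mono) auto
  also have "\<dots> \<le> 2/100" by (simp add: power2_eq_square)
  finally have "\<bar>out_angle a x - (\<theta> x - \<theta> a) / 2\<bar> \<le> 2/100" by (rule order_trans[OF f(7)])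
  moreover have "i \<le> d / 2 + 2/100" if "\<bar>p - d / 2\<bar> \<le> 2/100" "p + i = d" for p i d :: real using that by linarith
  ultimately have "in_angle a x \<le> (\<theta> x - \<theta> a) / 2 + 2/100" using f(6) by blast
  moreover have "(\<theta> x - \<theta> a) / 2 \<le> 158/100" using ta tx' pi_approx by simp
  ultimately have "pi - \<theta> x \<le> 17/10" unfolding e by (rule order_trans[OF _ add_right_mono, THEN order_trans]) simp
  then show "\<theta> (1 - x) - \<theta> x \<le> 34/10" unfolding \<theta>_refl by simp
qed

end

section \<open>Maximizers of \<open>Lq\<close> are billiard orbits\<close>

lemma (in near_circle) max_orbit_interior:
  assumes max: "is_Lq_max \<gamma> q s" and i: "0 < i" "i < q div 2" and y: "s (i - 1) \<le> y" "y \<le> s (Suc i)"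
  shows "chordL \<gamma> (s (i - 1)) y + chordL \<gamma> y (s (Suc i)) \<le> chordL \<gamma> (s (i - 1)) (s i) + chordL \<gamma> (s i) (s (Suc i))"
proof -
  let ?k = "q div 2"
  let ?t = "s(i := y)"
  have adm: "adm q s" and le: "\<And>t. adm q t \<Longrightarrow> Lq \<gamma> q t \<le> Lq \<gamma> q s" using max by (auto simp: is_Lq_max_def)
  have "?t j \<le> ?t (Suc j)" if "j < ?k" for j
  proof -
    consider "Suc j = i" | "j = i" | "j \<noteq> i" "Suc j \<noteq> i" by auto
    then show ?thesis
    proof cases
      case 3 then show ?thesis using adm that by (simp add: adm_def)
    qed (use y in auto)
  qed
  then have "adm q ?t" using adm i by (auto simp: adm_def)
  then have L: "Lq \<gamma> q ?t \<le> Lq \<gamma> q s" by (rule le)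
  define D where "D t = (\<lambda>j. chordL \<gamma> (t j) (t (Suc j)))" for t :: "nat \<Rightarrow> real"
  have split: "(\<Sum>j<?k. D t j) = D t (i - 1) + D t i + (\<Sum>j\<in>{..<?k} - {i - 1, i}. D t j)" for t
  proof -
    have "(\<Sum>j<?k. D t j) = (\<Sum>j\<in>{i - 1, i}. D t j) + (\<Sum>j\<in>{..<?k} - {i - 1, i}. D t j)"
      using i by (subst add.commute, intro sum.subset_diff) auto
    then show ?thesis using i by simp
  qed
  have rest: "(\<Sum>j\<in>{..<?k} - {i - 1, i}. D ?t j) = (\<Sum>j\<in>{..<?k} - {i - 1, i}. D s j)"
    using i by (intro sum.cong) (auto simp: D_def)
  have Lt: "Lq \<gamma> q t = 2 * (\<Sum>j<?k. D t j) + (if even q then 0 else chordL \<gamma> (t ?k) (- t ?k))" for t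
    by (simp add: Lq_def D_def sum_distrib_left)
  have tk: "?t ?k = s ?k" using i by simp
  have "(\<Sum>j<?k. D ?t j) \<le> (\<Sum>j<?k. D s j)" using L unfolding Lt tk by simp
  then have "D ?t (i - 1) + D ?t i \<le> D s (i - 1) + D s i" unfolding split rest by simp
  moreover have "i - 1 \<noteq> i" "Suc (i - 1) = i" using i by auto
  ultimately show ?thesis by (simp add: D_def)
qed

text \<open>For odd \<open>q\<close> the last point may move freely between its predecessor and
  \<open>1/2\<close>; only its chord to the predecessor and its mirror chord change.\<close>

lemma (in near_circle) max_orbit_last:
  assumes max: "is_Lq_max \<gamma> q s" and odd: "odd q" and q: "q \<ge> 2" and y: "s (q div 2 - 1) \<le> y" "y \<le> 1/2"
  shows "2 * chordL \<gamma> (s (q div 2 - 1)) y + chordL \<gamma> y (- y)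
     \<le> 2 * chordL \<gamma> (s (q div 2 - 1)) (s (q div 2)) + chordL \<gamma> (s (q div 2)) (- s (q div 2))"
proof -
  define k where "k = q div 2"
  have k: "k \<ge> 1" using q by (auto simp: k_def)
  let ?t = "s(k := y)"
  have adm: "adm q s" and le: "\<And>t. adm q t \<Longrightarrow> Lq \<gamma> q t \<le> Lq \<gamma> q s" using max by (auto simp: is_Lq_max_def)
  have "?t j \<le> ?t (Suc j)" if "j < k" for j
  proof (cases "Suc j = k")
    case True
    then have "j = k - 1" "j \<noteq> k" by auto
    then show ?thesis using y True by (simp add: k_def)
  next
    case False
    then show ?thesis using adm that by (simp add: adm_def k_def)
  qed
  then have "adm q ?t" using adm odd k y by (auto simp: adm_def k_def)
  then have L: "Lq \<gamma> q ?t \<le> Lq \<gamma> q s" by (rule le)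
  define D where "D t = (\<lambda>j. chordL \<gamma> (t j) (t (Suc j)))" for t :: "nat \<Rightarrow> real"
  obtain l where l: "k = Suc l" using k by (cases k) auto
  have rest: "(\<Sum>j<l. D ?t j) = (\<Sum>j<l. D s j)" using l by (intro sum.cong) (auto simp: D_def)
  have Lt: "Lq \<gamma> q t = 2 * (\<Sum>j<l. D t j) + 2 * D t l + chordL \<gamma> (t k) (- t k)" for t
    using odd l unfolding Lq_def k_def[symmetric] by (simp add: D_def sum_distrib_left)
  show ?thesis using L l unfolding Lt rest k_def[symmetric] by (simp add: D_def)
qed

text \<open>The reflection law needs distinct neighbours. If two consecutive points coincided, every
  further point would have to coincide as well, since \<open>two_chord_max\<close> forbids a
  repeated point next to a different one. All points would then be \<open>0\<close>, against the end
  condition \<open>1/2\<close> for even \<open>q\<close> and against \<open>mirror_chord_max\<close>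
  for odd \<open>q\<close>.\<close>

lemma (in near_circle) max_orbit_strict:
  assumes max: "is_Lq_max \<gamma> q s" and q: "q \<ge> 2" and eps': "\<epsilon> \<le> 1 / 20000"
  shows "\<And>i. i < q div 2 \<Longrightarrow> s i < s (Suc i)" "\<And>i. i \<le> q div 2 \<Longrightarrow> 0 \<le> s i \<and> s i \<le> 1/2"
    "odd q \<Longrightarrow> s (q div 2) < 1/2 \<and> in_angle (s (q div 2 - 1)) (s (q div 2)) = out_angle (s (q div 2)) (1 - s (q div 2))
      \<and> \<theta> (1 - s (q div 2)) - \<theta> (s (q div 2)) \<le> 34/10"
    "\<And>i. 0 < i \<Longrightarrow> i < q div 2 \<Longrightarrow> in_angle (s (i - 1)) (s i) = out_angle (s i) (s (Suc i))"
proof -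
  define k where "k = q div 2"
  have k: "k \<ge> 1" using q by (auto simp: k_def)
  have adm: "adm q s" using max by (simp add: is_Lq_max_def)
  have s0: "s 0 = 0" and mono: "\<And>i. i < k \<Longrightarrow> s i \<le> s (Suc i)" and sk: "s k \<le> 1/2" and ske: "even q \<Longrightarrow> s k = 1/2"
    using adm by (auto simp: adm_def k_def split: if_splits)
  have mono': "s i \<le> s (i + d)" if "i + d \<le> k" for i d using that
  proof (induction d)
    case (Suc d) then show ?case using mono[of "i + d"] by simp
  qed simp
  have rng: "0 \<le> s i \<and> s i \<le> 1/2" if "i \<le> k" for i
    using mono'[of 0 i] mono'[of i "k - i"] s0 sk that by simp
  have \<theta>small: "\<theta> (s j) - \<theta> (s i) \<le> 34/10" if "i \<le> k" "j \<le> k" for i j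
  proof -
    have "\<theta> (s i) \<ge> 0" using \<theta>_nonneg rng[OF that(1)] by simp
    moreover have "\<theta> (s j) \<le> pi" using \<theta>_le_pi rng[OF that(2)] by simp
    ultimately show ?thesis using pi_approx by simp
  qed
  have A: "s (i - 1) < s i \<and> s i < s (Suc i) \<and> in_angle (s (i - 1)) (s i) = out_angle (s i) (s (Suc i))"
    if i: "0 < i" "i < k" and lt: "s (i - 1) < s (Suc i)" for i
  proof -
    have "s (i - 1) \<le> s i" "s i \<le> s (Suc i)" using mono[of "i - 1"] mono[of i] i by auto
    from two_chord_max[OF lt _ this max_orbit_interior[OF max i(1) i(2)[unfolded k_def]]]
    show ?thesis using \<theta>small[of "i - 1" "Suc i"] i by auto
  qed
  have B: "s (k - 1) < s k \<and> s k < 1/2 \<and> in_angle (s (k - 1)) (s k) = out_angle (s k) (1 - s k) \<and> \<theta> (1 - s k) - \<theta> (s k) \<le> 34/10"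
    if odd: "odd q" and lt: "s (k - 1) < 1/2" for i
  proof -
    have "0 \<le> s (k - 1)" "s (k - 1) \<le> s k" using rng[of "k - 1"] mono[of "k - 1"] k by auto
    from mirror_chord_max[OF eps' this(1) lt this(2) sk max_orbit_last[OF max odd q, folded k_def]]
    show ?thesis by auto
  qed
  have strict: "s i < s (Suc i)" if i: "i < k" for i
  proof (rule ccontr)
    assume "\<not> s i < s (Suc i)"
    then have eq: "s i = s (Suc i)" using mono[OF i] by simp
    \<comment> \<open>The coincidence spreads to both ends of the chain, here upwards and then
      downwards.\<close>
    have up: "s (i + d) = s (Suc (i + d))" if "i + d < k" for d using that
    proof (induction d)
      case (Suc d)
      then have e: "s (i + d) = s (Suc (i + d))" by simp
      show ?case
      proof (rule ccontr)
        assume "s (i + Suc d) \<noteq> s (Suc (i + Suc d))"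
        then have "s (Suc (i + d) - 1) < s (Suc (Suc (i + d)))" using mono[of "Suc (i + d)"] Suc.prems e by simp
        then show False using A[of "Suc (i + d)"] Suc.prems e by simp
      qed
    qed (use eq in simp)
    have down: "s (i - d) = s (Suc (i - d))" if "d \<le> i" for d using that
    proof (induction d)
      case (Suc d)
      then have e: "s (i - d) = s (Suc (i - d))" by simp
      have j: "Suc (i - Suc d) = i - d" "i - d - 1 = i - Suc d" using Suc.prems by auto
      show ?case
      proof (rule ccontr)
        assume "s (i - Suc d) \<noteq> s (Suc (i - Suc d))"
        moreover have "i - Suc d < k" using i by simp
        ultimately have "s (i - d - 1) < s (Suc (i - d))" using mono[of "i - Suc d"] unfolding j e[symmetric] less_le by blast
        moreover have "0 < i - d" "i - d < k" using Suc.prems i by auto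
        ultimately show False using A[of "i - d"] e by simp
      qed
    qed (use eq in simp)
    have all: "s j = s (Suc j)" if "j < k" for j
      using up[of "j - i"] down[of "i - j"] that by (cases "i \<le> j") auto
    have zero: "s j = 0" if "j \<le> k" for j using that
    proof (induction j)
      case (Suc j) then show ?case using all[of j] by simp
    qed (use s0 in simp)
    show False
    proof (cases "even q")
      case True then show False using ske zero[of k] by simp
    next
      case False then show False using B zero[of k] zero[of "k - 1"] by auto
    qed
  qed
  show "\<And>i. i < q div 2 \<Longrightarrow> s i < s (Suc i)" using strict by (simp add: k_def)
  show "\<And>i. i \<le> q div 2 \<Longrightarrow> 0 \<le> s i \<and> s i \<le> 1/2" using rng by (simp add: k_def)
  show "odd q \<Longrightarrow> s (q div 2) < 1/2 \<and> in_angle (s (q div 2 - 1)) (s (q div 2)) = out_angle (s (q div 2)) (1 - s (q div 2))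
      \<and> \<theta> (1 - s (q div 2)) - \<theta> (s (q div 2)) \<le> 34/10"
    using B strict[of "k - 1"] k sk unfolding k_def[symmetric] by auto
  show "in_angle (s (i - 1)) (s i) = out_angle (s i) (s (Suc i))" if "0 < i" "i < q div 2" for i
  proof -
    have "s (i - 1) < s i" "s i < s (Suc i)" using strict[of "i - 1"] strict[of i] that by (auto simp: k_def)
    then show ?thesis using A[of i] that by (auto simp: k_def)
  qed
qed

text \<open>\<open>orbit_pt\<close> with the reflected half moved by one period, so that the
  parameters increase from \<open>0\<close> to \<open>1\<close> and the index \<open>q\<close>
  closes the polygon.\<close>

definition full_orbit :: "nat \<Rightarrow> (nat \<Rightarrow> real) \<Rightarrow> nat \<Rightarrow> real" where
  "full_orbit q s j = (if j \<le> q div 2 then s j else 1 - s (q - j))"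

text \<open>Everything is shown for the first half and carried over by the symmetry
  \<open>S (q - j) = 1 - S j\<close>, under which incoming and outgoing angles are
  exchanged.\<close>

lemma (in near_circle) full_orbit_facts:
  assumes max: "is_Lq_max \<gamma> q s" and q: "q \<ge> 2" and eps': "\<epsilon> \<le> 1 / 20000"
  defines "S \<equiv> full_orbit q s"
  shows "S 0 = 0" "S q = 1" "\<And>j. j < q \<Longrightarrow> S j < S (Suc j)" "\<And>j. j < q \<Longrightarrow> \<theta> (S (Suc j)) - \<theta> (S j) \<le> 34/10"
    "\<And>j. 0 < j \<Longrightarrow> j < q \<Longrightarrow> in_angle (S (j - 1)) (S j) = out_angle (S j) (S (Suc j))"
proof -
  define k where "k = q div 2"
  have k: "k \<ge> 1" "q = 2 * k \<or> q = 2 * k + 1" using q by (auto simp: k_def)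
  note st = max_orbit_strict[OF max q eps', folded k_def]
  have s0: "s 0 = 0" and ske: "even q \<Longrightarrow> s k = 1/2"
    using max by (auto simp: is_Lq_max_def adm_def k_def split: if_splits)
  have SS: "S j = (if j \<le> k then s j else 1 - s (q - j))" for j by (simp add: S_def full_orbit_def k_def)
  show S0: "S 0 = 0" using s0 by (simp add: SS)
  show Sq: "S q = 1" using s0 k by (auto simp: SS)
  have sym: "S (q - j) = 1 - S j" if "j \<le> q" for j
  proof -
    consider "j < k" | "j = k" "even q" | "j = k" "odd q" | "j > k" by linarith
    then show ?thesis
    proof cases
      case 2 then show ?thesis using k ske by (auto simp: SS)
    qed (use k that in \<open>auto simp: SS\<close>)
  qed
  have lo: "S j < S (Suc j)" if "j \<le> k" "j < q" for j
  proof (cases "j < k")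
    case True then show ?thesis using st(1)[of j] by (simp add: SS)
  next
    case False
    then have j: "j = k" using that by simp
    show ?thesis
    proof (cases "even q")
      case True
      then have "q = 2 * k" using k by auto
      then show ?thesis using st(1)[of "k - 1"] ske True k j by (simp add: SS)
    next
      case False
      then have "q = 2 * k + 1" using k by auto
      then show ?thesis using st(3)[OF False] j by (simp add: SS)
    qed
  qed
  have low: "\<theta> (S (Suc j)) - \<theta> (S j) \<le> 34/10" if "j < k" for j
  proof -
    have "\<theta> (s j) \<ge> 0" using \<theta>_nonneg st(2)[of j] that by simp
    moreover have "\<theta> (s (Suc j)) \<le> pi" using \<theta>_le_pi st(2)[of "Suc j"] that by simp
    ultimately show ?thesis using pi_approx that by (simp add: SS)
  qed
  have mir: "S j = 1 - S (q - j)" "S (Suc j) = 1 - S (q - Suc j)" if "j < q" for j using sym[of j] sym[of "Suc j"] that by auto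
  show inc: "S j < S (Suc j)" if "j < q" for j
  proof (cases "j \<le> k")
    case True then show ?thesis using lo that by simp
  next
    case False
    have "q - j = Suc (q - Suc j)" using that by simp
    moreover have "S (q - Suc j) < S (Suc (q - Suc j))" using False that k by (intro lo) auto
    ultimately show ?thesis using mir[OF that] by simp
  qed
  show small: "\<theta> (S (Suc j)) - \<theta> (S j) \<le> 34/10" if "j < q" for j
  proof -
    \<comment> \<open>An edge belongs to the first half, is the middle edge of an odd orbit, or
      mirrors an edge of the first half.\<close>
    have "j < k \<or> (j = k \<and> odd q) \<or> q - Suc j < k"
    proof (cases "even q")
      case True
      then have "q = 2 * k" using k by auto
      then show ?thesis using k(1) by arith
    next
      case False
      then have "q = 2 * k + 1" using k by auto
      then show ?thesis using False k(1) by arith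
    qed
    then consider "j < k" | "j = k" "odd q" | "q - Suc j < k" by blast
    then show ?thesis
    proof cases
      case 1 then show ?thesis by (rule low)
    next
      case 2
      then have "q = 2 * k + 1" using k by auto
      then show ?thesis using st(3)[OF 2(2)] 2 by (simp add: SS)
    next
      case 3
      have e: "q - j = Suc (q - Suc j)" using that by simp
      have "\<theta> (S (Suc j)) - \<theta> (S j) = \<theta> (S (Suc (q - Suc j))) - \<theta> (S (q - Suc j))"
        unfolding mir[OF that] \<theta>_refl e by simp
      then show ?thesis using low[OF 3] by simp
    qed
  qed
  have nz: "\<gamma> (S j) \<noteq> \<gamma> (S (Suc j))" if "j < q" for j using chord_facts(1)[OF inc[OF that] small[OF that]] .
  have law_lo: "in_angle (S (j - 1)) (S j) = out_angle (S j) (S (Suc j))" if j: "0 < j" "j \<le> k" for j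
  proof -
    consider "j < k" | "j = k" "even q" | "j = k" "odd q" using j(2) le_neq_implies_less by blast
    moreover have jk: "j - 1 \<le> k" using j by arith
    ultimately show ?thesis
    proof cases
      case 1 then show ?thesis using st(4)[of j] j jk by (simp add: SS)
    next
      case 2
      \<comment> \<open>The auxiliary point is held fixed in the maximization, so the law there
        comes from the mirror symmetry of its two chords.\<close>
      then have q2: "q = 2 * k" using k by auto
      have qk: "q - k = k" "q - (k - 1) = Suc k" "k \<le> q" "k - 1 \<le> q" "k - 1 < q" "Suc (k - 1) = k"
        unfolding q2 using k(1) by arith+
      have e1: "S k = 1 - S k" by (rule sym[OF qk(3), unfolded qk(1)])
      have e2: "S (Suc k) = 1 - S (k - 1)" by (rule sym[OF qk(4), unfolded qk(2)])
      have "out_angle (S k) (S (Suc k)) = out_angle (1 - S k) (1 - S (k - 1))" by (rule arg_cong2[OF e1 e2])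
      also have "\<dots> = in_angle (S (k - 1)) (S k)"
        by (rule angle_mirror_one(1)) (rule nz[OF qk(5), unfolded qk(6)])
      finally show ?thesis unfolding 2(1) by (rule HOL.sym)
    next
      case 3
      then have "q = 2 * k + 1" using k by auto
      then show ?thesis using st(3)[OF 3(2)] 3 k jk by (simp add: SS)
    qed
  qed
  show "in_angle (S (j - 1)) (S j) = out_angle (S j) (S (Suc j))" if j: "0 < j" "j < q" for j
  proof (cases "j \<le> k")
    case True then show ?thesis using law_lo j by simp
  next
    case False
    define i where "i = q - j"
    have i: "0 < i" "i \<le> k" "i < q" using False j k by (auto simp: i_def)
    have e: "S j = 1 - S i" "S (j - 1) = 1 - S (Suc i)" "S (Suc j) = 1 - S (i - 1)"
      using sym[of i] sym[of "Suc i"] sym[of "i - 1"] i j by (auto simp: i_def)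
    have "in_angle (S (j - 1)) (S j) = out_angle (S i) (S (Suc i))"
      unfolding e by (rule angle_mirror_one(2)) (use nz[of i] i in auto)
    also have "\<dots> = in_angle (S (i - 1)) (S i)" using law_lo[OF i(1,2)] by simp
    also have "\<dots> = out_angle (S j) (S (Suc j))"
      unfolding e by (rule angle_mirror_one(1)[symmetric]) (use nz[of "i - 1"] i in auto)
    finally show ?thesis .
  qed
qed

text \<open>Both \<open>\<nu>\<close> and the angles are \<open>1\<close>-periodic, so the lift
  changes nothing. At the last index \<open>Suc j mod q\<close> returns to the parameter
  \<open>0\<close>, whereas \<open>full_orbit\<close> continues to \<open>1\<close>.\<close>

lemma (in near_circle) ellq_full_orbit:
  assumes q: "q \<ge> 2" and s0: "s 0 = 0" and per: "\<And>t. \<nu> (t + 1) = \<nu> t"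
  shows "ellq \<gamma> q s \<nu> = (\<Sum>j<q. \<nu> (full_orbit q s j) * sin (out_angle (full_orbit q s j) (full_orbit q s (Suc j))))"
proof -
  let ?S = "full_orbit q s"
  have o: "orbit_pt q s j = ?S j \<or> orbit_pt q s j + 1 = ?S j" for j by (auto simp: orbit_pt_def full_orbit_def)
  have o': "orbit_pt q s (Suc j mod q) = ?S (Suc j) \<or> orbit_pt q s (Suc j mod q) + 1 = ?S (Suc j)" if "j < q" for j
  proof (cases "Suc j < q")
    case True then show ?thesis using o[of "Suc j"] by simp
  next
    case False
    then have "Suc j = q" using that by simp
    then show ?thesis using q s0 by (simp add: orbit_pt_def full_orbit_def)
  qed
  have "\<nu> (orbit_pt q s j) = \<nu> (?S j)" for j using o[of j] per[of "orbit_pt q s j"] by auto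
  moreover have "sin_angle \<gamma> (orbit_pt q s j) (orbit_pt q s (Suc j mod q)) = sin (out_angle (?S j) (?S (Suc j)))" if "j < q" for j
  proof -
    have "sin_angle \<gamma> (orbit_pt q s j) (orbit_pt q s (Suc j mod q)) = sin (out_angle (orbit_pt q s j) (orbit_pt q s (Suc j mod q)))"
      by (simp add: sin_angle_def out_angle_def)
    also have "out_angle (orbit_pt q s j) (orbit_pt q s (Suc j mod q)) = out_angle (?S j) (orbit_pt q s (Suc j mod q))"
      using o[of j] angles_shift(1)[of "orbit_pt q s j"] by auto
    also have "\<dots> = out_angle (?S j) (?S (Suc j))"
      using o'[OF that] angles_shift(2)[of "?S j" "orbit_pt q s (Suc j mod q)"] by auto
    finally show ?thesis .
  qed
  ultimately show ?thesis unfolding ellq_def by (intro sum.cong) auto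
qed

section \<open>Injectivity\<close>

context near_circle begin

definition total where "total = X (2 * pi)"

lemma total_bounds: "6 \<le> total" "total \<le> 7"
proof -
  obtain z where "X (2 * pi) - X 0 = (2 * pi - 0) * f z" using MVT2[of 0 "2 * pi" X f] dX by auto
  then have t: "total = 2 * pi * f z" using X0 by (simp add: total_def)
  have "(2 * 3.1) * (999/1000) \<le> 2 * pi * f z" using f_bounds[of z] pi_approx by (intro mult_mono) auto
  moreover have "2 * pi * f z \<le> (2 * 3.2) * (1001/1000)" using f_bounds[of z] pi_approx by (intro mult_mono) auto
  ultimately show "6 \<le> total" "total \<le> 7" unfolding t by simp_all
qed

lemma X_per: "X (t + 2 * pi) = X t + total"
proof -
  have "((\<lambda>t. X (t + 2 * pi) - X t) has_real_derivative f (t + 2 * pi) - f t) (at t)" for t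
    using DERIV_shift[of X "f (t + 2 * pi)" t "2 * pi"] dX by (intro DERIV_diff) auto
  then have "((\<lambda>t. X (t + 2 * pi) - X t) has_vector_derivative 0) (at t)" for t
    using f_per by (simp add: has_real_derivative_iff_has_vector_derivative)
  then have "X (t + 2 * pi) - X t = X (0 + 2 * pi) - X 0" by (rule vector_derivative_zero_constant)
  then show ?thesis using X0 by (simp add: total_def)
qed

lemma X_odd: "X (- t) = - X t"
proof -
  have "((\<lambda>t. X (- t) + X t) has_real_derivative - f (- t) + f t) (at t)" for t
    using DERIV_mirror[of X "f (- t)" t] dX by (intro DERIV_add) auto
  then have "((\<lambda>t. X (- t) + X t) has_vector_derivative 0) (at t)" for t
    using f_even by (simp add: has_real_derivative_iff_has_vector_derivative)
  then have "X (- t) + X t = X (- 0) + X 0" by (rule vector_derivative_zero_constant)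
  then show ?thesis using X0 by simp
qed

definition lazutkin :: "real \<Rightarrow> real" where "lazutkin s = X (\<theta> s) / total"

definition speed :: "real \<Rightarrow> real" where "speed s = f (\<theta> s) * \<kappa> s / total"

lemma lazutkin_deriv: "(lazutkin has_real_derivative speed s) (at s)"
  unfolding lazutkin_def[abs_def] speed_def
  by (rule DERIV_cdivide[OF DERIV_chain2[OF dX d\<theta>]])

lemma speed_ge: "1/2 \<le> speed s"
proof -
  have "(999/1000) * 6 \<le> f (\<theta> s) * \<kappa> s" using f_bounds[of "\<theta> s"] \<kappa>_ge[of s] by (intro mult_mono) auto
  then have "((999/1000) * 6) / 7 \<le> f (\<theta> s) * \<kappa> s / total" using total_bounds by (intro frac_le) auto
  then show ?thesis unfolding speed_def by (rule order_trans[rotated]) simp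
qed

lemma lazutkin_facts: "lazutkin 0 = 0" "lazutkin (s + 1) = lazutkin s + 1" "lazutkin (- s) = - lazutkin s"
  using total_bounds by (simp_all add: lazutkin_def \<theta>0 X0 \<theta>_per X_per \<theta>_odd X_odd add_divide_distrib)

text \<open>\<open>cq\<close> is the common approximate value of \<open>f * sin\<close> of the
  angles; dividing by it makes the weights close to \<open>1\<close>. Since
  \<open>cq \<ge> 1 / q\<close>, this costs one power of \<open>q\<close>. The first bound is
  weakened to the same constant so that one error parameter serves both.\<close>

lemma orbit_sampling:
  assumes max: "is_Lq_max \<gamma> q s" and q: "q \<ge> 2" and eps': "\<epsilon> \<le> 1 / 20000" and j: "j < q"
  defines "S \<equiv> full_orbit q s" and "cq \<equiv> total / (2 * pi) * sin (pi / real q)"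
  shows "\<bar>lazutkin (S (Suc j)) - lazutkin (S j) - 1 / real q\<bar> \<le> 2000000 * \<epsilon> / real q ^ 3"
    and "\<bar>f (\<theta> (S j)) * sin (out_angle (S j) (S (Suc j))) / cq - 1\<bar> \<le> 2000000 * \<epsilon> / (real q)\<^sup>2"
    and "0 < cq"
proof -
  note F = full_orbit_facts[OF max q eps', folded S_def]
  have q0: "real q \<ge> 2" using q by simp
  have est: "\<bar>X (\<theta> (S (Suc j))) - X (\<theta> (S j)) - total / real q\<bar> \<le> 62000 * \<epsilon> / real q ^ 3"
    "\<bar>f (\<theta> (S j)) * sin (out_angle (S j) (S (Suc j))) - total / (2 * pi) * sin (pi / real q)\<bar> \<le> 2000000 * \<epsilon> / real q ^ 3"
    using orbit_estimates[where \<theta> = "\<lambda>j. \<theta> (S j)", OF q eps' _ _ _ _ _ j] F \<theta>_less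
    unfolding total_def by (simp_all add: \<theta>0 \<theta>_one X0 flip: in_angle_G out_angle_G)
  have "\<bar>lazutkin (S (Suc j)) - lazutkin (S j) - 1 / real q\<bar> = \<bar>X (\<theta> (S (Suc j))) - X (\<theta> (S j)) - total / real q\<bar> / total"
  proof -
    have "lazutkin (S (Suc j)) - lazutkin (S j) - 1 / real q = (X (\<theta> (S (Suc j))) - X (\<theta> (S j)) - total / real q) / total"
      using total_bounds by (simp add: lazutkin_def diff_divide_distrib)
    then show ?thesis using total_bounds by simp
  qed
  also have "\<dots> \<le> (62000 * \<epsilon> / real q ^ 3) / 1" using est(1) total_bounds eps by (intro frac_le) auto
  also have "\<dots> \<le> 2000000 * \<epsilon> / real q ^ 3" using eps by (simp add: divide_right_mono)
  finally show "\<bar>lazutkin (S (Suc j)) - lazutkin (S j) - 1 / real q\<bar> \<le> 2000000 * \<epsilon> / real q ^ 3" .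
  have cq: "1 / real q \<le> cq"
  proof -
    have "pi / real q \<le> 3.2 / 2" using q0 pi_approx by (intro frac_le) auto
    then have "pi / real q \<le> 17/10" by (rule order_trans) simp
    then have "sin (pi / real q) \<ge> pi / real q / 2" by (intro sin_ge_half) auto
    then have "total / (2 * pi) * (pi / real q / 2) \<le> cq" unfolding cq_def using total_bounds by (intro mult_left_mono) auto
    moreover have "total / (2 * pi) * (pi / real q / 2) = (total / 4) * (1 / real q)" by simp
    moreover have "1 * (1 / real q) \<le> (total / 4) * (1 / real q)" using total_bounds by (intro mult_right_mono) auto
    ultimately show ?thesis by simp
  qed
  then show cq0: "0 < cq" using q0 by (simp add: less_le_trans[of 0 "1 / real q"])
  have "\<bar>f (\<theta> (S j)) * sin (out_angle (S j) (S (Suc j))) / cq - 1\<bar> = \<bar>f (\<theta> (S j)) * sin (out_angle (S j) (S (Suc j))) - cq\<bar> / cq"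
  proof -
    have "f (\<theta> (S j)) * sin (out_angle (S j) (S (Suc j))) / cq - 1 = (f (\<theta> (S j)) * sin (out_angle (S j) (S (Suc j))) - cq) / cq"
      using cq0 by (simp add: diff_divide_distrib)
    then show ?thesis using cq0 by simp
  qed
  also have "\<dots> \<le> (2000000 * \<epsilon> / real q ^ 3) / (1 / real q)"
    using est(2) cq q0 eps unfolding cq_def by (intro frac_le) auto
  also have "\<dots> = 2000000 * \<epsilon> / (real q)\<^sup>2" using q0 by (simp add: power2_eq_square power3_eq_cube)
  finally show "\<bar>f (\<theta> (S j)) * sin (out_angle (S j) (S (Suc j))) / cq - 1\<bar> \<le> 2000000 * \<epsilon> / (real q)\<^sup>2" .
qed

text \<open>In the Lazutkin coordinate the weighted function \<open>d / f\<close> is sampled almost uniformly and with almost equal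
  weights.\<close>
lemma injective_core:
  fixes d da db :: "real \<Rightarrow> real"
  assumes eps': "\<epsilon> \<le> 5 / 10 ^ 12"
    and max: "\<And>q. q \<ge> 2 \<Longrightarrow> is_Lq_max \<gamma> q (\<sigma> q)"
    and per: "\<And>s. d (s + 1) = d s" and ev: "\<And>s. d (- s) = d s"
    and dd: "\<And>s. (d has_real_derivative da s) (at s)" "\<And>s. (da has_real_derivative db s) (at s)"
    and cd2: "continuous_on UNIV db"
    and l0: "integral {0..1} (\<lambda>s. d s * \<kappa> s) = 0" and l1: "d 0 = 0"
    and lq: "\<And>q. q \<ge> 2 \<Longrightarrow> ellq \<gamma> q (\<sigma> q) d = 0"
  shows "d s = 0"
proof -
  have e1: "\<epsilon> \<le> 1 / 20000" using eps' by simp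
  obtain z where z: "\<And>s. z (lazutkin s) = s" "\<And>y. lazutkin (z y) = y" "\<And>y. (z has_real_derivative 1 / speed (z y)) (at y)"
    using ex_inverse_deriv[OF lazutkin_deriv, of "1/2"] speed_ge by (metis zero_less_divide_1_iff zero_less_numeral)
  have pull: "((\<lambda>y. A (z y)) has_real_derivative B (z y) / speed (z y)) (at y)"
    if "\<And>s. (A has_real_derivative B s) (at s)" for A B y
    using DERIV_chain2[OF that z(3), of y] by simp
  have zodd: "z (- y) = - z y" for y using z(1)[of "- z y"] z(2)[of y] lazutkin_facts(3)[of "z y"] by simp
  have zper: "z (y + 1) = z y + 1" for y using z(1)[of "z y + 1"] z(2)[of y] lazutkin_facts(2)[of "z y"] by simp
  define F Fa Fb where "F s = f (\<theta> s)" and "Fa s = f1 (\<theta> s) * \<kappa> s" and "Fb s = f2 (\<theta> s) * \<kappa> s * \<kappa> s + f1 (\<theta> s) * \<kappa>' s" for s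
  define sp1 where "sp1 s = (Fa s * \<kappa> s + F s * \<kappa>' s) / total" for s
  have F0: "F s \<noteq> 0" "F s > 0" for s using f_bounds[of "\<theta> s"] by (auto simp: F_def)
  have sp0: "speed s \<noteq> 0" for s using speed_ge[of s] by auto
  have dF: "(F has_real_derivative Fa s) (at s)" for s
    unfolding F_def[abs_def] Fa_def by (rule DERIV_chain2[OF df(1) d\<theta>])
  have dFa: "(Fa has_real_derivative Fb s) (at s)" for s
    unfolding Fa_def[abs_def] Fb_def
    using DERIV_mult[OF DERIV_chain2[OF df(2) d\<theta>] d\<kappa>, of s] by (simp add: algebra_simps)
  have dsp: "(speed has_real_derivative sp1 s) (at s)" for s
  proof -
    have "speed = (\<lambda>s. F s * \<kappa> s / total)" by (auto simp: speed_def F_def)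
    then show ?thesis unfolding sp1_def using DERIV_cdivide[OF DERIV_mult[OF dF[of s] d\<kappa>[of s]], of total] by (simp add: algebra_simps)
  qed
  \<comment> \<open>The derivatives are carried as explicit quotients, which makes the continuity of
    the second derivative of \<open>u\<close> visible.\<close>
  define V where "V s = d s / F s" for s
  define V1 where "V1 s = (da s * F s - d s * Fa s) / (F s * F s)" for s
  define N1 where "N1 s = db s * F s + da s * Fa s - (da s * Fa s + d s * Fb s)" for s
  define V2 where "V2 s = (N1 s * (F s * F s) - (da s * F s - d s * Fa s) * (Fa s * F s + F s * Fa s)) / ((F s * F s) * (F s * F s))" for s
  define W1 where "W1 s = V1 s / speed s" for s
  define W2 where "W2 s = (V2 s * speed s - V1 s * sp1 s) / (speed s * speed s)" for s
  have dV: "(V has_real_derivative V1 s) (at s)" for s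
    unfolding V_def[abs_def] V1_def by (rule DERIV_divide[OF dd(1) dF F0(1)])
  have dN: "((\<lambda>s. da s * F s - d s * Fa s) has_real_derivative N1 s) (at s)" for s
    unfolding N1_def using DERIV_diff[OF DERIV_mult[OF dd(2) dF] DERIV_mult[OF dd(1) dFa], of s] by (simp add: algebra_simps)
  have dFF: "((\<lambda>s. F s * F s) has_real_derivative Fa s * F s + F s * Fa s) (at s)" for s
    using DERIV_mult[OF dF dF, of s] by (simp add: algebra_simps)
  have dV1: "(V1 has_real_derivative V2 s) (at s)" for s
    unfolding V1_def[abs_def] V2_def by (rule DERIV_divide[OF dN dFF]) (use F0 in auto)
  have dW1: "(W1 has_real_derivative W2 s) (at s)" for s
    unfolding W1_def[abs_def] W2_def by (rule DERIV_divide[OF dV1 dsp sp0])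
  define u u1 u2 where "u y = V (z y)" and "u1 y = W1 (z y)" and "u2 y = W2 (z y) / speed (z y)" for y
  have du: "(u has_real_derivative u1 y) (at y)" for y
    unfolding u_def[abs_def] u1_def W1_def by (rule pull[OF dV])
  have du1: "(u1 has_real_derivative u2 y) (at y)" for y
    unfolding u1_def[abs_def] u2_def by (rule pull[OF dW1])
  have dc: "continuous_on UNIV A" if "\<And>s. (A has_real_derivative B s) (at s)" for A B :: "real \<Rightarrow> real"
    using DERIV_continuous_on[of UNIV A B] that by blast
  have cf2: "continuous_on UNIV (\<lambda>s. f2 (\<theta> s))" by (rule continuous_on_compose2[OF dc[OF df(3)] dc[OF d\<theta>]]) auto
  have cf1: "continuous_on UNIV (\<lambda>s. f1 (\<theta> s))" by (rule continuous_on_compose2[OF dc[OF df(2)] dc[OF d\<theta>]]) auto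
  have cFb: "continuous_on UNIV Fb" unfolding Fb_def[abs_def] by (intro continuous_intros cf1 cf2 dc[OF d\<kappa>] c\<kappa>')
  have csp1: "continuous_on UNIV sp1" unfolding sp1_def[abs_def] using total_bounds
    by (intro continuous_intros dc[OF dF] dc[OF dFa] dc[OF d\<kappa>] c\<kappa>') auto
  have cN1: "continuous_on UNIV N1" unfolding N1_def[abs_def]
    by (intro continuous_intros cd2 cFb dc[OF dF] dc[OF dFa] dc[OF dd(1)] dc[OF dd(2)])
  have cV2: "continuous_on UNIV V2" unfolding V2_def[abs_def]
    by (intro continuous_intros cN1 dc[OF dF] dc[OF dFa] dc[OF dd(1)] dc[OF dd(2)]) (use F0 in auto)
  have cW2: "continuous_on UNIV (\<lambda>s. W2 s / speed s)" unfolding W2_def[abs_def]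
    by (intro continuous_intros cV2 csp1 dc[OF dV1] dc[OF dsp]) (use sp0 in auto)
  have cu2: "continuous_on UNIV u2" unfolding u2_def[abs_def]
    by (rule continuous_on_compose2[OF cW2 dc[OF z(3)]]) auto
  have uper: "u (y + 1) = u y" for y
  proof -
    have "F (s + 1) = F s" for s unfolding F_def \<theta>_per by (rule f_per)
    then show ?thesis unfolding u_def V_def zper per by simp
  qed
  have uev: "u (- y) = u y" for y
  proof -
    have "F (- s) = F s" for s unfolding F_def \<theta>_odd by (rule f_even)
    then show ?thesis unfolding u_def V_def zodd ev by simp
  qed
  have ux: "u (lazutkin s) = d s / F s" for s unfolding u_def V_def z ..
  have u0: "u 0 = 0" using ux[of 0] lazutkin_facts(1) l1 by simp
  \<comment> \<open>Substitution through one antiderivative \<open>U\<close>: with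
    \<open>speed = F * \<kappa> / total\<close>, the factor \<open>F\<close> cancels the denominator
    of \<open>u\<close>, so the curvature functional is \<open>total\<close> times the mean of
    \<open>u\<close>.\<close>
  have mean: "integral {0..1} u = 0"
  proof -
    obtain U where U: "\<And>y. (U has_real_derivative u y) (at y)" using ex_antiderivative[OF dc[OF du]] by blast
    have "(u has_integral (U 1 - U 0)) {0..1}"
      using U by (intro fundamental_theorem_of_calculus) (auto simp: has_real_derivative_iff_has_vector_derivative[symmetric] intro: has_field_derivative_at_within)
    moreover have "((\<lambda>s. d s * \<kappa> s / total) has_integral (U (lazutkin 1) - U (lazutkin 0))) {0..1}"
    proof (rule fundamental_theorem_of_calculus)
      fix s :: real
      have "((\<lambda>s. U (lazutkin s)) has_real_derivative u (lazutkin s) * speed s) (at s)"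
        by (rule DERIV_chain2[OF U lazutkin_deriv])
      moreover have "u (lazutkin s) * speed s = d s * \<kappa> s / total"
        unfolding ux speed_def using F0[of s] by (simp add: F_def)
      ultimately show "((\<lambda>s. U (lazutkin s)) has_vector_derivative d s * \<kappa> s / total) (at s within {0..1})"
        by (auto simp: has_real_derivative_iff_has_vector_derivative[symmetric] intro: has_field_derivative_at_within)
    qed simp
    moreover have "((\<lambda>s. d s * \<kappa> s / total) has_integral 0) {0..1}"
    proof -
      have "(\<lambda>s. d s * \<kappa> s) integrable_on {0..1}"
        by (intro integrable_continuous_interval continuous_intros continuous_on_subset[OF dc[OF dd(1)]] continuous_on_subset[OF dc[OF d\<kappa>]]) auto
      then have "((\<lambda>s. d s * \<kappa> s) has_integral 0) {0..1}" using l0 integrable_integral by metis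
      from has_integral_divide[OF this, of total] show ?thesis by simp
    qed
    ultimately show ?thesis using lazutkin_facts(1) lazutkin_facts(2)[of 0] has_integral_unique integral_unique by (metis add_0)
  qed
  let ?S = "\<lambda>q. full_orbit q (\<sigma> q)"
  let ?c = "\<lambda>q. total / (2 * pi) * sin (pi / real q)"
  define e where "e q j = f (\<theta> (?S q j)) * sin (out_angle (?S q j) (?S q (Suc j))) / ?c q - 1" for q j
  have "u (lazutkin s) = 0"
  \<comment> \<open>The hypothesis \<open>\<epsilon> \<le> 5 / 10 ^ 12\<close> is exactly
    \<open>2000000 * \<epsilon> \<le> 1 / 100000\<close>.\<close>
  proof (rule perturbed_sampling_unique[where \<epsilon> = "2000000 * \<epsilon>" and x = "\<lambda>q j. lazutkin (?S q j)" and e = e, OF _ _ uper uev du du1 cu2 mean u0])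
    fix q :: nat assume q: "2 \<le> q"
    note F = full_orbit_facts[OF max[OF q] q e1]
    show "lazutkin (?S q 0) = 0" using F(1) lazutkin_facts(1) by simp
    show "lazutkin (?S q q) = 1" using F(2) lazutkin_facts(1) lazutkin_facts(2)[of 0] by simp
    show "\<bar>lazutkin (?S q (Suc j)) - lazutkin (?S q j) - 1 / real q\<bar> \<le> 2000000 * \<epsilon> / real q ^ 3" if "j < q" for j
      by (rule orbit_sampling(1)[OF max[OF q] q e1 that])
    show "\<bar>e q j\<bar> \<le> 2000000 * \<epsilon> / (real q)\<^sup>2" if "j < q" for j
      unfolding e_def by (rule orbit_sampling(2)[OF max[OF q] q e1 that])
    have s0: "\<sigma> q 0 = 0" using max[OF q] by (simp add: is_Lq_max_def adm_def)
    have "(\<Sum>j<q. u (lazutkin (?S q j)) * (1 + e q j)) = (\<Sum>j<q. d (?S q j) * sin (out_angle (?S q j) (?S q (Suc j))) / ?c q)"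
    proof (rule sum.cong)
      fix j
      show "u (lazutkin (?S q j)) * (1 + e q j) = d (?S q j) * sin (out_angle (?S q j) (?S q (Suc j))) / ?c q"
        unfolding ux e_def F_def[symmetric] using F0[of "?S q j"] by simp
    qed simp
    also have "\<dots> = ellq \<gamma> q (\<sigma> q) d / ?c q"
      unfolding ellq_full_orbit[where s = "\<sigma> q" and \<nu> = d, OF q s0 per] by (simp only: sum_divide_distrib)
    also have "\<dots> = 0" using lq[OF q] by simp
    finally show "(\<Sum>j<q. u (lazutkin (?S q j)) * (1 + e q j)) = 0" .
  qed (use eps eps' in auto)
  then show ?thesis unfolding ux using F0[of s] by simp
qed

end

theorem theorem4p8:
  shows "\<exists>\<delta>>0. \<forall>\<Omega> c \<gamma> \<sigma>. marked_sym_domain 8 \<delta> \<Omega> c \<gamma> \<longrightarrow>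
           (\<forall>q\<ge>2. is_Lq_max \<gamma> q (\<sigma> q)) \<longrightarrow>
           inj_on (T_op \<gamma> \<sigma>) {\<nu>. Csym 8 \<nu>}"
proof (intro exI[of _ "1 / 10 ^ 17"] conjI allI impI)
  fix \<Omega> c \<gamma> \<sigma>
  assume dom: "marked_sym_domain 8 (1 / 10 ^ 17) \<Omega> c \<gamma>" and max: "\<forall>q\<ge>2. is_Lq_max \<gamma> q (\<sigma> q)"
  define \<delta> :: real where "\<delta> = 1 / 10 ^ 17"
  have g: "perim1_arclen (8 + 1) ((\<lambda>z. c *\<^sub>R z) ` \<Omega>) \<gamma>" using dom by (simp add: marked_sym_domain_def)
  then have ck: "Ck 9 \<gamma>" and gper: "\<And>s. \<gamma> (s + 1) = \<gamma> s" and gu: "\<And>s. norm (vd 1 \<gamma> s) = 1"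
    by (auto simp: perim1_arclen_def simp del: vd.simps)
  obtain p v where v: "norm v = 1" "\<And>s. \<gamma> (- s) = reflection (c *\<^sub>R p) v (\<gamma> s)"
    using dom unfolding marked_sym_domain_def by blast
  have near: "\<exists>T. norm T = 1 \<and> (\<forall>k\<le>4. norm (vd (Suc k) \<gamma> s - (2 * pi * \<i>) ^ k * T) \<le> \<delta>)" for s
  proof -
    have "\<delta> \<le> 1/10" by (simp add: \<delta>_def)
    from near_circle_derivatives[OF dom[folded \<delta>_def] this, of s]
    show ?thesis by (meson le_trans numeral_le_iff one_le_numeral semiring_norm(68) semiring_norm(71) semiring_norm(76) semiring_norm(78))
  qed
  have \<delta>': "12000 * \<delta> \<le> 1 / 1000" by (simp add: \<delta>_def)
  have m: "(5::nat) \<le> 9" by simp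
  obtain f f1 f2 f3 X G \<theta> where nc: "near_circle f f1 f2 f3 X G (12000 * \<delta>) \<gamma> \<theta> (curvature \<gamma>) (curv_d1 \<gamma>) (vd 1 \<gamma> 0)"
    using near_circle_construct[OF ck m gper gu near v \<delta>'] by blast
  interpret near_circle f f1 f2 f3 X G "12000 * \<delta>" \<gamma> \<theta> "curvature \<gamma>" "curv_d1 \<gamma>" "vd 1 \<gamma> 0" by (rule nc)
  show "inj_on (T_op \<gamma> \<sigma>) {\<nu>. Csym 8 \<nu>}"
  proof (rule inj_onI)
    fix \<nu> \<mu> assume "\<nu> \<in> {\<nu>. Csym 8 \<nu>}" "\<mu> \<in> {\<nu>. Csym 8 \<nu>}" and T: "T_op \<gamma> \<sigma> \<nu> = T_op \<gamma> \<sigma> \<mu>"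
    then have cn: "Ck 8 \<nu>" "Ck 8 \<mu>" and sy: "\<And>s. \<nu> (s + 1) = \<nu> s" "\<And>s. \<nu> (- s) = \<nu> s" "\<And>s. \<mu> (s + 1) = \<mu> s" "\<And>s. \<mu> (- s) = \<mu> s"
      by (auto simp: Csym_def)
    define d where "d s = \<nu> s - \<mu> s" for s
    have dv: "(vd k h has_real_derivative vd (Suc k) h s) (at s)" if "Ck 8 h" "k < 8" for h :: "real \<Rightarrow> real" and k s
      using Ck_has_vd[OF that] by (simp add: has_real_derivative_iff_has_vector_derivative del: vd.simps)
    have c0: "continuous_on A h" if "Ck 8 h" for h :: "real \<Rightarrow> real" and A using Ck_continuous_vd[OF that, of 0 A] by simp
    have ck0: "continuous_on A (curvature \<gamma>)" for A
      using DERIV_continuous_on[of A "curvature \<gamma>" "curv_d1 \<gamma>"] d\<kappa> has_field_derivative_at_within by blast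
    have "d s = 0" for s
    proof (rule injective_core[where d = d and da = "\<lambda>s. vd 1 \<nu> s - vd 1 \<mu> s" and db = "\<lambda>s. vd 2 \<nu> s - vd 2 \<mu> s" and \<sigma> = \<sigma>])
      \<comment> \<open>The most demanding requirement on \<open>\<delta>\<close>; the others ask
        only for \<open>1/10\<close> and for \<open>12000 * \<delta> \<le> 1 / 1000\<close>.\<close>
      show "12000 * \<delta> \<le> 5 / 10 ^ 12" by (simp add: \<delta>_def)
      show "is_Lq_max \<gamma> q (\<sigma> q)" if "2 \<le> q" for q using max that by blast
      show "d (s + 1) = d s" "d (- s) = d s" for s by (simp_all add: d_def sy)
      show "(d has_real_derivative vd 1 \<nu> s - vd 1 \<mu> s) (at s)" for s
        unfolding d_def[abs_def] using DERIV_diff[OF dv[OF cn(1), of 0 s] dv[OF cn(2), of 0 s]] by simp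
      show "((\<lambda>s. vd 1 \<nu> s - vd 1 \<mu> s) has_real_derivative vd 2 \<nu> s - vd 2 \<mu> s) (at s)" for s
        using DERIV_diff[OF dv[OF cn(1), of 1 s] dv[OF cn(2), of 1 s]] by (simp add: numeral_2_eq_2 del: vd.simps)
      show "continuous_on UNIV (\<lambda>s. vd 2 \<nu> s - vd 2 \<mu> s)"
        by (intro continuous_intros Ck_continuous_vd[OF cn(1)] Ck_continuous_vd[OF cn(2)]) auto
      have "ell0 \<gamma> h = integral {0..1} (\<lambda>s. h s * curvature \<gamma> s)" for h by (simp add: ell0_def radius_curv_def)
      then have "integral {0..1} (\<lambda>s. \<nu> s * curvature \<gamma> s) = integral {0..1} (\<lambda>s. \<mu> s * curvature \<gamma> s)"
        using fun_cong[OF T, of 0] by (simp add: T_op_def)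
      moreover have "integral {0..1} (\<lambda>s. d s * curvature \<gamma> s) = integral {0..1} (\<lambda>s. \<nu> s * curvature \<gamma> s) - integral {0..1} (\<lambda>s. \<mu> s * curvature \<gamma> s)"
        unfolding d_def left_diff_distrib
        by (intro integral_diff integrable_continuous_interval continuous_intros c0[OF cn(1)] c0[OF cn(2)] ck0)
      ultimately show "integral {0..1} (\<lambda>s. d s * curvature \<gamma> s) = 0" by simp
      show "d 0 = 0" using fun_cong[OF T, of 1] by (simp add: T_op_def d_def)
      show "ellq \<gamma> q (\<sigma> q) d = 0" if "2 \<le> q" for q
      proof -
        have "ellq \<gamma> q (\<sigma> q) d = ellq \<gamma> q (\<sigma> q) \<nu> - ellq \<gamma> q (\<sigma> q) \<mu>"
          unfolding ellq_def d_def left_diff_distrib by (rule sum_subtractf)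
        then show ?thesis using fun_cong[OF T, of q] that by (simp add: T_op_def)
      qed
    qed
    then show "\<nu> = \<mu>" by (auto simp: d_def)
  qed
qed simp

end
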